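(* Let $N\ge2$, $R>0$, and let $f:[0,\infty)\to[0,\infty)$ satisfy $(f_1)$, $(f_2)$, $(f_3)$ (listed in the context). Suppose $f$ is super-exponential. Let $u$ be a solution of $(P_R^* )$, and let $\alpha\ge0$ be such that $u$ is a solution of $(P_{\alpha,R})$. Then $\alpha=0$.
   Context: $B_R\subset\mathbb R^N$ is the open ball of radius $R$ centred at $0$; $\Delta_N u=\operatorname{div}(|\nabla u|^{N-2}\nabla u)$; $\delta_0$ is the Dirac mass at $0$. $L^\infty_{\rm loc}(\overline B_R\setminus\{0\})$ denotes functions essentially bounded on compact subsets of $\overline B_R\setminus\{0\}$. Standing assumptions on $f$: $(f_1)$ $f$ is locally Hölder continuous on $[0,\infty)$ with some exponent $\theta\in(0,1)$; $(f_2)$ $\liminf_{t\to\infty}f(t)t^{1-N}>0$; $(f_3)$ there is $\kappa>0$ such that $t\mapsto f(t)+\kappa t^{N-1}$ is non-decreasing on $[0,\infty)$. $f$ is sub-exponential if there is $\beta>0$ with $\sup_{t\ge0}f(t)e^{-\beta t}<\infty$; it is super-exponential if it is not sub-exponential. A solution of $(P_R^* )$ is a radial function $u\ge0$ on $B_R\setminus\{0\}$, $u\in L^\infty_{\rm loc}(\overline B_R\setminus\{0\})$, weakly differentiable with $|\nabla u|\in L^{N-1}_{\rm loc}(B_R\setminus\{0\})$, with $-\Delta_N u=f(u)$ in $\mathcal D'(B_R\setminus\{0\})$, i.e. $\int|\nabla u|^{N-2}\nabla u\cdot\nabla\phi\,dx=\int f(u)\phi\,dx$ for all $\phi\in C_0^\infty(B_R\setminus\{0\})$.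 $u\ge 0$ is a solution of $(P_{\alpha,R})$ if $u\in L^1_{\rm loc}(B_R)$, $|\nabla u|\in L^{N-1}_{\rm loc}(B_R)$, $f(u)\in L^\infty_{\rm loc}(\overline B_R\setminus\{0\})\cap L^1(B_R)$ and $-\Delta_N u=f(u)+\alpha\delta_0$ in $\mathcal D'(B_R)$, i.e. $\int_{B_R}|\nabla u|^{N-2}\nabla u\cdot\nabla\phi\,dx=\int_{B_R}f(u)\phi\,dx+\alpha\phi(0)$ for all $\phi\in C_0^\infty(B_R)$. (It is known, by Brezis–Lions for $N=2$ and Véron for $N>2$, that every solution $u$ of $(P^*_R)$ lies in $W^{1,p}(B_R)$ for all $1\le p<N$ and solves $(P_{\alpha,R})$ for some $\alpha\ge0$.) *)

theory Defs
  imports "HOL-Analysis.Analysis"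
begin

section \<open>The nonlinearity\<close>

text \<open>A nonlinearity $f : [0,\infty) \to [0,\infty)$ is represented by a total function on the
  reals; every condition below constrains it on \<open>{0..}\<close> only.\<close>

definition locally_holder_on :: "real set \<Rightarrow> real \<Rightarrow> (real \<Rightarrow> real) \<Rightarrow> bool" where
  "locally_holder_on S \<theta> f \<longleftrightarrow>
     (\<forall>K. compact K \<and> K \<subseteq> S \<longrightarrow>
        (\<exists>C. \<forall>s\<in>K. \<forall>t\<in>K. \<bar>f s - f t\<bar> \<le> C * \<bar>s - t\<bar> powr \<theta>))"

definition cond_f1 :: "(real \<Rightarrow> real) \<Rightarrow> bool" where
  "cond_f1 f \<longleftrightarrow> (\<exists>\<theta>. 0 < \<theta> \<and> \<theta> < 1 \<and> locally_holder_on {0..} \<theta> f)"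

definition cond_f2 :: "nat \<Rightarrow> (real \<Rightarrow> real) \<Rightarrow> bool" where
  "cond_f2 N f \<longleftrightarrow> Liminf at_top (\<lambda>t. ereal (f t * t powr (1 - real N))) > 0"

definition cond_f3 :: "nat \<Rightarrow> (real \<Rightarrow> real) \<Rightarrow> bool" where
  "cond_f3 N f \<longleftrightarrow> (\<exists>\<kappa>>0. mono_on {0..} (\<lambda>t. f t + \<kappa> * t ^ (N - 1)))"

definition sub_exponential :: "(real \<Rightarrow> real) \<Rightarrow> bool" where
  "sub_exponential f \<longleftrightarrow> (\<exists>\<beta>>0. bdd_above ((\<lambda>t. f t * exp (- \<beta> * t)) ` {0..}))"

definition super_exponential :: "(real \<Rightarrow> real) \<Rightarrow> bool" where
  "super_exponential f \<longleftrightarrow> \<not> sub_exponential f"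


section \<open>Test functions\<close>

definition partial_deriv :: "'n \<Rightarrow> (real ^ 'n \<Rightarrow> real) \<Rightarrow> real ^ 'n \<Rightarrow> real" where
  "partial_deriv i \<phi> x = frechet_derivative \<phi> (at x) (axis i 1)"

definition grad :: "(real ^ 'n \<Rightarrow> real) \<Rightarrow> real ^ 'n \<Rightarrow> real ^ 'n" where
  "grad \<phi> x = (\<chi> i. partial_deriv i \<phi> x)"

primrec C_k :: "nat \<Rightarrow> (real ^ 'n \<Rightarrow> real) \<Rightarrow> bool" where
  "C_k 0 \<phi> \<longleftrightarrow> continuous_on UNIV \<phi>"
| "C_k (Suc k) \<phi> \<longleftrightarrow> \<phi> differentiable_on UNIV \<and> (\<forall>i. C_k k (partial_deriv i \<phi>))"

text \<open>The space $C_0^\infty(\Omega)$; its members are extended by zero to the whole space.\<close>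

definition test_functions :: "(real ^ 'n) set \<Rightarrow> (real ^ 'n \<Rightarrow> real) set" where
  "test_functions \<Omega> =
     {\<phi>. (\<forall>k. C_k k \<phi>) \<and> compact (closure {x. \<phi> x \<noteq> 0}) \<and> closure {x. \<phi> x \<noteq> 0} \<subseteq> \<Omega>}"


section \<open>Local Lebesgue spaces and weak gradients\<close>

definition Lp_loc :: "nat \<Rightarrow> (real ^ 'n) set \<Rightarrow> (real ^ 'n \<Rightarrow> 'b::euclidean_space) \<Rightarrow> bool" where
  "Lp_loc p S g \<longleftrightarrow>
     (\<forall>K. compact K \<and> K \<subseteq> S \<longrightarrow>
        set_borel_measurable lebesgue K g \<and> set_integrable lebesgue K (\<lambda>x. norm (g x) ^ p))"

definition Linf_loc :: "(real ^ 'n) set \<Rightarrow> (real ^ 'n \<Rightarrow> real) \<Rightarrow> bool" where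
  "Linf_loc S g \<longleftrightarrow>
     (\<forall>K. compact K \<and> K \<subseteq> S \<longrightarrow>
        set_borel_measurable lebesgue K g \<and> (\<exists>C. AE x in lebesgue. x \<in> K \<longrightarrow> \<bar>g x\<bar> \<le> C))"

definition has_weak_gradient ::
    "(real ^ 'n) set \<Rightarrow> (real ^ 'n \<Rightarrow> real) \<Rightarrow> (real ^ 'n \<Rightarrow> real ^ 'n) \<Rightarrow> bool" where
  "has_weak_gradient \<Omega> u v \<longleftrightarrow>
     Lp_loc 1 \<Omega> u \<and> Lp_loc 1 \<Omega> v \<and>
     (\<forall>\<phi>\<in>test_functions \<Omega>. \<forall>i.
        (LINT x:\<Omega>|lebesgue. u x * partial_deriv i \<phi> x) = - (LINT x:\<Omega>|lebesgue. (v x $ i) * \<phi> x))"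


section \<open>The two problems\<close>

text \<open>Functions are understood up to Lebesgue null sets, so radiality and nonnegativity are
  required almost everywhere. The weak gradient is unique almost everywhere, so quantifying
  it existentially involves no choice. The $N$-Laplace operator enters through its flux.\<close>

definition radial_on :: "(real ^ 'n) set \<Rightarrow> (real ^ 'n \<Rightarrow> real) \<Rightarrow> bool" where
  "radial_on S u \<longleftrightarrow> (\<exists>g. AE x in lebesgue. x \<in> S \<longrightarrow> u x = g (norm x))"

definition N_flux :: "real ^ 'n \<Rightarrow> real ^ 'n" where
  "N_flux \<xi> = norm \<xi> ^ (CARD('n) - 2) *\<^sub>R \<xi>"

definition solves_P_star ::
    "(real \<Rightarrow> real) \<Rightarrow> real \<Rightarrow> (real ^ 'n \<Rightarrow> real) \<Rightarrow> bool" where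
  "solves_P_star f R u \<longleftrightarrow>
     (let \<Omega> = ball 0 R - {0} in
       radial_on \<Omega> u \<and>
       (AE x in lebesgue. x \<in> \<Omega> \<longrightarrow> 0 \<le> u x) \<and>
       Linf_loc (cball 0 R - {0}) u \<and>
       (\<exists>v. has_weak_gradient \<Omega> u v \<and>
            Lp_loc (CARD('n) - 1) \<Omega> v \<and>
            (\<forall>\<phi>\<in>test_functions \<Omega>.
               (LINT x:\<Omega>|lebesgue. N_flux (v x) \<bullet> grad \<phi> x)
               = (LINT x:\<Omega>|lebesgue. f (u x) * \<phi> x))))"

definition solves_P_alpha ::
    "(real \<Rightarrow> real) \<Rightarrow> real \<Rightarrow> real \<Rightarrow> (real ^ 'n \<Rightarrow> real) \<Rightarrow> bool" where
  "solves_P_alpha f \<alpha> R u \<longleftrightarrow>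
     (let B = ball 0 R in
       (AE x in lebesgue. x \<in> B \<longrightarrow> 0 \<le> u x) \<and>
       Lp_loc 1 B u \<and>
       Linf_loc (cball 0 R - {0}) (\<lambda>x. f (u x)) \<and>
       set_integrable lebesgue B (\<lambda>x. f (u x)) \<and>
       (\<exists>v. has_weak_gradient B u v \<and>
            Lp_loc (CARD('n) - 1) B v \<and>
            (\<forall>\<phi>\<in>test_functions B.
               (LINT x:B|lebesgue. N_flux (v x) \<bullet> grad \<phi> x)
               = (LINT x:B|lebesgue. f (u x) * \<phi> x) + \<alpha> * \<phi> 0)))"

end

theory Submission
  imports Defs
begin

text \<open>
  Since \<open>u\<close> is radial, so are its mollifications with radial kernels, and their gradients are
  radial multiples of \<open>x\<close>; passing to an almost everywhere limit, the weak gradient of \<open>u\<close> is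
  \<open>H(|x|) x / |x|\<close>. Testing the equation with radial functions shows that the flux
  \<open>- |H|\<^sup>N\<^sup>-\<^sup>2 H\<close> through the sphere of radius \<open>r\<close> is at least \<open>\<alpha>\<close>, whence \<open>- H(r) \<ge> c / r\<close>, with
  \<open>c > 0\<close> if \<open>\<alpha> > 0\<close>. The weak gradient tested with \<open>\<zeta>(|x|\<^sup>2) x\<close> turns this into
  \<open>u(x) \<ge> C - c ln |x|\<close> near the origin. By monotonicity of \<open>M(t) = f(t) + \<kappa> t\<^sup>N\<^sup>-\<^sup>1\<close>,
  \<open>M(C - c ln r) |B\<^sub>r|\<close> is bounded by the integral of \<open>M(u)\<close>, which is finite because \<open>t\<^sup>N\<^sup>-\<^sup>1\<close> is
  dominated by \<open>f(t) + 1\<close>. Thus \<open>f(t)\<close> grows at most like \<open>exp(N t / c)\<close>.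
\<close>

section \<open>Smooth functions on the line\<close>

text \<open>Since \<open>u\<close> and its gradient are given only almost everywhere and in the weak
  sense, there is no radial ODE to start from: each pointwise inequality for a radial profile is
  first obtained in integrated form against bumps and then localised. The profile \<open>g\<close>
  given by radiality need not even be measurable; the mollifiers repair this, and their exact
  symmetry comes from the orthogonal invariance of Lebesgue measure. All test functions are built
  from smooth functions of |x|^2, which stay smooth at the origin. Two kinds occur: plateaus around
  0, which see the mass \<alpha> at 0, and fields vanishing near 0, for which the singular weight
  |x|^(-N) that cancels the Jacobian r^(N-1) is harmless. The equation enters as an inequality
  because f(u) >= 0 has a favourable sign. With S the area of the unit sphere, S c^(N-1) = \<alpha>
  fixes c. Monotonicity is taken from \<open>M\<close> because f itself may oscillate. Finally t = C
  - c ln r means r = exp ((C - t) / c), so the volume r^N is what produces the rate N / c.\<close>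

primrec diff_k :: "nat \<Rightarrow> (real \<Rightarrow> real) \<Rightarrow> bool" where
  "diff_k 0 f \<longleftrightarrow> True"
| "diff_k (Suc k) f \<longleftrightarrow> (\<forall>t. f differentiable (at t)) \<and> diff_k k (deriv f)"

text \<open>Order 0 of \<open>diff_k\<close> asks for nothing, not even continuity. Requiring every
  order makes each derivative differentiable, hence continuous.\<close>

definition smooth :: "(real \<Rightarrow> real) \<Rightarrow> bool" where
  "smooth f \<longleftrightarrow> (\<forall>k. diff_k k f)"

lemma smooth_deriv: "smooth f \<Longrightarrow> smooth (deriv f)"
  unfolding smooth_def by (metis diff_k.simps(2))

lemma smooth_DERIV: "smooth f \<Longrightarrow> (f has_real_derivative deriv f t) (at t)"
  unfolding smooth_def
  by (metis diff_k.simps(2) DERIV_deriv_iff_real_differentiable)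

lemma smooth_continuous: "smooth f \<Longrightarrow> continuous_on S f"
  by (meson DERIV_isCont continuous_at_imp_continuous_on smooth_DERIV)

lemma diff_k_SucI:
  assumes "\<And>t. (f has_real_derivative f' t) (at t)" and "diff_k k f'"
  shows "diff_k (Suc k) f"
proof -
  have "deriv f = f'" using assms(1) DERIV_imp_deriv by blast
  with assms show ?thesis using real_differentiable_def by auto
qed

lemma smoothI:
  assumes "\<And>t. (f has_real_derivative f' t) (at t)" and "smooth f'"
  shows "smooth f"
  unfolding smooth_def
proof
  fix k show "diff_k k f"
  proof (cases k)
    case (Suc j)
    then show ?thesis using diff_k_SucI[OF assms(1)] assms(2) unfolding smooth_def by blast
  qed simp
qed

lemma smooth_const: "smooth (\<lambda>_. c)"
proof -
  have "diff_k k (\<lambda>_. c)" for k c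
    by (induction k arbitrary: c) (auto intro: diff_k_SucI[where f' = "\<lambda>_. 0"] simp del: diff_k.simps(2))
  then show ?thesis unfolding smooth_def by blast
qed

lemma diff_k_mono: "diff_k (Suc k) f \<Longrightarrow> diff_k k f"
  by (induction k arbitrary: f) auto

lemma diff_k_add: "diff_k k f \<Longrightarrow> diff_k k g \<Longrightarrow> diff_k k (\<lambda>t. f t + g t)"
proof (induction k arbitrary: f g)
  case (Suc k)
  then have "(f has_real_derivative deriv f t) (at t)" "(g has_real_derivative deriv g t) (at t)" for t
    by (auto simp: DERIV_deriv_iff_real_differentiable)
  then have "((\<lambda>t. f t + g t) has_real_derivative deriv f t + deriv g t) (at t)" for t
    by (rule DERIV_add)
  then show ?case
    by (rule diff_k_SucI) (use Suc in auto)
qed simp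

lemma diff_k_mult: "diff_k k f \<Longrightarrow> diff_k k g \<Longrightarrow> diff_k k (\<lambda>t. f t * g t)"
proof (induction k arbitrary: f g)
  case (Suc k)
  then have "(f has_real_derivative deriv f t) (at t)" "(g has_real_derivative deriv g t) (at t)" for t
    by (auto simp: DERIV_deriv_iff_real_differentiable)
  then have "((\<lambda>t. f t * g t) has_real_derivative deriv f t * g t + deriv g t * f t) (at t)" for t
    by (rule DERIV_mult)
  then show ?case
    by (rule diff_k_SucI) (use Suc diff_k_mono in \<open>auto intro!: diff_k_add\<close>)
qed simp

lemma smooth_add: "smooth f \<Longrightarrow> smooth g \<Longrightarrow> smooth (\<lambda>t. f t + g t)"
  unfolding smooth_def using diff_k_add by blast

lemma smooth_mult: "smooth f \<Longrightarrow> smooth g \<Longrightarrow> smooth (\<lambda>t. f t * g t)"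
  unfolding smooth_def using diff_k_mult by blast

lemma smooth_cmult: "smooth f \<Longrightarrow> smooth (\<lambda>t. c * f t)"
  by (rule smooth_mult[OF smooth_const])

lemma smooth_affine:
  assumes "smooth f" shows "smooth (\<lambda>t. f (c * t + d))"
proof -
  have "diff_k k (\<lambda>t. f (c * t + d))" if "smooth f" for k f
    using that
  proof (induction k arbitrary: f)
    case (Suc k)
    have "((\<lambda>t. f (c * t + d)) has_real_derivative c * deriv f (c * t + d)) (at t)" for t
    proof -
      have "((\<lambda>t. c * t + d) has_real_derivative c) (at t)"
        by (auto intro!: derivative_eq_intros)
      from DERIV_chain2[OF smooth_DERIV[OF Suc.prems] this] show ?thesis
        by (simp add: mult.commute)
    qed
    then show ?case
      by (rule diff_k_SucI) (use Suc smooth_deriv smooth_const smooth_def in \<open>auto intro!: diff_k_mult\<close>)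
  qed simp
  with assms show ?thesis unfolding smooth_def by blast
qed

section \<open>Flat exponentials, bumps and singular powers\<close>

definition expinv :: "real poly \<Rightarrow> real \<Rightarrow> real" where
  "expinv P t = (if t > 0 then poly P (1 / t) * exp (- 1 / t) else 0)"

lemma poly_exp_minus_tendsto_0: "((\<lambda>s::real. poly P s * exp (- s)) \<longlongrightarrow> 0) at_top"
proof -
  have "((\<lambda>s::real. \<Sum>i\<le>degree P. coeff P i * (s ^ i / exp s)) \<longlongrightarrow> (\<Sum>i\<le>degree P. coeff P i * 0)) at_top"
    by (intro tendsto_intros tendsto_power_div_exp_0)
  then show ?thesis
    by (simp add: poly_altdef sum_distrib_right exp_minus divide_inverse mult.assoc)
qed

text \<open>The polynomial parameter makes the family closed under differentiation, also at the
  gluing point 0, so an induction over the order with \<open>P\<close> arbitrary suffices.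
  \<open>P = 1\<close> gives the classical flat function.\<close>

lemma smooth_expinv: "smooth (expinv P)"
proof -
  \<comment> \<open>In the variable s = 1/t one has d/dt = - s^2 d/ds, which sends P(s) exp(-s) to
    s^2 (P(s) - P'(s)) exp(-s).\<close>
  have D: "(expinv P has_real_derivative expinv (monom 1 2 * (P - pderiv P)) t) (at t)" for t P
  proof (cases t "0::real" rule: linorder_cases)
    case less
    have "eventually (\<lambda>x. x < 0) (nhds t)"
      using less by (simp add: eventually_nhds_in_open[of "{..<0}", simplified])
    then have "eventually (\<lambda>x. 0 = expinv P x) (nhds t)"
      by eventually_elim (simp add: expinv_def)
    from DERIV_cong_ev[OF refl this refl, of 0] have "(expinv P has_real_derivative 0) (at t)"
      by simp
    then show ?thesis
      using less by (simp add: expinv_def[of _ t])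
  next
    case equal
    \<comment> \<open>The right difference quotient at 0 is s P(s) exp(-s) with s = 1/h, and
      \<open>pCons 0 P\<close> is the polynomial s P(s).\<close>
    have "((\<lambda>h. poly (pCons 0 P) (inverse h) * exp (- inverse h)) \<longlongrightarrow> 0) (at_right (0::real))"
      by (rule filterlim_compose[OF poly_exp_minus_tendsto_0 filterlim_inverse_at_top_right])
    then have "((\<lambda>h. (expinv P h - expinv P 0) / h) \<longlongrightarrow> 0) (at_right 0)"
      by (rule Lim_transform_eventually)
        (auto simp: expinv_def eventually_at_filter field_simps)
    moreover have "((\<lambda>h. (expinv P h - expinv P 0) / h) \<longlongrightarrow> 0) (at_left 0)"
      by (rule Lim_transform_eventually[OF tendsto_const[of 0]])
        (auto simp: expinv_def eventually_at_filter)
    ultimately show ?thesis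
      using equal by (simp add: DERIV_def filterlim_split_at expinv_def)
  next
    case greater
    have D1: "((\<lambda>t. poly P (1 / t) * exp (- 1 / t)) has_real_derivative 
        poly (monom 1 2 * (P - pderiv P)) (1/t) * exp (- 1 / t)) (at t)"
      using greater
      by (auto intro!: derivative_eq_intros DERIV_chain2[OF poly_DERIV] 
          simp: field_simps power2_eq_square poly_monom)
    have "eventually (\<lambda>x. x > 0) (nhds t)"
      using greater by (simp add: eventually_nhds_in_open[of "{0<..}", simplified])
    then have "eventually (\<lambda>x. poly P (1 / x) * exp (- 1 / x) = expinv P x) (nhds t)"
      by eventually_elim (simp add: expinv_def)
    from DERIV_cong_ev[OF refl this refl] show ?thesis
      using D1 greater by (simp add: expinv_def[of _ t])
  qed
  have "diff_k k (expinv P)" for k P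
    by (induction k arbitrary: P) (auto intro: diff_k_SucI[OF D] simp del: diff_k.simps(2))
  then show ?thesis unfolding smooth_def by blast
qed

text \<open>The factor \<open>Suc n\<close> does not rescale the height: it drives both exponents to
  0, so that the bumps tend to the indicator of the open interval while staying below 1. This makes
  indicators accessible as test functions by dominated convergence.\<close>

definition bump :: "real \<Rightarrow> real \<Rightarrow> nat \<Rightarrow> real \<Rightarrow> real" where
  "bump a b n t = expinv 1 (real (Suc n) * t - real (Suc n) * a) * expinv 1 (real (Suc n) * b - real (Suc n) * t)"

lemma bump_eq:
  "bump a b n t = (if a < t \<and> t < b then exp (- 1 / (real (Suc n) * (t - a))) * exp (- 1 / (real (Suc n) * (b - t))) else 0)"
  unfolding bump_def expinv_def by (auto simp: right_diff_distrib[symmetric] zero_less_mult_iff)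

lemma smooth_bump: "smooth (bump a b n)"
proof -
  have "smooth (\<lambda>t. expinv 1 (real (Suc n) * t + - (real (Suc n) * a)) * expinv 1 (- real (Suc n) * t + real (Suc n) * b))"
    by (intro smooth_mult smooth_affine smooth_expinv)
  moreover have "(\<lambda>t. expinv 1 (real (Suc n) * t + - (real (Suc n) * a)) * expinv 1 (- real (Suc n) * t + real (Suc n) * b)) = bump a b n"
    unfolding bump_def by (intro ext) (simp add: algebra_simps)
  ultimately show ?thesis by simp
qed

lemma bump_nonneg: "0 \<le> bump a b n t" and bump_le_1: "bump a b n t \<le> 1"
  unfolding bump_eq by (auto intro!: mult_le_one)

lemma bump_pos: "a < t \<Longrightarrow> t < b \<Longrightarrow> 0 < bump a b n t"
  unfolding bump_eq by auto

lemma bump_eq_0: "t \<le> a \<or> b \<le> t \<Longrightarrow> bump a b n t = 0"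
  unfolding bump_eq by auto

lemma bump_tendsto: "(\<lambda>n. bump a b n t) \<longlonglongrightarrow> indicator {a<..<b} t"
proof (cases "a < t \<and> t < b")
  case True
  have "(\<lambda>n. exp (- 1 / (real (Suc n) * d))) \<longlonglongrightarrow> 1" if "d > 0" for d :: real
  proof -
    have "(\<lambda>n. exp (- inverse (real (Suc n)) * inverse d)) \<longlonglongrightarrow> exp (- 0 * inverse d)"
      by (intro tendsto_intros LIMSEQ_inverse_real_of_nat)
    then show ?thesis by (simp add: field_simps)
  qed
  from tendsto_mult[OF this[of "t - a"] this[of "b - t"]] True show ?thesis
    by (simp add: bump_eq)
qed (auto simp: bump_eq)

text \<open>The power is singular only at 0, where \<open>\<psi>\<close> has already vanished.
  Differentiation produces two terms of the same form, with exponents s - 1 and s, and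
  \<open>deriv \<psi>\<close> again vanishes below \<open>a\<close>; hence the induction over all
  exponents and all such \<open>\<psi>\<close>.\<close>

lemma smooth_powr_mult:
  assumes "smooth \<psi>" "a > 0" "\<And>t. t < a \<Longrightarrow> \<psi> t = 0"
  shows "smooth (\<lambda>t. t powr s * \<psi> t)"
proof -
  have "diff_k k (\<lambda>t. t powr s * \<psi> t)" if "smooth \<psi>" "\<And>t. t < a \<Longrightarrow> \<psi> t = 0" for k s \<psi>
    using that
  proof (induction k arbitrary: s \<psi>)
    case (Suc k)
    have z: "deriv \<psi> t = 0" if "t < a" for t
    proof -
      have "eventually (\<lambda>x. x < a) (nhds t)"
        using that by (simp add: eventually_nhds_in_open[of "{..<a}", simplified])
      then have "eventually (\<lambda>x. 0 = \<psi> x) (nhds t)"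
        by eventually_elim (simp add: Suc.prems)
      from DERIV_cong_ev[OF refl this refl, of 0] show ?thesis
        by (simp add: DERIV_imp_deriv)
    qed
    have "((\<lambda>t. t powr s * \<psi> t) has_real_derivative 
        t powr (s - 1) * (s * \<psi> t) + t powr s * deriv \<psi> t) (at t)" for t
    \<comment> \<open>Splitting at a/2 instead of a leaves room: above a/2 the power is
      differentiable, and every point up to a/2 has a neighbourhood on which the product is
      0.\<close>
    proof (cases "t > a/2")
      case True
      then show ?thesis using assms(2)
        by (auto intro!: derivative_eq_intros smooth_DERIV[OF Suc.prems(1)] simp: mult_ac)
    next
      case False
      have "eventually (\<lambda>x. x < a) (nhds t)"
        using False assms(2) by (simp add: eventually_nhds_in_open[of "{..<a}", simplified])
      then have "eventually (\<lambda>x. 0 = x powr s * \<psi> x) (nhds t)"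
        by eventually_elim (simp add: Suc.prems)
      from DERIV_cong_ev[OF refl this refl, of 0] show ?thesis
        using False assms(2) by (simp add: Suc.prems z)
    qed
    then show ?case
      by (rule diff_k_SucI)
        (use Suc z in \<open>auto intro!: diff_k_add Suc.IH smooth_cmult smooth_deriv\<close>)
  qed simp
  with assms show ?thesis unfolding smooth_def by blast
qed

section \<open>Radial test functions\<close>

lemma grad_nth: "grad \<phi> x $ i = partial_deriv i \<phi> x"
  by (simp add: grad_def)

lemma partial_deriv_eqI:
  "(\<phi> has_derivative D) (at x) \<Longrightarrow> partial_deriv i \<phi> x = D (axis i 1)"
  unfolding partial_deriv_def by (metis frechet_derivative_at)

lemma C_k_mono: "C_k (Suc k) \<phi> \<Longrightarrow> C_k k \<phi>"
proof (induction k arbitrary: \<phi>)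
  case 0
  then show ?case by (simp add: differentiable_imp_continuous_on)
next
  case (Suc k)
  then show ?case by auto
qed

lemma C_k_SucI:
  assumes "\<And>x. (\<phi> has_derivative D x) (at x)" and "\<And>i. C_k k (\<lambda>x. D x (axis i 1))"
  shows "C_k (Suc k) \<phi>"
proof -
  have "partial_deriv i \<phi> = (\<lambda>x. D x (axis i 1))" for i
    using partial_deriv_eqI[OF assms(1)] by blast
  moreover have "\<phi> differentiable_on UNIV"
    using assms(1) by (meson differentiable_at_imp_differentiable_on differentiableI)
  ultimately show ?thesis using assms(2) by simp
qed

lemma C_k_has_derivative:
  assumes "C_k (Suc k) \<phi>" shows "(\<phi> has_derivative frechet_derivative \<phi> (at x)) (at x)"
  using assms by (simp add: differentiable_on_def frechet_derivative_works)

lemma C_k_partial: "C_k (Suc k) \<phi> \<Longrightarrow> C_k k (\<lambda>x. frechet_derivative \<phi> (at x) (axis i 1))"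
  by (simp add: partial_deriv_def[abs_def])

lemma C_k_const: "C_k k (\<lambda>_. c)"
  by (induction k arbitrary: c)
    (auto intro: C_k_SucI[where D = "\<lambda>_ _. 0"] simp del: C_k.simps(2))

lemma C_k_add: "C_k k \<phi> \<Longrightarrow> C_k k \<psi> \<Longrightarrow> C_k k (\<lambda>x. \<phi> x + \<psi> x)"
proof (induction k arbitrary: \<phi> \<psi>)
  case 0
  then show ?case by (simp add: continuous_on_add)
next
  case (Suc k)
  show ?case
    by (rule C_k_SucI[OF has_derivative_add[OF Suc.prems[THEN C_k_has_derivative]]])
      (intro Suc.IH Suc.prems[THEN C_k_partial])
qed

lemma C_k_mult: "C_k k \<phi> \<Longrightarrow> C_k k \<psi> \<Longrightarrow> C_k k (\<lambda>x. \<phi> x * \<psi> x)"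
proof (induction k arbitrary: \<phi> \<psi>)
  case 0
  then show ?case by (simp add: continuous_on_mult)
next
  case (Suc k)
  show ?case
    by (rule C_k_SucI[OF has_derivative_mult[OF Suc.prems[THEN C_k_has_derivative]]])
      (intro Suc.IH C_k_add Suc.prems[THEN C_k_partial] Suc.prems[THEN C_k_mono])
qed

lemma C_k_smooth: "smooth h \<Longrightarrow> C_k k \<phi> \<Longrightarrow> C_k k (\<lambda>x. h (\<phi> x))"
proof (induction k arbitrary: h \<phi>)
  case 0
  from 0(2) have "continuous_on UNIV \<phi>" by simp
  with smooth_continuous[OF 0(1), of UNIV] have "continuous_on UNIV (\<lambda>x. h (\<phi> x))"
    using continuous_on_compose2[of UNIV h UNIV \<phi>] by auto
  then show ?case by simp
next
  case (Suc k)
  have "((\<lambda>x. h (\<phi> x)) has_derivative (\<lambda>y. deriv h (\<phi> x) * frechet_derivative \<phi> (at x) y)) (at x)" for x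
    using has_derivative_compose[OF C_k_has_derivative[OF Suc.prems(2)]
        smooth_DERIV[OF Suc.prems(1), unfolded has_field_derivative_def]] .
  then show ?case
    by (rule C_k_SucI) (rule C_k_mult[OF Suc.IH[OF smooth_deriv[OF Suc.prems(1)] C_k_mono[OF Suc.prems(2)]]
        C_k_partial[OF Suc.prems(2)]])
qed

lemma C_k_nth: "C_k k (\<lambda>x::real ^ 'n. x $ i)"
proof (cases k)
  case (Suc j)
  have "((\<lambda>x. x $ i) has_derivative (\<lambda>y. y $ i)) (at x)" for x :: "real ^ 'n"
    by (intro bounded_linear_imp_has_derivative bounded_linear_vec_nth)
  then show ?thesis
    unfolding Suc by (rule C_k_SucI) (rule C_k_const)
qed (auto intro!: continuous_intros)

section \<open>Test functions built from the squared distance\<close>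

lemma has_derivative_norm_sq:
  fixes a x :: "'a::real_inner"
  shows "((\<lambda>x. (norm (x - a))\<^sup>2) has_derivative (\<lambda>y. 2 * ((x - a) \<bullet> y))) (at x)"
  unfolding power2_norm_eq_inner
  by (auto intro!: derivative_eq_intros simp: inner_commute)

text \<open>The square is a polynomial in the coordinates, so composing it with a smooth function of
  one variable needs no flatness condition at the centre, unlike the norm itself.\<close>

lemma C_k_norm_sq: "C_k k (\<lambda>x::real ^ 'n. (norm (x - a))\<^sup>2)"
proof (cases k)
  case (Suc j)
  have "C_k j (\<lambda>x. 2 * (x $ i + - a $ i))" for i
    by (intro C_k_mult C_k_const C_k_add C_k_nth)
  then show ?thesis
    unfolding Suc by (intro C_k_SucI[OF has_derivative_norm_sq]) (simp add: inner_axis)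
qed (auto intro!: continuous_intros)

lemma partial_deriv_radial:
  assumes "smooth h"
  shows "partial_deriv i (\<lambda>x. h ((norm (x - a))\<^sup>2)) x = 2 * (x - a) $ i * deriv h ((norm (x - a))\<^sup>2)"
proof -
  have "((\<lambda>x. h ((norm (x - a))\<^sup>2)) has_derivative 
      (\<lambda>y. deriv h ((norm (x - a))\<^sup>2) * (2 * ((x - a) \<bullet> y)))) (at x)"
    using has_derivative_compose[OF has_derivative_norm_sq
        smooth_DERIV[OF assms, unfolded has_field_derivative_def]] .
  from partial_deriv_eqI[OF this] show ?thesis by (simp add: inner_axis)
qed

lemma test_functionsI:
  assumes "\<And>k. C_k k \<phi>" and "compact K" "K \<subseteq> \<Omega>" and "\<And>x. x \<notin> K \<Longrightarrow> \<phi> x = 0"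
  shows "\<phi> \<in> test_functions \<Omega>"
proof -
  have "closure {x. \<phi> x \<noteq> 0} \<subseteq> K"
    by (intro closure_minimal compact_imp_closed assms) (use assms(4) in blast)
  moreover from this have "compact (closure {x. \<phi> x \<noteq> 0})"
    using compact_Int_closed[OF assms(2) closed_closure] inf.absorb_iff2 by metis
  ultimately show ?thesis
    unfolding test_functions_def using assms(1,3) by blast
qed

lemma radial_test_function:
  assumes "smooth h" and "\<And>t. t \<ge> s\<^sup>2 \<Longrightarrow> h t = 0" and "cball a s \<subseteq> \<Omega>" "s \<ge> 0"
  shows "(\<lambda>x. h ((norm (x - a))\<^sup>2)) \<in> test_functions \<Omega>"
proof (rule test_functionsI[OF C_k_smooth[OF assms(1) C_k_norm_sq] compact_cball assms(3)])
  fix x assume "x \<notin> cball a s"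
  then have "s \<le> norm (x - a)" by (simp add: dist_norm norm_minus_commute)
  from power_mono[OF this assms(4)] show "h ((norm (x - a))\<^sup>2) = 0"
    by (rule assms(2))
qed

text \<open>These are the components of the vector field h(|x|^2) x, which will be tested one at a
  time against the weak partial derivatives of \<open>u\<close>.\<close>

lemma nth_radial_test_function:
  assumes "smooth h" and "\<And>t. t \<ge> s\<^sup>2 \<Longrightarrow> h t = 0" and "cball 0 s \<subseteq> \<Omega>" "s \<ge> 0"
  shows "(\<lambda>x. x $ i * h ((norm x)\<^sup>2)) \<in> test_functions \<Omega>"
proof (rule test_functionsI[OF _ compact_cball assms(3)])
  show "C_k k (\<lambda>x. x $ i * h ((norm x)\<^sup>2))" for k
    using C_k_mult[OF C_k_nth C_k_smooth[OF assms(1) C_k_norm_sq[of _ 0]]] by simp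
  fix x assume "x \<notin> cball (0 :: real ^ 'a) s"
  then have "s \<le> norm x" by simp
  from power_mono[OF this assms(4)] show "x $ i * h ((norm x)\<^sup>2) = 0"
    by (simp add: assms(2))
qed

text \<open>Summed over i, this yields the divergence N h + 2 |x|^2 h' of the field h(|x|^2)
  x.\<close>

lemma partial_deriv_nth_radial:
  assumes "smooth h"
  shows "partial_deriv i (\<lambda>x. x $ i * h ((norm x)\<^sup>2)) x = 
     h ((norm x)\<^sup>2) + 2 * (x $ i)\<^sup>2 * deriv h ((norm x)\<^sup>2)"
proof -
  have "((\<lambda>x. h ((norm x)\<^sup>2)) has_derivative (\<lambda>y. deriv h ((norm x)\<^sup>2) * (2 * (x \<bullet> y)))) (at x)"
    using has_derivative_compose[OF has_derivative_norm_sq[of 0]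
        smooth_DERIV[OF assms, unfolded has_field_derivative_def]] by simp
  moreover have "((\<lambda>x. x $ i) has_derivative (\<lambda>y. y $ i)) (at x)"
    by (intro bounded_linear_imp_has_derivative bounded_linear_vec_nth)
  ultimately have "((\<lambda>x. x $ i * h ((norm x)\<^sup>2)) has_derivative
      (\<lambda>y. x $ i * (deriv h ((norm x)\<^sup>2) * (2 * (x \<bullet> y))) + y $ i * h ((norm x)\<^sup>2))) (at x)"
    by (rule has_derivative_mult[rotated])
  from partial_deriv_eqI[OF this] show ?thesis by (simp add: inner_axis power2_eq_square)
qed

section \<open>Translation continuity in mean and mollifiers\<close>

lemma integrable_lborel_translate:
  fixes w :: "'a::euclidean_space \<Rightarrow> 'b::{banach, second_countable_topology}"
  assumes "integrable lborel w"
  shows "integrable lborel (\<lambda>x. w (x + z))"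
proof -
  have "integrable (distr lborel borel ((+) z)) w"
    using assms by (simp add: lborel_distr_plus)
  then have "integrable lborel (\<lambda>x. w (z + x))"
    using assms by (subst (asm) integrable_distr_eq) auto
  then show ?thesis by (simp add: add.commute)
qed

lemma integral_lborel_translate:
  fixes w :: "'a::euclidean_space \<Rightarrow> 'b::{banach, second_countable_topology}"
  assumes [measurable]: "w \<in> borel_measurable borel"
  shows "(\<integral>x. w (x + z) \<partial>lborel) = (\<integral>x. w x \<partial>lborel)"
proof -
  have "(\<integral>x. w x \<partial>lborel) = (\<integral>x. w x \<partial>(distr lborel borel ((+) z)))"
    by (simp add: lborel_distr_plus)
  also have "\<dots> = (\<integral>x. w (z + x) \<partial>lborel)"
    by (subst integral_distr) auto
  finally show ?thesis by (simp add: add.commute)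
qed

text \<open>Enclose \<open>A\<close> between a compact \<open>K\<close> and an open \<open>U\<close>
  whose difference is small. A shift shorter than the distance from \<open>K\<close> to the
  complement of \<open>U\<close> can change membership in \<open>A\<close> only when x or x + z lies
  in \<open>U - K\<close>.\<close>

lemma L1_translation_indicator:
  fixes A :: "'a::euclidean_space set"
  assumes A: "A \<in> sets lborel" "emeasure lborel A < \<infinity>" and "e > 0"
  obtains d where "d > 0"
    "\<And>z. norm z < d \<Longrightarrow> (\<integral>x. \<bar>indicator A (x + z) - indicator A x\<bar> \<partial>lborel) < (e::real)"
proof -
  have AL: "A \<in> sets lebesgue" using A by simp
  \<comment> \<open>Three pieces of size e/8 will cover \<open>D = U - K\<close>, and
    \<open>D\<close> is counted twice, at x and at x + z: altogether 6e/8 < e.\<close>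
  obtain U where U: "open U" "A \<subseteq> U" "U - A \<in> lmeasurable" "emeasure lebesgue (U - A) < ennreal (e/8)"
    using sets_lebesgue_outer_open[OF AL, of "e/8"] assms(3) by auto
  obtain T where T: "closed T" "T \<subseteq> A" "A - T \<in> lmeasurable" "emeasure lebesgue (A - T) < ennreal (e/8)"
    using sets_lebesgue_inner_closed[OF AL, of "e/8"] assms(3) by auto
  \<comment> \<open>The inner set \<open>T\<close> is closed but perhaps unbounded; since
    \<open>A\<close> has finite measure, cutting with a large ball costs little and gives
    compactness.\<close>
  have "(\<lambda>n. emeasure lborel (A - cball 0 (real n))) \<longlonglongrightarrow> emeasure lborel (\<Inter>n. A - cball 0 (real n))"
  proof (rule Lim_emeasure_decseq)
    show "emeasure lborel (A - cball 0 (real n)) \<noteq> \<infinity>" for n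
      using emeasure_mono[of "A - cball 0 (real n)" A lborel] A by (auto simp: top_unique)
  qed (use A in \<open>auto simp: decseq_def\<close>)
  also have "(\<Inter>n. A - cball 0 (real n)) = {}"
    using real_arch_simple by (auto simp: dist_norm)
  finally have "eventually (\<lambda>n. emeasure lborel (A - cball 0 (real n)) < ennreal (e/8)) sequentially"
    using assms(3) by (intro order_tendstoD(2)) auto
  then obtain n where n: "emeasure lborel (A - cball 0 (real n)) < ennreal (e/8)"
    by (meson eventually_sequentially order_refl)
  define K where "K = T \<inter> cball 0 (real n)"
  define D where "D = U - K"
  have K: "compact K" "K \<subseteq> A" "K \<subseteq> U"
    using T U by (auto simp: K_def closed_Int_compact)
  have [measurable]: "K \<in> sets borel" "U \<in> sets borel" "D \<in> sets borel" "T \<in> sets borel" "A \<in> sets borel"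
    using K(1) U(1) T(1) A(1) by (auto simp: D_def intro: borel_compact)
  have "emeasure lborel D \<le> emeasure lborel ((U - A) \<union> ((A - T) \<union> (A - cball 0 (real n))))"
    by (intro emeasure_mono) (auto simp: D_def K_def)
  also have "\<dots> \<le> emeasure lborel (U - A) + (emeasure lborel (A - T) + emeasure lborel (A - cball 0 (real n)))"
    by (intro order_trans[OF emeasure_subadditive] add_left_mono) auto
  also have "\<dots> \<le> ennreal (e/8) + (ennreal (e/8) + ennreal (e/8))"
    using U(4) T(4) n by (intro add_mono) (auto simp: emeasure_completion)
  also have "\<dots> = ennreal (3 * e / 8)"
    using assms(3) by (simp flip: ennreal_plus)
  finally have D: "emeasure lborel D \<le> ennreal (3 * e / 8)" .
  then have Dfin: "emeasure lborel D < \<infinity>"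
    by (rule le_less_trans) simp
  have Dm: "measure lborel D \<le> 3 * e / 8"
    using D assms(3) Dfin by (simp add: emeasure_eq_ennreal_measure)
  obtain d where d: "d > 0" "\<And>x y. x \<in> K \<Longrightarrow> y \<notin> U \<Longrightarrow> d \<le> dist x y"
    using separate_compact_closed[OF K(1) closed_Compl[OF U(1)]] K(3) by blast
  have I: "integrable lborel (indicator D :: 'a \<Rightarrow> real)"
    using Dfin by (simp add: integrable_indicator_iff)
  note I' = integrable_lborel_translate[OF I]
  have IA: "integrable lborel (indicator A :: 'a \<Rightarrow> real)"
    using A by (simp add: integrable_indicator_iff)
  note IA' = integrable_lborel_translate[OF IA]
  have "(\<integral>x. \<bar>indicator A (x + z) - indicator A x\<bar> \<partial>lborel) < e" if z: "norm z < d" for z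
  proof -
    have U1: "x + z \<in> U" if "x \<in> K" for x
      using d(2)[OF that, of "x + z"] z by (auto simp: dist_norm)
    have U2: "x \<in> U" if "x + z \<in> K" for x
      using d(2)[OF that, of x] z by (auto simp: dist_norm)
    \<comment> \<open>If exactly one of x, x + z is in \<open>A\<close>, that point lies in
      \<open>D\<close> unless it is in \<open>K\<close>; in the latter case the other point is in
      \<open>U\<close> but not in \<open>A\<close>, hence in \<open>D\<close>.\<close>
    have "\<bar>indicator A (x + z) - indicator A x\<bar> \<le> (indicator D (x + z) + indicator D x :: real)" for x
    proof (cases "x \<in> A \<longleftrightarrow> x + z \<in> A")
      case False
      then have "x + z \<in> D \<or> x \<in> D"
        using U(2) K(2) U1[of x] U2[of x] unfolding D_def by blast
      with False show ?thesis by (auto split: split_indicator)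
    qed (simp split: split_indicator)
    moreover have "integrable lborel (\<lambda>x. \<bar>indicator A (x + z) - indicator A x\<bar> :: real)"
      using IA IA'[of z] by simp
    moreover have ID: "integrable lborel (\<lambda>x. indicator D (x + z) :: real)" by (rule I')
    moreover have "integrable lborel (\<lambda>x. indicator D (x + z) + indicator D x :: real)"
      using I ID by simp
    ultimately have "(\<integral>x. \<bar>indicator A (x + z) - indicator A x\<bar> \<partial>lborel) 
        \<le> (\<integral>x. indicator D (x + z) + indicator D x \<partial>lborel :: real)"
      by (intro integral_mono) auto
    also have "\<dots> = (\<integral>x. indicator D (x + z) \<partial>lborel) + (\<integral>x. indicator D x \<partial>lborel)"
      using I ID by (rule Bochner_Integration.integral_add[rotated])
    also have "(\<integral>x. indicator D (x + z) \<partial>lborel) = (\<integral>x. indicator D x \<partial>lborel :: real)"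
      by (rule integral_lborel_translate[of "indicator D"]) measurable
    also have "(\<integral>x. indicator D x \<partial>lborel :: real) = measure lborel D" by simp
    finally show ?thesis using Dm assms(3) by simp
  qed
  with d(1) show ?thesis by (rule that)
qed

text \<open>Indicators of sets of finite measure are the base case; the property passes to sums and,
  by splitting the error into three parts, to dominated limits.\<close>

lemma L1_translation_continuous:
  fixes w :: "'a::euclidean_space \<Rightarrow> 'b::{banach, second_countable_topology}"
  assumes "integrable lborel w" and "e > 0"
  shows "\<exists>d>0. \<forall>z. norm z < d \<longrightarrow> (\<integral>x. norm (w (x + z) - w x) \<partial>lborel) < e"
  using assms
proof (induction arbitrary: e rule: integrable_induct)
  case (base A c)
  have "e / (norm c + 1) > 0" using base by (simp add: add_nonneg_pos)
  from L1_translation_indicator[OF base(1,2) this] obtain d where d: "d > 0"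
    "\<And>z. norm z < d \<Longrightarrow> (\<integral>x. \<bar>indicator A (x + z) - indicator A x\<bar> \<partial>lborel) < e / (norm c + 1)"
    by metis
  have "(\<integral>x. norm (indicator A (x + z) *\<^sub>R c - indicator A x *\<^sub>R c) \<partial>lborel) < e" if "norm z < d" for z
  proof -
    have "(\<integral>x. norm (indicator A (x + z) *\<^sub>R c - indicator A x *\<^sub>R c) \<partial>lborel)
        = (\<integral>x. \<bar>indicator A (x + z) - indicator A x\<bar> * norm c \<partial>lborel)"
      by (simp add: scaleR_diff_left[symmetric])
    also have "\<dots> = (\<integral>x. \<bar>indicator A (x + z) - indicator A x\<bar> \<partial>lborel) * norm c"
      by simp
    also have "\<dots> \<le> (\<integral>x. \<bar>indicator A (x + z) - indicator A x\<bar> \<partial>lborel) * (norm c + 1)"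
      by (intro mult_left_mono) auto
    also have "\<dots> < e"
      using d(2)[OF that] by (simp add: pos_less_divide_eq add_nonneg_pos)
    finally show ?thesis .
  qed
  with d(1) show ?case by blast
next
  case (add f g)
  obtain d1 where d1: "d1 > 0" "\<And>z. norm z < d1 \<Longrightarrow> (\<integral>x. norm (f (x + z) - f x) \<partial>lborel) < e/2"
    using add.IH(1)[of "e/2"] add.prems by auto
  obtain d2 where d2: "d2 > 0" "\<And>z. norm z < d2 \<Longrightarrow> (\<integral>x. norm (g (x + z) - g x) \<partial>lborel) < e/2"
    using add.IH(2)[of "e/2"] add.prems by auto
  have "(\<integral>x. norm (f (x + z) + g (x + z) - (f x + g x)) \<partial>lborel) < e" if "norm z < min d1 d2" for z
  proof -
    note I = integrable_lborel_translate[OF add.hyps(1), of z] integrable_lborel_translate[OF add.hyps(2), of z] add.hyps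
    have "(\<integral>x. norm (f (x + z) + g (x + z) - (f x + g x)) \<partial>lborel)
      \<le> (\<integral>x. norm (f (x + z) - f x) + norm (g (x + z) - g x) \<partial>lborel)"
      using I by (intro integral_mono) (auto simp: add_diff_add norm_triangle_ineq)
    also have "\<dots> = (\<integral>x. norm (f (x + z) - f x) \<partial>lborel) + (\<integral>x. norm (g (x + z) - g x) \<partial>lborel)"
      using I by simp
    also have "\<dots> < e" using d1(2)[of z] d2(2)[of z] that by simp
    finally show ?thesis .
  qed
  with d1(1) d2(1) show ?case by (intro exI[of _ "min d1 d2"]) auto
next
  case (lim f s)
  have [measurable]: "f \<in> borel_measurable borel" "\<And>i. s i \<in> borel_measurable borel"
    using borel_measurable_integrable[OF lim.hyps(4)] borel_measurable_integrable[OF lim.hyps(1)] by auto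
  have "(\<lambda>i. \<integral>x. norm (s i x - f x) \<partial>lborel) \<longlonglongrightarrow> (\<integral>x. 0 \<partial>(lborel :: 'a measure))"
  \<comment> \<open>The approximants satisfy |s_i| <= 2 |f|, whence the majorant 3 |f| for the
    difference.\<close>
  proof (rule integral_dominated_convergence[where w = "\<lambda>x. 3 * norm (f x)"])
    show "AE x in lborel. (\<lambda>i. norm (s i x - f x)) \<longlonglongrightarrow> 0"
      using lim.hyps(2) by (intro AE_I2) (simp add: tendsto_norm_zero_iff LIM_zero_iff)
    show "AE x in lborel. norm (norm (s i x - f x)) \<le> 3 * norm (f x)" for i
    proof (intro AE_I2)
      fix x
      show "norm (norm (s i x - f x)) \<le> 3 * norm (f x)"
        using norm_triangle_ineq4[of "s i x" "f x"] lim.hyps(3)[of x i] by simp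
    qed
  qed (use lim.hyps(4) in auto)
  then have "eventually (\<lambda>i. (\<integral>x. norm (s i x - f x) \<partial>lborel) < e/3) sequentially"
    using lim.prems by (intro order_tendstoD(2)) auto
  then obtain i where i: "(\<integral>x. norm (s i x - f x) \<partial>lborel) < e/3"
    by (meson eventually_sequentially order_refl)
  obtain d where d: "d > 0" "\<And>z. norm z < d \<Longrightarrow> (\<integral>x. norm (s i (x + z) - s i x) \<partial>lborel) < e/3"
    using lim.IH[of "e/3" i] lim.prems by (metis divide_pos_pos zero_less_numeral)
  have "(\<integral>x. norm (f (x + z) - f x) \<partial>lborel) < e" if "norm z < d" for z
  proof -
    have I: "integrable lborel (\<lambda>x. norm (s i x - f x))"
        "integrable lborel (\<lambda>x. norm (s i (x + z) - f (x + z)))"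
        "integrable lborel (\<lambda>x. norm (s i (x + z) - s i x))"
        "integrable lborel (\<lambda>x. norm (f (x + z) - f x))"
      using lim.hyps(1)[of i] lim.hyps(4) integrable_lborel_translate[OF lim.hyps(1)[of i], of z]
        integrable_lborel_translate[OF lim.hyps(4), of z] by auto
    have "norm (f (x + z) - f x) \<le> norm (s i (x + z) - f (x + z)) 
        + norm (s i (x + z) - s i x) + norm (s i x - f x)" for x
    proof -
      have "f (x + z) - f x = - (s i (x + z) - f (x + z)) + (s i (x + z) - s i x) + (s i x - f x)" by simp
      also have "norm \<dots> \<le> norm (s i (x + z) - f (x + z)) + norm (s i (x + z) - s i x) + norm (s i x - f x)"
        using norm_triangle_ineq[of "- (s i (x + z) - f (x + z)) + (s i (x + z) - s i x)" "s i x - f x"]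
          norm_triangle_ineq[of "- (s i (x + z) - f (x + z))" "s i (x + z) - s i x"]
        unfolding norm_minus_cancel by linarith
      finally show ?thesis .
    qed
    then have "(\<integral>x. norm (f (x + z) - f x) \<partial>lborel) \<le> (\<integral>x. norm (s i (x + z) - f (x + z)) 
        + norm (s i (x + z) - s i x) + norm (s i x - f x) \<partial>lborel)"
      using I by (intro integral_mono) auto
    also have "\<dots> = (\<integral>x. norm (s i (x + z) - f (x + z)) \<partial>lborel)
        + (\<integral>x. norm (s i (x + z) - s i x) \<partial>lborel) + (\<integral>x. norm (s i x - f x) \<partial>lborel)"
      by (simp add: I Bochner_Integration.integrable_add)
    also have "(\<integral>x. norm (s i (x + z) - f (x + z)) \<partial>lborel) = (\<integral>x. norm (s i x - f x) \<partial>lborel)"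
      by (rule integral_lborel_translate[of "\<lambda>x. norm (s i x - f x)"]) measurable
    finally show ?thesis using i d(2)[OF that] by simp
  qed
  with d(1) show ?case by blast
qed

text \<open>As \<open>K\<close> has mass 1, the error at x is the \<open>K\<close>-weighted mean of
  w(x + z) - w(x). Interchanging the integrals bounds its L1 norm by the \<open>K\<close>-mean of
  translation errors, and only shifts z with \<open>K z \<noteq> 0\<close> contribute.\<close>

lemma mollifier_L1_bound:
  fixes w :: "'a::euclidean_space \<Rightarrow> 'b::{banach, second_countable_topology}" and K :: "'a \<Rightarrow> real"
  assumes w: "integrable lborel w"
    and [measurable]: "K \<in> borel_measurable borel"
    and K: "\<And>z. 0 \<le> K z" "\<And>z. K z \<le> C" "integrable lborel K" "(\<integral>z. K z \<partial>lborel) = 1"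
    and e: "\<And>z. K z \<noteq> 0 \<Longrightarrow> (\<integral>x. norm (w (x + z) - w x) \<partial>lborel) \<le> e"
  shows "(\<lambda>x. \<integral>y. K (y - x) *\<^sub>R w y \<partial>lborel) \<in> borel_measurable borel"
    and "integrable lborel (\<lambda>x. (\<integral>y. K (y - x) *\<^sub>R w y \<partial>lborel) - w x)"
    and "(\<integral>x. norm ((\<integral>y. K (y - x) *\<^sub>R w y \<partial>lborel) - w x) \<partial>lborel) \<le> e"
proof -
  have [measurable]: "w \<in> borel_measurable borel"
    using borel_measurable_integrable[OF w] by simp
  show m[measurable]: "(\<lambda>x. \<integral>y. K (y - x) *\<^sub>R w y \<partial>lborel) \<in> borel_measurable borel"
    by measurable
  have Kw: "integrable lborel (\<lambda>z. K z *\<^sub>R w (x + z))" for x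
  proof (rule Bochner_Integration.integrable_bound[of _ "\<lambda>z. C *\<^sub>R w (x + z)"])
    show "integrable lborel (\<lambda>z. C *\<^sub>R w (x + z))"
      using integrable_lborel_translate[OF w, of x] by (simp add: add.commute)
  qed (use K in \<open>auto intro!: mult_right_mono simp: abs_of_nonneg order_trans[OF K(1) K(2)]\<close>)
  let ?F = "\<lambda>x. (\<integral>y. K (y - x) *\<^sub>R w y \<partial>lborel) - w x"
  have eq: "?F x = (\<integral>z. K z *\<^sub>R (w (x + z) - w x) \<partial>lborel)" for x
  proof -
    have "(\<integral>y. K (y - x) *\<^sub>R w y \<partial>lborel) = (\<integral>z. K z *\<^sub>R w (x + z) \<partial>lborel)"
      using integral_lborel_translate[of "\<lambda>y. K (y - x) *\<^sub>R w y" x] by (simp add: add.commute)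
    moreover have "(\<integral>z. K z *\<^sub>R w x \<partial>lborel) = w x" using K(3,4) by simp
    ultimately show ?thesis
      using Kw K(3) by (simp add: scaleR_diff_right)
  qed
  \<comment> \<open>A kernel of mass 1 is nonzero somewhere, and at such a z the number
    \<open>e\<close> bounds the integral of a norm.\<close>
  have e0: "0 \<le> e"
  proof -
    have "\<exists>z. K z \<noteq> 0"
    proof (rule ccontr)
      assume "\<not> ?thesis"
      then have "K = (\<lambda>_. 0)" by auto
      with K(4) show False by simp
    qed
    then obtain z where "K z \<noteq> 0" by blast
    moreover have "0 \<le> (\<integral>x. norm (w (x + z) - w x) \<partial>lborel)" by (intro integral_nonneg_AE) simp
    ultimately show ?thesis using e[of z] by linarith
  qed
  have "(\<integral>\<^sup>+x. norm (?F x) \<partial>lborel) \<le> (\<integral>\<^sup>+x. (\<integral>\<^sup>+z. K z * norm (w (x + z) - w x) \<partial>lborel) \<partial>lborel)"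
  proof (intro nn_integral_mono)
    fix x
    have "integrable lborel (\<lambda>z. K z *\<^sub>R (w (x + z) - w x))"
      unfolding scaleR_diff_right using Kw[of x] K(3) by simp
    from integral_norm_bound_ennreal[OF this]
    have "ennreal (norm (?F x)) \<le> (\<integral>\<^sup>+z. norm (K z *\<^sub>R (w (x + z) - w x)) \<partial>lborel)"
      unfolding eq .
    then show "ennreal (norm (?F x)) \<le> (\<integral>\<^sup>+z. ennreal (K z * norm (w (x + z) - w x)) \<partial>lborel)"
      using K(1) by simp
  qed
  also have "\<dots> = (\<integral>\<^sup>+z. (\<integral>\<^sup>+x. K z * norm (w (x + z) - w x) \<partial>lborel) \<partial>lborel)"
    by (rule lborel_pair.Fubini') measurable
  also have "\<dots> \<le> (\<integral>\<^sup>+z. ennreal (K z) * ennreal e \<partial>lborel)"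
  proof (intro nn_integral_mono)
    fix z
    have "(\<integral>\<^sup>+x. K z * norm (w (x + z) - w x) \<partial>lborel) = ennreal (K z) * (\<integral>\<^sup>+x. norm (w (x + z) - w x) \<partial>lborel)"
      using K(1) by (subst nn_integral_cmult[symmetric]) (auto simp: ennreal_mult)
    also have "(\<integral>\<^sup>+x. norm (w (x + z) - w x) \<partial>lborel) = ennreal (\<integral>x. norm (w (x + z) - w x) \<partial>lborel)"
      using w integrable_lborel_translate[OF w, of z] by (intro nn_integral_eq_integral) auto
    also have "ennreal (K z) * \<dots> \<le> ennreal (K z) * ennreal e"
      using e[of z] by (cases "K z = 0") (auto intro!: mult_left_mono ennreal_leI)
    finally show "(\<integral>\<^sup>+x. K z * norm (w (x + z) - w x) \<partial>lborel) \<le> ennreal (K z) * ennreal e" .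
  qed
  also have "\<dots> = (\<integral>\<^sup>+z. ennreal (K z) \<partial>lborel) * ennreal e"
    by (rule nn_integral_multc) measurable
  also have "(\<integral>\<^sup>+z. ennreal (K z) \<partial>lborel) = 1"
    using nn_integral_eq_integral[OF K(3)] K(1,4) by simp
  finally have N: "(\<integral>\<^sup>+x. norm (?F x) \<partial>lborel) \<le> ennreal e" by simp
  show I: "integrable lborel ?F"
  proof (rule integrableI_bounded)
    show "(\<integral>\<^sup>+x. norm (?F x) \<partial>lborel) < \<infinity>" using N by (rule le_less_trans) simp
  qed measurable
  have "ennreal (\<integral>x. norm (?F x) \<partial>lborel) = (\<integral>\<^sup>+x. norm (?F x) \<partial>lborel)"
    using I by (intro nn_integral_eq_integral[symmetric]) auto
  from N[folded this] show "(\<integral>x. norm (?F x) \<partial>lborel) \<le> e"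
    unfolding ennreal_le_iff[OF e0] .
qed

text \<open>Shrinking supports and continuity of translations give convergence in L1; convergence
  almost everywhere then holds along a subsequence.\<close>

lemma mollifier_AE_subseq:
  fixes w :: "'a::euclidean_space \<Rightarrow> 'b::{banach, second_countable_topology}" and K :: "nat \<Rightarrow> 'a \<Rightarrow> real"
  assumes w: "integrable lborel w"
    and [measurable]: "\<And>n. K n \<in> borel_measurable borel"
    and K: "\<And>n z. 0 \<le> K n z" "\<And>n z. K n z \<le> C n" "\<And>n. integrable lborel (K n)" "\<And>n. (\<integral>z. K n z \<partial>lborel) = 1"
    and supp: "\<And>n z. K n z \<noteq> 0 \<Longrightarrow> norm z < \<epsilon> n" "\<epsilon> \<longlonglongrightarrow> 0"
  obtains r :: "nat \<Rightarrow> nat" where "strict_mono r"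
    "AE x in lborel. (\<lambda>n. \<integral>y. K (r n) (y - x) *\<^sub>R w y \<partial>lborel) \<longlonglongrightarrow> w x"
proof -
  let ?F = "\<lambda>n x. (\<integral>y. K n (y - x) *\<^sub>R w y \<partial>lborel) - w x"
  have ev: "eventually (\<lambda>n. \<forall>z. K n z \<noteq> 0 \<longrightarrow> (\<integral>x. norm (w (x + z) - w x) \<partial>lborel) \<le> e) sequentially"
    if e: "e > 0" for e
  proof -
    obtain d where d: "d > 0" "\<And>z. norm z < d \<Longrightarrow> (\<integral>x. norm (w (x + z) - w x) \<partial>lborel) < e"
      using L1_translation_continuous[OF w e] by blast
    have "eventually (\<lambda>n. \<epsilon> n < d) sequentially"
      using order_tendstoD(2)[OF supp(2) d(1)] .
    then show ?thesis
    proof eventually_elim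
      case (elim n)
      show ?case
      proof (intro allI impI)
        fix z assume "K n z \<noteq> 0"
        then have "norm z < d" using supp(1)[of n z] elim by simp
        from d(2)[OF this] show "(\<integral>x. norm (w (x + z) - w x) \<partial>lborel) \<le> e" by simp
      qed
    qed
  qed
  \<comment> \<open>This crude bound makes the error integrable for every n, also for the early
    kernels whose support is not yet small.\<close>
  have bd: "(\<integral>x. norm (w (x + z) - w x) \<partial>lborel) \<le> 2 * (\<integral>x. norm (w x) \<partial>lborel)" for z
  proof -
    have [measurable]: "w \<in> borel_measurable borel"
      using borel_measurable_integrable[OF w] by simp
    note I = w integrable_lborel_translate[OF w, of z]
    have "(\<integral>x. norm (w (x + z) - w x) \<partial>lborel) \<le> (\<integral>x. norm (w (x + z)) + norm (w x) \<partial>lborel)"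
      using I by (intro integral_mono norm_triangle_ineq4) auto
    also have "\<dots> = (\<integral>x. norm (w (x + z)) \<partial>lborel) + (\<integral>x. norm (w x) \<partial>lborel)"
      using I by simp
    also have "(\<integral>x. norm (w (x + z)) \<partial>lborel) = (\<integral>x. norm (w x) \<partial>lborel)"
      by (rule integral_lborel_translate[of "\<lambda>x. norm (w x)"]) measurable
    finally show ?thesis by simp
  qed
  have I: "integrable lborel (?F n)" for n
    by (rule mollifier_L1_bound(2)[OF w assms(2) K(1) K(2) K(3) K(4) bd])
  have "(\<lambda>n. \<integral>x. norm (?F n x) \<partial>lborel) \<longlonglongrightarrow> 0"
  proof (rule order_tendstoI)
    fix a :: real assume "a < 0"
    then show "eventually (\<lambda>n. a < (\<integral>x. norm (?F n x) \<partial>lborel)) sequentially"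
      by (intro always_eventually allI) (rule less_le_trans, assumption, intro integral_nonneg_AE, simp)
  next
    fix a :: real assume "0 < a"
    then have "eventually (\<lambda>n. \<forall>z. K n z \<noteq> 0 \<longrightarrow> (\<integral>x. norm (w (x + z) - w x) \<partial>lborel) \<le> a/2) sequentially"
      by (intro ev) simp
    then show "eventually (\<lambda>n. (\<integral>x. norm (?F n x) \<partial>lborel) < a) sequentially"
    proof eventually_elim
      case (elim n)
      then have "(\<integral>x. norm (?F n x) \<partial>lborel) \<le> a/2"
        by (intro mollifier_L1_bound(3)[OF w assms(2) K(1) K(2) K(3) K(4)]) auto
      with \<open>0 < a\<close> show ?case by simp
    qed
  qed
  from tendsto_L1_AE_subseq[OF I this] obtain r where r: "strict_mono r" "AE x in lborel. (\<lambda>n. ?F (r n) x) \<longlonglongrightarrow> 0"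
    by blast
  from r(2) have "AE x in lborel. (\<lambda>n. \<integral>y. K (r n) (y - x) *\<^sub>R w y \<partial>lborel) \<longlonglongrightarrow> w x"
    by eventually_elim (rule LIM_zero_cancel)
  with r(1) show ?thesis by (rule that)
qed

section \<open>Orthogonal invariance of Lebesgue measure\<close>

text \<open>The image measure is translation invariant, so Fubini compares it with Lebesgue measure up
  to a factor, which is read off from the unit ball. The library's change of variables needs a
  well-ordered index type.\<close>

lemma distr_lborel_orthogonal:
  fixes Q :: "'a::euclidean_space \<Rightarrow> 'a"
  assumes Q: "orthogonal_transformation Q"
  shows "distr lborel borel Q = lborel"
proof -
  interpret linear Q using Q by (rule orthogonal_transformation_linear)
  have [measurable]: "Q \<in> borel_measurable borel"
    using linear_continuous_on[of Q UNIV] linear_axioms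
    by (intro borel_measurable_continuous_onI) (simp add: linear_conv_bounded_linear)
  define \<mu> where "\<mu> = distr lborel borel Q"
  have sets_mu[simp, measurable_cong]: "sets \<mu> = sets borel" "space \<mu> = UNIV" by (auto simp: \<mu>_def)
  \<comment> \<open>Agreement on centred balls is used twice: for sigma-finiteness of the image
    measure and, at radius 1, for the normalising factor.\<close>
  have ball: "emeasure \<mu> (ball 0 r) = emeasure lborel (ball (0 :: 'a) r)" for r
  proof -
    have "Q -` ball 0 r = ball 0 r"
      using orthogonal_transformation_norm[OF Q] by auto
    then show ?thesis by (simp add: \<mu>_def emeasure_distr)
  qed
  interpret sigma_finite_measure \<mu>
  proof
    show "\<exists>A. countable A \<and> A \<subseteq> sets \<mu> \<and> \<Union>A = space \<mu> \<and> (\<forall>a\<in>A. emeasure \<mu> a \<noteq> \<infinity>)"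
    proof (intro exI conjI)
      show "\<Union>(range (\<lambda>n. ball (0 :: 'a) (real n))) = space \<mu>"
        using reals_Archimedean2 by (auto simp: dist_norm)
      show "\<forall>a\<in>range (\<lambda>n. ball 0 (real n)). emeasure \<mu> a \<noteq> \<infinity>"
        by (auto simp: ball emeasure_ball)
    qed auto
  qed
  interpret P: pair_sigma_finite \<mu> lborel ..
  have trans_mu: "(\<integral>\<^sup>+x. F (y + x) \<partial>\<mu>) = (\<integral>\<^sup>+x. F x \<partial>\<mu>)" if [measurable]: "F \<in> borel_measurable borel" for F :: "'a \<Rightarrow> ennreal" and y
  proof -
    obtain y' where y': "Q y' = y"
      using orthogonal_transformation_surj[OF Q] by (metis surjD)
    have "(\<integral>\<^sup>+x. F (y + x) \<partial>\<mu>) = (\<integral>\<^sup>+x. F (Q (y' + x)) \<partial>lborel)"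
      by (simp add: \<mu>_def nn_integral_distr add y')
    also have "\<dots> = (\<integral>\<^sup>+x. F (Q x) \<partial>(distr lborel borel ((+) y')))"
      by (subst nn_integral_distr) auto
    also have "\<dots> = (\<integral>\<^sup>+x. F x \<partial>\<mu>)"
      by (simp add: lborel_distr_plus \<mu>_def nn_integral_distr)
    finally show ?thesis .
  qed
  have trans_lb: "(\<integral>\<^sup>+x. F (y + x) \<partial>lborel) = (\<integral>\<^sup>+x. F x \<partial>lborel)" if [measurable]: "F \<in> borel_measurable borel" for F :: "'a \<Rightarrow> ennreal" and y
  proof -
    have "(\<integral>\<^sup>+x. F x \<partial>lborel) = (\<integral>\<^sup>+x. F x \<partial>(distr lborel borel ((+) y)))"
      by (simp add: lborel_distr_plus)
    then show ?thesis by (simp add: nn_integral_distr)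
  qed
  define B where "B = ball (0 :: 'a) 1"
  have [measurable]: "B \<in> sets borel" by (simp add: B_def)
  have Bsym: "- x \<in> B \<longleftrightarrow> x \<in> B" for x by (simp add: B_def)
  have "emeasure \<mu> A = emeasure lborel A" if [measurable]: "A \<in> sets borel" for A
  proof -
    have "emeasure \<mu> A * emeasure lborel B = (\<integral>\<^sup>+x. indicator A x * emeasure lborel B \<partial>\<mu>)"
      by (simp add: nn_integral_multc)
    also have "\<dots> = (\<integral>\<^sup>+x. (\<integral>\<^sup>+y. indicator A x * indicator B (- x + y) \<partial>lborel) \<partial>\<mu>)"
    proof (intro nn_integral_cong)
      fix x
      have "(\<integral>\<^sup>+y. indicator A x * indicator B (- x + y) \<partial>lborel) = indicator A x * (\<integral>\<^sup>+y. indicator B (- x + y) \<partial>lborel)"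
        by (rule nn_integral_cmult) measurable
      also have "(\<integral>\<^sup>+y. indicator B (- x + y) \<partial>lborel) = emeasure lborel B"
        by (subst trans_lb) auto
      finally show "indicator A x * emeasure lborel B = (\<integral>\<^sup>+y. indicator A x * indicator B (- x + y) \<partial>lborel)" ..
    qed
    also have "\<dots> = (\<integral>\<^sup>+y. (\<integral>\<^sup>+x. indicator A x * indicator B (- x + y) \<partial>\<mu>) \<partial>lborel)"
      by (rule P.Fubini'[symmetric]) measurable
    \<comment> \<open>Shifting x by y under \<open>\<mu>\<close> turns the indicator of
      \<open>B\<close> at y - x into that at -x, free of y. The integral over y then involves
      \<open>A\<close> alone and can be evaluated by invariance of Lebesgue measure.\<close>
    also have "\<dots> = (\<integral>\<^sup>+y. (\<integral>\<^sup>+x. indicator A (y + x) * indicator B (- (y + x) + y) \<partial>\<mu>) \<partial>lborel)"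
      by (intro nn_integral_cong trans_mu[symmetric]) measurable
    also have "\<dots> = (\<integral>\<^sup>+y. (\<integral>\<^sup>+x. indicator A (y + x) * indicator B x \<partial>\<mu>) \<partial>lborel)"
      by (simp add: indicator_def Bsym)
    also have "\<dots> = (\<integral>\<^sup>+x. (\<integral>\<^sup>+y. indicator A (y + x) * indicator B x \<partial>lborel) \<partial>\<mu>)"
      by (rule P.Fubini') measurable
    also have "\<dots> = (\<integral>\<^sup>+x. emeasure lborel A * indicator B x \<partial>\<mu>)"
    proof (intro nn_integral_cong)
      fix x
      have "(\<integral>\<^sup>+y. indicator A (y + x) * indicator B x \<partial>lborel) = (\<integral>\<^sup>+y. indicator A (x + y) \<partial>lborel) * indicator B x"
        by (simp add: nn_integral_multc add.commute)
      also have "(\<integral>\<^sup>+y. indicator A (x + y) \<partial>lborel) = emeasure lborel A"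
        by (subst trans_lb) auto
      finally show "(\<integral>\<^sup>+y. indicator A (y + x) * indicator B x \<partial>lborel) = emeasure lborel A * indicator B x" .
    qed
    also have "\<dots> = emeasure lborel A * emeasure lborel B"
      by (subst nn_integral_cmult) (auto simp: ball[of 1, folded B_def])
    finally show ?thesis
      using emeasure_ball[of 1 "0 :: 'a"] ennreal_mult_cancel_left[of "emeasure lborel B"]
        less_imp_neq[OF unit_ball_vol_pos[of "real DIM('a)"]]
      by (auto simp: B_def mult.commute)
  qed
  then show ?thesis
    unfolding \<mu>_def[symmetric] by (intro measure_eqI) auto
qed

lemma integral_orthogonal:
  fixes Q :: "'a::euclidean_space \<Rightarrow> 'a" and F :: "'a \<Rightarrow> 'b::{banach, second_countable_topology}"
  assumes Q: "orthogonal_transformation Q" and [measurable]: "F \<in> borel_measurable borel"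
  shows "(\<integral>x. F (Q x) \<partial>lborel) = (\<integral>x. F x \<partial>lborel)"
proof -
  have [measurable]: "Q \<in> borel_measurable borel"
    using orthogonal_transformation_linear[OF Q] linear_continuous_on[of Q UNIV]
    by (intro borel_measurable_continuous_onI) (simp add: linear_conv_bounded_linear)
  have "(\<integral>x. F x \<partial>(distr lborel borel Q)) = (\<integral>x. F (Q x) \<partial>lborel)"
    by (rule integral_distr) auto
  then show ?thesis by (simp add: distr_lborel_orthogonal[OF Q])
qed

lemma AE_orthogonal:
  fixes Q :: "'a::euclidean_space \<Rightarrow> 'a"
  assumes Q: "orthogonal_transformation Q" and "AE x in lborel. P x"
  shows "AE x in lborel. P (Q x)"
proof -
  have [measurable]: "Q \<in> borel_measurable borel"
    using orthogonal_transformation_linear[OF Q] linear_continuous_on[of Q UNIV]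
    by (intro borel_measurable_continuous_onI) (simp add: linear_conv_bounded_linear)
  have "AE x in distr lborel borel Q. P x"
    unfolding distr_lborel_orthogonal[OF Q] by (rule assms(2))
  then show ?thesis by (rule AE_distrD[rotated]) simp
qed

text \<open>The map \<open>S\<close> fixes e and is minus the identity on the orthogonal complement
  of e. Commuting with \<open>S\<close> forces the value at a multiple of e to be parallel to e, and
  an orthogonal map carrying that multiple to x transports the statement to x.\<close>

lemma orthogonal_equivariant_eq:
  fixes V :: "real ^ 'n \<Rightarrow> real ^ 'n" and e :: "real ^ 'n"
  assumes V: "\<And>Q x. orthogonal_transformation Q \<Longrightarrow> V (Q x) = Q (V x)" and e: "norm e = 1"
  shows "V x = ((V (norm x *\<^sub>R e) \<bullet> e) / norm x) *\<^sub>R x"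
proof -
  define S where "S = (\<lambda>z. (2 * (z \<bullet> e)) *\<^sub>R e - z)"
  have ee: "e \<bullet> e = 1" using e by (simp add: norm_eq_1)
  have linS: "linear S"
    by (rule linearI) (auto simp: S_def inner_left_distrib scaleR_add_left scaleR_diff_right algebra_simps)
  have S: "orthogonal_transformation S"
    unfolding orthogonal_transformation_def
    using linS by (auto simp: S_def inner_diff_left inner_diff_right ee inner_commute algebra_simps)
  obtain Q where Q: "orthogonal_transformation Q" "Q (norm x *\<^sub>R e) = x"
    using orthogonal_transformation_exists[of "norm x *\<^sub>R e" x] e by auto
  let ?v = "V (norm x *\<^sub>R e)"
  have "S (norm x *\<^sub>R e) = norm x *\<^sub>R e"
    by (simp add: S_def ee algebra_simps scaleR_2[symmetric])
  then have "?v = S ?v" using V[OF S, of "norm x *\<^sub>R e"] by simp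
  then have "?v + ?v = (2 * (?v \<bullet> e)) *\<^sub>R e" by (simp add: S_def algebra_simps)
  from arg_cong[OF this, of "\<lambda>z. (1 / 2) *\<^sub>R z"] have v: "?v = (?v \<bullet> e) *\<^sub>R e"
    by (simp add: scaleR_2[symmetric])
  have linQ: "linear Q" using Q(1) by (rule orthogonal_transformation_linear)
  have "V x = Q ?v" using V[OF Q(1), of "norm x *\<^sub>R e"] Q(2) by simp
  also have "\<dots> = (?v \<bullet> e) *\<^sub>R Q e" by (subst v) (simp add: linear_scale[OF linQ])
  finally have Vx: "V x = (?v \<bullet> e) *\<^sub>R Q e" .
  show ?thesis
  proof (cases "x = 0")
    case True
    then have "?v = V 0" by simp
    \<comment> \<open>At the origin the quotient by \<open>norm x\<close> is 0 by convention, so V 0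
      = 0 is required; it follows from commuting with x -> -x.\<close>
    moreover have "V 0 = - V 0"
      using V[of uminus 0] by (simp add: orthogonal_transformation_def linear_uminus)
    ultimately show ?thesis using True by (simp add: eq_neg_iff_add_eq_0 scaleR_2[symmetric])
  next
    case False
    have "x = norm x *\<^sub>R Q e" using Q(2) linear_scale[OF linQ] by metis
    then have "Q e = (1 / norm x) *\<^sub>R x" using False
      by (metis divide_self_if norm_eq_zero scaleR_one scaleR_scaleR times_divide_eq_left mult_1)
    with Vx show ?thesis by simp
  qed
qed

lemma orthogonal_invariant_eq:
  fixes V :: "real ^ 'n \<Rightarrow> 'b" and e :: "real ^ 'n"
  assumes V: "\<And>Q x. orthogonal_transformation Q \<Longrightarrow> V (Q x) = V x" and e: "norm e = 1"
  shows "V x = V (norm x *\<^sub>R e)"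
  using orthogonal_transformation_exists[of "norm x *\<^sub>R e" x] e V by (metis abs_norm_cancel mult.right_neutral norm_scaleR)

section \<open>Weak gradients of radial functions\<close>

lemma expinv_1: "expinv 1 t = (if t > 0 then exp (- 1 / t) else 0)"
  by (simp add: expinv_def)

lemma exists_smooth_mollifier:
  fixes \<epsilon> :: real
  assumes "\<epsilon> > 0"
  obtains k C where "smooth k" "\<And>t. 0 \<le> k t" "\<And>t. k t \<le> C" "\<And>t. t \<ge> \<epsilon>\<^sup>2 \<Longrightarrow> k t = 0"
    "integrable lborel (\<lambda>z::'a::euclidean_space. k ((norm z)\<^sup>2))"
    "(\<integral>z. k ((norm (z::'a))\<^sup>2) \<partial>lborel) = 1"
proof -
  define p where "p t = expinv 1 (- 1 * t + \<epsilon>\<^sup>2)" for t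
  have p: "smooth p" "\<And>t. 0 \<le> p t" "\<And>t. p t \<le> 1" "\<And>t. t \<ge> \<epsilon>\<^sup>2 \<Longrightarrow> p t = 0"
    unfolding p_def[abs_def] using smooth_affine[OF smooth_expinv, of 1 "- 1" "\<epsilon>\<^sup>2"]
    by (auto simp: expinv_1)
  have pc: "continuous_on UNIV (\<lambda>z::'a. p ((norm z)\<^sup>2))"
    by (rule continuous_on_compose2[OF smooth_continuous[OF p(1), of UNIV]])
      (auto intro!: continuous_intros)
  have [measurable]: "(\<lambda>z::'a. p ((norm z)\<^sup>2)) \<in> borel_measurable borel"
    by (rule borel_measurable_continuous_onI[OF pc])
  have p_ind: "p ((norm z)\<^sup>2) \<le> indicator (ball 0 \<epsilon>) z" for z :: 'a
    using p(3,4) assms by (auto simp: indicator_def not_less intro!: p(4) power_mono)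
  have I1: "integrable lborel (indicator (ball (0::'a) \<epsilon>) :: 'a \<Rightarrow> real)"
    using assms by (simp add: integrable_indicator_iff emeasure_ball)
  have I: "integrable lborel (\<lambda>z::'a. p ((norm z)\<^sup>2))"
    by (rule Bochner_Integration.integrable_bound[OF I1]) (use p(2) p_ind in auto)
  define m where "m = (\<integral>z. p ((norm (z::'a))\<^sup>2) \<partial>lborel)"
  have "m > 0"
  proof -
    \<comment> \<open>This is the value of the profile at |z| = \<epsilon>/2, its minimum on the
      half ball, and shows that the mass to be normalised is positive.\<close>
    define c where "c = exp (- 1 / (\<epsilon>\<^sup>2 - (\<epsilon>/2)\<^sup>2))"
    have d: "\<epsilon>\<^sup>2 - (\<epsilon>/2)\<^sup>2 > 0" using assms by (simp add: power2_eq_square)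
    have "c * indicator (ball 0 (\<epsilon>/2)) z \<le> p ((norm z)\<^sup>2)" for z :: 'a
    proof (cases "z \<in> ball 0 (\<epsilon>/2)")
      case True
      then have "(norm z)\<^sup>2 \<le> (\<epsilon>/2)\<^sup>2" by (intro power_mono) auto
      then have "\<epsilon>\<^sup>2 - (norm z)\<^sup>2 \<ge> \<epsilon>\<^sup>2 - (\<epsilon>/2)\<^sup>2" by simp
      then have "c \<le> p ((norm z)\<^sup>2)" using d
        by (auto simp: c_def p_def expinv_1 intro!: divide_left_mono)
      with True show ?thesis by simp
    qed (simp add: p(2))
    moreover have "integrable lborel (\<lambda>z::'a. c * indicator (ball 0 (\<epsilon>/2)) z)"
      using assms by (intro integrable_mult_right) (simp add: integrable_indicator_iff emeasure_ball)
    ultimately have "(\<integral>z. c * indicator (ball 0 (\<epsilon>/2)) (z :: 'a) \<partial>lborel) \<le> m"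
      unfolding m_def by (intro integral_mono I) auto
    moreover have "(\<integral>z. c * indicator (ball 0 (\<epsilon>/2)) (z :: 'a) \<partial>lborel) > 0"
      using assms by (simp add: c_def content_ball)
    ultimately show ?thesis by simp
  qed
  show ?thesis
  proof (rule that)
    show "smooth (\<lambda>t. 1 / m * p t)" by (rule smooth_cmult[OF p(1)])
    show "1 / m * p t \<le> 1 / m" for t using p(3)[of t] \<open>m > 0\<close> by (simp add: divide_right_mono)
    show "integrable lborel (\<lambda>z::'a. 1 / m * p ((norm z)\<^sup>2))" using I by simp
    show "(\<integral>z. 1 / m * p ((norm (z::'a))\<^sup>2) \<partial>lborel) = 1" using \<open>m > 0\<close> by (simp add: m_def)
  qed (use p \<open>m > 0\<close> in auto)
qed

text \<open>The kernels are fixed before \<open>w\<close>; only the subsequence depends on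
  \<open>w\<close>. The kernels depend on |y - x| alone, which the symmetry arguments
  exploit.\<close>

lemma exists_radial_mollifiers:
  obtains k :: "nat \<Rightarrow> real \<Rightarrow> real" where
    "\<And>n. smooth (k n)" "\<And>n t. t \<ge> (1 / Suc n)\<^sup>2 \<Longrightarrow> k n t = 0"
    "\<And>w :: 'a::euclidean_space \<Rightarrow> 'b::{banach, second_countable_topology}. integrable lborel w \<Longrightarrow>
       \<exists>r :: nat \<Rightarrow> nat. strict_mono r \<and>
       (AE x in lborel. (\<lambda>n. \<integral>y. k (r n) ((norm (y - x))\<^sup>2) *\<^sub>R w y \<partial>lborel) \<longlonglongrightarrow> w x)"
proof -
  have "\<exists>k C. smooth k \<and> (\<forall>t. 0 \<le> k t) \<and> (\<forall>t. k t \<le> C) \<and> (\<forall>t \<ge> (1 / real (Suc n))\<^sup>2. k t = 0) \<and>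
    integrable lborel (\<lambda>z::'a. k ((norm z)\<^sup>2)) \<and> (\<integral>z. k ((norm (z::'a))\<^sup>2) \<partial>lborel) = 1" for n
    by (rule exists_smooth_mollifier[of "1 / Suc n", where 'a = 'a]) (simp, blast)
  then obtain k C where k: "\<And>n. smooth (k n)" "\<And>n t. 0 \<le> k n t" "\<And>n t. k n t \<le> C n"
    "\<And>n t. t \<ge> (1 / Suc n)\<^sup>2 \<Longrightarrow> k n t = 0"
    "\<And>n. integrable lborel (\<lambda>z::'a. k n ((norm z)\<^sup>2))"
    "\<And>n. (\<integral>z. k n ((norm (z::'a))\<^sup>2) \<partial>lborel) = 1"
    by metis
  have m: "(\<lambda>z::'a. k n ((norm z)\<^sup>2)) \<in> borel_measurable borel" for n
    using borel_measurable_integrable[OF k(5)[of n]] by simp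
  have supp: "norm z < 1 / Suc n" if "k n ((norm z)\<^sup>2) \<noteq> 0" for n and z :: 'a
  proof (rule ccontr)
    assume "\<not> norm z < 1 / Suc n"
    then have "(1 / Suc n)\<^sup>2 \<le> (norm z)\<^sup>2" by (intro power_mono) auto
    with k(4) that show False by blast
  qed
  show ?thesis
  proof (rule that[of k])
    fix w :: "'a \<Rightarrow> 'b" assume w: "integrable lborel w"
    obtain r :: "nat \<Rightarrow> nat" where "strict_mono r"
      "AE x in lborel. (\<lambda>n. \<integral>y. k (r n) ((norm (y - x))\<^sup>2) *\<^sub>R w y \<partial>lborel) \<longlonglongrightarrow> w x"
      by (rule mollifier_AE_subseq[OF w m k(2) k(3) k(5) k(6) supp lim_1_over_n[THEN LIMSEQ_Suc]])
    then show "\<exists>r :: nat \<Rightarrow> nat. strict_mono r \<and>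
       (AE x in lborel. (\<lambda>n. \<integral>y. k (r n) ((norm (y - x))\<^sup>2) *\<^sub>R w y \<partial>lborel) \<longlonglongrightarrow> w x)"
      by blast
  qed (use k in auto)
qed

lemma smooth_measurable: "smooth h \<Longrightarrow> h \<in> borel_measurable borel"
  by (intro borel_measurable_continuous_onI smooth_continuous)

text \<open>The endpoint t = a is the delicate case, since \<open>h\<close> is known to vanish on
  one side of it only; continuity of the derivative settles it.\<close>

lemma smooth_deriv_eq_0:
  assumes "smooth h" "\<And>t. t \<ge> a \<Longrightarrow> h t = 0" "t \<ge> a"
  shows "deriv h t = 0"
proof -
  have z: "deriv h t = 0" if "t > a" for t
  proof -
    have "eventually (\<lambda>x. x > a) (nhds t)"
      using that by (simp add: eventually_nhds_in_open[of "{a<..}", simplified])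
    then have "eventually (\<lambda>x. 0 = h x) (nhds t)"
      by eventually_elim (simp add: assms(2))
    from DERIV_cong_ev[OF refl this refl, of 0] show ?thesis
      by (simp add: DERIV_imp_deriv)
  qed
  have "isCont (deriv h) t"
    using smooth_DERIV[OF smooth_deriv[OF assms(1)]] by (rule DERIV_isCont)
  then have "(deriv h \<longlongrightarrow> deriv h t) (at_right t)"
    unfolding isCont_def by (rule filterlim_mono[OF _ order_refl at_le]) auto
  moreover have "(deriv h \<longlongrightarrow> 0) (at_right t)"
    by (rule tendsto_eventually) (use z assms(3) in \<open>auto simp: eventually_at_filter\<close>)
  ultimately show ?thesis by (intro tendsto_unique[of "at_right t"]) auto
qed

lemma compact_support_bounded:
  fixes F :: "'a::euclidean_space \<Rightarrow> 'b::real_normed_vector"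
  assumes "continuous_on UNIV F" "\<And>z. norm (z - a) \<ge> s \<Longrightarrow> F z = 0"
  shows "\<exists>C. \<forall>z. norm (F z) \<le> C"
proof -
  have "bounded (F ` cball a s)"
    by (intro compact_imp_bounded compact_continuous_image continuous_on_subset[OF assms(1)]) auto
  then obtain C where C: "\<And>z. z \<in> cball a s \<Longrightarrow> norm (F z) \<le> C"
    unfolding bounded_iff by blast
  have "norm (F z) \<le> max C 0" for z
    using C[of z] assms(2)[of z] by (cases "z \<in> cball a s") (auto simp: dist_norm norm_minus_commute)
  then show ?thesis by blast
qed

lemma integrable_scaleR_bounded:
  fixes F :: "'a::euclidean_space \<Rightarrow> 'b::{banach, second_countable_topology}" and u :: "'a \<Rightarrow> real"
  assumes "integrable lborel u" "F \<in> borel_measurable borel" "\<And>y. norm (F y) \<le> C"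
  shows "integrable lborel (\<lambda>y. u y *\<^sub>R F y)"
proof (rule Bochner_Integration.integrable_bound)
  show "integrable lborel (\<lambda>y. C * \<bar>u y\<bar>)" using assms(1) by simp
  have [measurable]: "u \<in> borel_measurable borel" using borel_measurable_integrable[OF assms(1)] by simp
  note [measurable] = assms(2)
  show "(\<lambda>y. u y *\<^sub>R F y) \<in> borel_measurable lborel" by measurable
  show "AE x in lborel. norm (u x *\<^sub>R F x) \<le> norm (C * \<bar>u x\<bar>)"
  proof (intro AE_I2)
    fix x
    have "norm (u x *\<^sub>R F x) = norm (F x) * \<bar>u x\<bar>" by simp
    also have "\<dots> \<le> C * \<bar>u x\<bar>" by (intro mult_right_mono assms) simp
    finally show "norm (u x *\<^sub>R F x) \<le> norm (C * \<bar>u x\<bar>)" by simp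
  qed
qed

lemma continuous_on_smooth_norm_sq:
  fixes a :: "'a::real_normed_vector"
  assumes "smooth h" shows "continuous_on S (\<lambda>z. h ((norm (z - a))\<^sup>2))"
  by (rule continuous_on_compose2[OF smooth_continuous[OF assms, of UNIV]])
    (auto intro!: continuous_intros)

text \<open>Nothing is assumed about measurability of \<open>g\<close>. The mollifications of
  \<open>u\<close> are Borel and radial at every point, not just almost everywhere, so restricting
  them to one ray and passing to the limit gives a Borel profile.\<close>

lemma radial_borel_representative:
  fixes u :: "real ^ 'n \<Rightarrow> real"
  assumes u: "integrable lborel u" and g: "AE x in lborel. u x = g (norm x)"
  obtains G where "G \<in> borel_measurable borel" "AE x in lborel. u x = G (norm x)"
proof -
  obtain k :: "nat \<Rightarrow> real \<Rightarrow> real" where k: "\<And>n. smooth (k n)" 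
    and ex: "\<And>w :: real ^ 'n \<Rightarrow> real. integrable lborel w \<Longrightarrow>
       \<exists>r :: nat \<Rightarrow> nat. strict_mono r \<and>
       (AE x in lborel. (\<lambda>n. \<integral>y. k (r n) ((norm (y - x))\<^sup>2) *\<^sub>R w y \<partial>lborel) \<longlonglongrightarrow> w x)"
    by (rule exists_radial_mollifiers[where 'a = "real ^ 'n" and 'b = real]) blast
  note [measurable] = smooth_measurable[OF k]
  have [measurable]: "u \<in> borel_measurable borel"
    using borel_measurable_integrable[OF u] by simp
  obtain r :: "nat \<Rightarrow> nat" where r:
    "AE x in lborel. (\<lambda>n. \<integral>y. k (r n) ((norm (y - x))\<^sup>2) *\<^sub>R u y \<partial>lborel) \<longlonglongrightarrow> u x"
    using ex[OF u] by blast
  define V where "V n x = (\<integral>y. k (r n) ((norm (y - x))\<^sup>2) *\<^sub>R u y \<partial>lborel)" for n x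
  have Vm[measurable]: "V n \<in> borel_measurable borel" for n
    unfolding V_def[abs_def] by measurable
  have V_inv: "V n (Q x) = V n x" if Q: "orthogonal_transformation Q" for n Q x
  proof -
    have lin: "linear Q" using Q by (rule orthogonal_transformation_linear)
    have nQ: "norm (Q y - Q x) = norm (y - x)" for y
      by (simp add: linear_diff[OF lin, symmetric] orthogonal_transformation_norm[OF Q])
    have [measurable]: "Q \<in> borel_measurable borel"
      using lin linear_continuous_on[of Q UNIV]
      by (intro borel_measurable_continuous_onI) (simp add: linear_conv_bounded_linear)
    have ae: "AE y in lborel. u (Q y) = u y"
      using g AE_orthogonal[OF Q g] by eventually_elim (simp add: orthogonal_transformation_norm[OF Q])
    have "V n (Q x) = (\<integral>y. k (r n) ((norm (Q y - Q x))\<^sup>2) *\<^sub>R u (Q y) \<partial>lborel)"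
      unfolding V_def by (rule integral_orthogonal[OF Q, symmetric]) measurable
    also have "\<dots> = V n x"
      unfolding V_def nQ
    proof (rule integral_cong_AE)
      show "AE y in lborel. k (r n) ((norm (y - x))\<^sup>2) *\<^sub>R u (Q y) = k (r n) ((norm (y - x))\<^sup>2) *\<^sub>R u y"
        using ae by eventually_elim simp
    qed measurable
    finally show ?thesis .
  qed
  obtain e :: "real ^ 'n" where e: "norm e = 1" using vector_choose_size[of 1] by auto
  have Vx: "V n x = V n (norm x *\<^sub>R e)" for n x
    by (rule orthogonal_invariant_eq[of "V n" e x]) (use V_inv e in auto)
  show ?thesis
  proof (rule that)
    \<comment> \<open>Where the sequence diverges \<open>lim\<close> has some arbitrary value; for
      almost every x the sequence at radius |x| converges.\<close>
    show "(\<lambda>s. lim (\<lambda>n. V n (s *\<^sub>R e))) \<in> borel_measurable borel"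
      by (rule borel_measurable_lim_metric) measurable
    show "AE x in lborel. u x = lim (\<lambda>n. V n (norm x *\<^sub>R e))"
      using r
    proof eventually_elim
      case (elim x)
      then have "(\<lambda>n. V n (norm x *\<^sub>R e)) \<longlonglongrightarrow> u x"
        unfolding V_def[symmetric] by (subst (asm) Vx)
      then show ?case by (simp add: limI)
    qed
  qed
qed

text \<open>Moving the derivative onto the kernel expresses the mollified gradient through
  \<open>u\<close>. That expression commutes exactly with orthogonal maps, so it is a scalar
  function of |x| times x, and this form survives the almost everywhere limit.\<close>

lemma radial_weak_gradient:
  fixes u :: "real ^ 'n \<Rightarrow> real" and w :: "real ^ 'n \<Rightarrow> real ^ 'n"
  assumes u: "integrable lborel u" and g: "AE x in lborel. u x = g (norm x)"
    and w: "integrable lborel w"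
    and weak: "\<And>h x s i. smooth h \<Longrightarrow> s > 0 \<Longrightarrow> (\<And>t. t \<ge> s\<^sup>2 \<Longrightarrow> h t = 0) \<Longrightarrow> norm x + s < R \<Longrightarrow>
      (\<integral>y. u y * (2 * (y - x) $ i * deriv h ((norm (y - x))\<^sup>2)) \<partial>lborel) = - (\<integral>y. w y $ i * h ((norm (y - x))\<^sup>2) \<partial>lborel)"
  obtains H where "H \<in> borel_measurable borel" 
    "AE x in lborel. norm x < R \<longrightarrow> w x = (H (norm x) / norm x) *\<^sub>R x"
proof -
  obtain k :: "nat \<Rightarrow> real \<Rightarrow> real" where k: "\<And>n. smooth (k n)" "\<And>n t. t \<ge> (1 / Suc n)\<^sup>2 \<Longrightarrow> k n t = 0"
    and ex: "\<And>w :: real ^ 'n \<Rightarrow> real ^ 'n. integrable lborel w \<Longrightarrow>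
       \<exists>r :: nat \<Rightarrow> nat. strict_mono r \<and>
       (AE x in lborel. (\<lambda>n. \<integral>y. k (r n) ((norm (y - x))\<^sup>2) *\<^sub>R w y \<partial>lborel) \<longlonglongrightarrow> w x)"
    by (rule exists_radial_mollifiers[where 'a = "real ^ 'n" and 'b = "real ^ 'n"]) blast
  note [measurable] = smooth_measurable[OF k(1)] smooth_measurable[OF smooth_deriv[OF k(1)]]
  have [measurable]: "u \<in> borel_measurable borel" "w \<in> borel_measurable borel"
    using borel_measurable_integrable[OF u] borel_measurable_integrable[OF w] by auto
  obtain r :: "nat \<Rightarrow> nat" where r: "strict_mono r"
    "AE x in lborel. (\<lambda>n. \<integral>y. k (r n) ((norm (y - x))\<^sup>2) *\<^sub>R w y \<partial>lborel) \<longlonglongrightarrow> w x"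
    using ex[OF w] by blast
  \<comment> \<open>\<open>F n (y - x)\<close> is the gradient of the kernel k(|y - x|^2) with
    respect to x, hence the minus sign on z.\<close>
  define F where "F n z = (2 * deriv (k (r n)) ((norm z)\<^sup>2)) *\<^sub>R (- z)" for n and z :: "real ^ 'n"
  define V where "V n x = (\<integral>y. u y *\<^sub>R F n (y - x) \<partial>lborel)" for n x
  have [measurable]: "F n \<in> borel_measurable borel" for n
    unfolding F_def[abs_def] by measurable
  have Vm[measurable]: "V n \<in> borel_measurable borel" for n
    unfolding V_def[abs_def] by measurable
  have nz: "(1 / real (Suc (r n)))\<^sup>2 \<le> (norm z)\<^sup>2" if "norm z \<ge> 1 / Suc (r n)" for n and z :: "real ^ 'n"
    using that by (intro power_mono) auto
  have "\<exists>C. \<forall>z. norm (F n z) \<le> C" for n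
  proof (rule compact_support_bounded[where a = 0 and s = "1 / Suc (r n)"])
    have "continuous_on UNIV (\<lambda>z::real ^ 'n. deriv (k (r n)) ((norm z)\<^sup>2))"
      using continuous_on_smooth_norm_sq[OF smooth_deriv[OF k(1)], of UNIV _ 0] by simp
    then show "continuous_on UNIV (F n)"
      unfolding F_def[abs_def] by (intro continuous_intros)
    show "F n z = 0" if "1 / Suc (r n) \<le> norm (z - 0)" for z
      using smooth_deriv_eq_0[OF k(1) k(2) nz[of n z]] that by (simp add: F_def)
  qed
  then obtain CF where CF: "\<And>n z. norm (F n z) \<le> CF n" by metis
  have uF: "integrable lborel (\<lambda>y. u y *\<^sub>R F n (y - x))" for n x
    by (rule integrable_scaleR_bounded[OF u _ CF]) measurable
  have "\<exists>C. \<forall>z::real ^ 'n. norm (k (r n) ((norm z)\<^sup>2)) \<le> C" for n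
  proof (rule compact_support_bounded[where a = 0 and s = "1 / Suc (r n)"])
    show "continuous_on UNIV (\<lambda>z::real ^ 'n. k (r n) ((norm z)\<^sup>2))"
      using continuous_on_smooth_norm_sq[OF k(1), of UNIV _ 0] by simp
    show "k (r n) ((norm z)\<^sup>2) = 0" if "1 / Suc (r n) \<le> norm (z - 0)" for z :: "real ^ 'n"
      using k(2)[OF nz[of n z]] that by simp
  qed
  then obtain Ck where Ck: "\<And>n (z::real ^ 'n). norm (k (r n) ((norm z)\<^sup>2)) \<le> Ck n" by metis
  have kw: "integrable lborel (\<lambda>y. k (r n) ((norm (y - x))\<^sup>2) *\<^sub>R w y)" for n x
  proof (rule Bochner_Integration.integrable_bound)
    show "integrable lborel (\<lambda>y. Ck n *\<^sub>R w y)" using w by simp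
    show "AE y in lborel. norm (k (r n) ((norm (y - x))\<^sup>2) *\<^sub>R w y) \<le> norm (Ck n *\<^sub>R w y)"
    proof (intro AE_I2)
      fix y
      have "norm (k (r n) ((norm (y - x))\<^sup>2)) \<le> \<bar>Ck n\<bar>" using Ck[of n "y - x"] by linarith
      then show "norm (k (r n) ((norm (y - x))\<^sup>2) *\<^sub>R w y) \<le> norm (Ck n *\<^sub>R w y)"
        by (auto intro: mult_right_mono)
    qed
  qed measurable
  \<comment> \<open>Equivariance is available for the expression in \<open>u\<close>, whose
    invariance is known on the whole space; nothing is known yet about the symmetry of
    \<open>w\<close>.\<close>
  have V_eq: "V n (Q x) = Q (V n x)" if Q: "orthogonal_transformation Q" for n Q x
  proof -
    have lin: "linear Q" using Q by (rule orthogonal_transformation_linear)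
    have bl: "bounded_linear Q" using lin by (simp add: linear_conv_bounded_linear)
    have [measurable]: "Q \<in> borel_measurable borel"
      using lin linear_continuous_on[of Q UNIV]
      by (intro borel_measurable_continuous_onI) (simp add: linear_conv_bounded_linear)
    have FQ: "F n (Q y - Q x) = Q (F n (y - x))" for y
      by (simp add: F_def linear_diff[OF lin, symmetric] linear_neg[OF lin, symmetric] linear_scale[OF lin, symmetric] orthogonal_transformation_norm[OF Q])
    have ae: "AE y in lborel. u (Q y) = u y"
      using g AE_orthogonal[OF Q g] by eventually_elim (simp add: orthogonal_transformation_norm[OF Q])
    have "V n (Q x) = (\<integral>y. u (Q y) *\<^sub>R F n (Q y - Q x) \<partial>lborel)"
      unfolding V_def by (rule integral_orthogonal[OF Q, symmetric]) measurable
    also have "\<dots> = (\<integral>y. Q (u y *\<^sub>R F n (y - x)) \<partial>lborel)"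
      unfolding FQ linear_scale[OF lin]
    proof (rule integral_cong_AE)
      show "AE y in lborel. u (Q y) *\<^sub>R Q (F n (y - x)) = u y *\<^sub>R Q (F n (y - x))"
        using ae by eventually_elim simp
    qed measurable
    also have "\<dots> = Q (V n x)"
      unfolding V_def
      by (intro integral_bounded_linear bl uF)
    finally show ?thesis .
  qed
  \<comment> \<open>The identification with the mollified \<open>w\<close> needs the kernel centred
    at x to be supported inside the ball of radius \<open>R\<close>; for fixed |x| < R this holds
    for all large n.\<close>
  have V_moll: "V n x = (\<integral>y. k (r n) ((norm (y - x))\<^sup>2) *\<^sub>R w y \<partial>lborel)" 
    if "norm x + 1 / Suc (r n) < R" for n x
  proof (subst vec_eq_iff, intro allI)
    fix i
    have "V n x $ i = (\<integral>y. (u y *\<^sub>R F n (y - x)) $ i \<partial>lborel)"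
      unfolding V_def by (rule integral_bounded_linear[OF bounded_linear_vec_nth uF, symmetric])
    also have "\<dots> = - (\<integral>y. u y * (2 * (y - x) $ i * deriv (k (r n)) ((norm (y - x))\<^sup>2)) \<partial>lborel)"
      by (subst Bochner_Integration.integral_minus[symmetric]) (auto simp: F_def algebra_simps)
    also have "\<dots> = (\<integral>y. w y $ i * k (r n) ((norm (y - x))\<^sup>2) \<partial>lborel)"
      using weak[OF k(1)[of "r n"] _ k(2) that, of i] by simp
    also have "\<dots> = (\<integral>y. (k (r n) ((norm (y - x))\<^sup>2) *\<^sub>R w y) $ i \<partial>lborel)"
      by (simp add: mult.commute)
    also have "\<dots> = (\<integral>y. k (r n) ((norm (y - x))\<^sup>2) *\<^sub>R w y \<partial>lborel) $ i"
      by (rule integral_bounded_linear[OF bounded_linear_vec_nth kw])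
    finally show "V n x $ i = (\<integral>y. k (r n) ((norm (y - x))\<^sup>2) *\<^sub>R w y \<partial>lborel) $ i" .
  qed
  obtain e :: "real ^ 'n" where e: "norm e = 1" using vector_choose_size[of 1] by auto
  show ?thesis
  proof (rule that)
    show "(\<lambda>s. lim (\<lambda>n. V n (s *\<^sub>R e) \<bullet> e)) \<in> borel_measurable borel"
      by (rule borel_measurable_lim_metric) measurable
    show "AE x in lborel. norm x < R \<longrightarrow> w x = (lim (\<lambda>n. V n (norm x *\<^sub>R e) \<bullet> e) / norm x) *\<^sub>R x"
      using r(2)
    proof eventually_elim
      case (elim x)
      show ?case
      proof
        assume "norm x < R"
        have "(\<lambda>n. 1 / real (Suc (r n))) \<longlonglongrightarrow> 0"
          using LIMSEQ_subseq_LIMSEQ[OF lim_1_over_n[THEN LIMSEQ_Suc] r(1)] by (simp add: o_def)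
        then have "eventually (\<lambda>n. 1 / real (Suc (r n)) < R - norm x) sequentially"
          using \<open>norm x < R\<close> by (intro order_tendstoD(2)) auto
        then have "eventually (\<lambda>n. (\<integral>y. k (r n) ((norm (y - x))\<^sup>2) *\<^sub>R w y \<partial>lborel) = V n x) sequentially"
          by eventually_elim (simp add: V_moll)
        with elim have lim: "(\<lambda>n. V n x) \<longlonglongrightarrow> w x"
          by (rule Lim_transform_eventually)
        have Vx: "V n x = ((V n (norm x *\<^sub>R e) \<bullet> e) / norm x) *\<^sub>R x" for n
          by (rule orthogonal_equivariant_eq[of "V n" e x]) (use V_eq e in auto)
        show "w x = (lim (\<lambda>n. V n (norm x *\<^sub>R e) \<bullet> e) / norm x) *\<^sub>R x"
        proof (cases "x = 0")
          case True
          then have "V n x = 0" for n using Vx by simp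
          with lim have "w x = 0" using LIMSEQ_unique[OF lim, of 0] by simp
          with True show ?thesis by simp
        next
          case False
          have "(\<lambda>n. V n x \<bullet> x / norm x) \<longlonglongrightarrow> w x \<bullet> x / norm x"
            using False by (intro tendsto_intros lim) auto
          moreover have "V n x \<bullet> x / norm x = V n (norm x *\<^sub>R e) \<bullet> e" for n
            using False by (subst Vx) (simp add: power2_norm_eq_inner[symmetric] power2_eq_square)
          ultimately have l: "(\<lambda>n. V n (norm x *\<^sub>R e) \<bullet> e) \<longlonglongrightarrow> w x \<bullet> x / norm x" by simp
          have "(\<lambda>n. V n x) \<longlonglongrightarrow> ((w x \<bullet> x / norm x) / norm x) *\<^sub>R x"
            by (subst Vx) (intro tendsto_intros l, use False in simp)
          from LIMSEQ_unique[OF lim this] show ?thesis using limI[OF l] by simp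
        qed
      qed
    qed
  qed
qed

section \<open>Polar coordinates for radial functions\<close>

definition sphere_area :: "'a::euclidean_space itself \<Rightarrow> real \<Rightarrow> real" where
  "sphere_area _ r = DIM('a) * unit_ball_vol DIM('a) * r ^ (DIM('a) - 1)"

lemma sphere_area_measurable [measurable]: "sphere_area TYPE('a::euclidean_space) \<in> borel_measurable borel"
  unfolding sphere_area_def[abs_def] by measurable

lemma sphere_area_pos: "r > 0 \<Longrightarrow> 0 < sphere_area TYPE('a::euclidean_space) r"
  by (simp add: sphere_area_def)

lemma sphere_area_nonneg: "r \<ge> 0 \<Longrightarrow> 0 \<le> sphere_area TYPE('a::euclidean_space) r"
  by (simp add: sphere_area_def)

text \<open>Both measures assign to a half-line {..t} the volume of the ball of radius t, and
  \<open>sphere_area\<close> is the derivative of that volume. Half-lines generate the Borel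
  sets.\<close>

lemma distr_norm_lborel:
  "distr (lborel :: 'a::euclidean_space measure) borel norm = 
     density lborel (\<lambda>r. ennreal (indicator {0..} r * sphere_area TYPE('a) r))"
proof (rule measure_eqI_generator_eq[where E = "range atMost" and \<Omega> = UNIV and A = "\<lambda>n. {..real n}"])
  let ?M = "distr (lborel :: 'a measure) borel norm"
  let ?D = "density lborel (\<lambda>r. ennreal (indicator {0..} r * sphere_area TYPE('a) r))"
  have M: "emeasure ?M {..t} = ennreal (if t < 0 then 0 else unit_ball_vol DIM('a) * t ^ DIM('a))" for t
  proof -
    have "norm -` {..t} = cball (0 :: 'a) t" by auto
    then show ?thesis by (auto simp: emeasure_distr emeasure_cball)
  qed
  show "Int_stable (range (atMost :: real \<Rightarrow> real set))"
    by (auto simp: Int_stable_def Int_atMost)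
  show "sets ?M = sigma_sets UNIV (range atMost)" "sets ?D = sigma_sets UNIV (range atMost)"
    by (simp_all add: borel_eq_atMost)
  show "emeasure ?M {..real i} \<noteq> \<infinity>" for i
    by (simp add: M)
  fix X :: "real set" assume "X \<in> range atMost"
  then obtain t where X: "X = {..t}" by auto
  have "emeasure ?D X = (\<integral>\<^sup>+ r. ennreal (indicator {0..} r * sphere_area TYPE('a) r) * indicator {..t} r \<partial>lborel)"
    unfolding X by (rule emeasure_density) auto
  also have "\<dots> = (\<integral>\<^sup>+ r. ennreal (sphere_area TYPE('a) r) * indicator {0..t} r \<partial>lborel)"
    by (intro nn_integral_cong) (auto split: split_indicator)
  also have "\<dots> = ennreal (if t < 0 then 0 else unit_ball_vol DIM('a) * t ^ DIM('a))"
  proof (cases "t < 0")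
    case False
    have "(\<integral>\<^sup>+ r. ennreal (sphere_area TYPE('a) r) * indicator {0..t} r \<partial>lborel) = 
        ennreal (unit_ball_vol DIM('a) * t ^ DIM('a) - unit_ball_vol DIM('a) * 0 ^ DIM('a))"
    proof (rule nn_integral_FTC_Icc)
      show "((\<lambda>t. unit_ball_vol DIM('a) * t ^ DIM('a)) has_real_derivative sphere_area TYPE('a) x) (at x)" for x
        unfolding sphere_area_def by (auto intro!: derivative_eq_intros)
    qed (use False in \<open>auto simp: sphere_area_nonneg\<close>)
    with False show ?thesis by simp
  qed simp
  finally show "emeasure ?M X = emeasure ?D X" unfolding X M by simp
qed (auto, meson real_arch_simple)

lemma
  fixes F :: "real \<Rightarrow> real"
  assumes [measurable]: "F \<in> borel_measurable borel"
  shows integrable_radial_iff: "integrable lborel (\<lambda>x::'a::euclidean_space. F (norm x)) \<longleftrightarrow>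
      integrable lborel (\<lambda>r. indicator {0..} r * sphere_area TYPE('a) r * F r)"
    and integral_radial: "(\<integral>x. F (norm (x::'a)) \<partial>lborel) = 
      (\<integral>r. indicator {0..} r * sphere_area TYPE('a) r * F r \<partial>lborel)"
proof -
  let ?c = "\<lambda>r. indicator {0..} r * sphere_area TYPE('a) r"
  have c: "AE r in lborel. 0 \<le> ?c r"
    by (auto intro!: AE_I2 simp: sphere_area_nonneg split: split_indicator)
  have "integrable lborel (\<lambda>x::'a. F (norm x)) \<longleftrightarrow> integrable (distr (lborel :: 'a measure) borel norm) F"
    by (rule integrable_distr_eq[symmetric]) auto
  also have "\<dots> \<longleftrightarrow> integrable lborel (\<lambda>r. ?c r * F r)"
    unfolding distr_norm_lborel by (subst integrable_density) (use c in auto)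
  finally show "integrable lborel (\<lambda>x::'a. F (norm x)) \<longleftrightarrow> integrable lborel (\<lambda>r. ?c r * F r)" .
  have "(\<integral>x. F (norm (x::'a)) \<partial>lborel) = (\<integral>r. F r \<partial>(distr (lborel :: 'a measure) borel norm))"
    by (rule integral_distr[symmetric]) auto
  also have "\<dots> = (\<integral>r. ?c r * F r \<partial>lborel)"
    unfolding distr_norm_lborel by (subst integral_density) (use c in auto)
  finally show "(\<integral>x. F (norm (x::'a)) \<partial>lborel) = (\<integral>r. ?c r * F r \<partial>lborel)" .
qed

lemma AE_radial:
  assumes "AE r in lborel. P r"
  shows "AE x in (lborel :: 'a::euclidean_space measure). P (norm x)"
proof -
  have "AE r in distr (lborel :: 'a measure) borel norm. P r"
    unfolding distr_norm_lborel using assms by (subst AE_density) auto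
  then show ?thesis by (rule AE_distrD[rotated]) simp
qed

text \<open>The mean over (x - h, x + h) is a mollification with a box kernel; along a sequence of h
  tending to 0 the means converge to J almost everywhere and hand on their sign.\<close>

lemma AE_nonneg_of_intervals:
  fixes J :: "real \<Rightarrow> real"
  assumes J: "integrable lborel J"
    and nn: "\<And>a b. c < a \<Longrightarrow> a < b \<Longrightarrow> b < d \<Longrightarrow> 0 \<le> (\<integral>x. indicator {a<..<b} x * J x \<partial>lborel)"
  shows "AE x in lborel. c < x \<and> x < d \<longrightarrow> 0 \<le> J x"
proof -
  define K where "K n z = real (Suc n) / 2 * indicator {- 1 / real (Suc n)<..<1 / real (Suc n)} z" for n and z :: real
  have Km: "K n \<in> borel_measurable borel" for n unfolding K_def[abs_def] by measurable
  have emK: "emeasure lborel {- 1 / real (Suc n)<..<1 / real (Suc n)} = ennreal (2 / real (Suc n))" for n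
    by (subst emeasure_lborel_Ioo) (auto simp: field_simps)
  obtain r :: "nat \<Rightarrow> nat" where r: "strict_mono r"
    "AE x in lborel. (\<lambda>n. \<integral>y. K (r n) (y - x) *\<^sub>R J y \<partial>lborel) \<longlonglongrightarrow> J x"
  proof (rule mollifier_AE_subseq[where K = K and C = "\<lambda>n. real (Suc n) / 2" and \<epsilon> = "\<lambda>n. 1 / real (Suc n)", OF J Km])
    show "0 \<le> K n z" "K n z \<le> real (Suc n) / 2" for n z
      by (auto simp: K_def split: split_indicator)
    show "integrable lborel (K n)" for n
      unfolding K_def[abs_def] using emK[of n]
      by (intro integrable_mult_right) (simp add: integrable_indicator_iff)
    show "integral\<^sup>L lborel (K n) = 1" for n
      using emK[of n] by (simp add: K_def[abs_def] measure_def)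
    show "norm z < 1 / real (Suc n)" if "K n z \<noteq> 0" for n z
      using that by (auto simp: K_def abs_less_iff split: split_indicator_asm)
    show "(\<lambda>n. 1 / real (Suc n)) \<longlonglongrightarrow> 0" by (rule lim_1_over_n[THEN LIMSEQ_Suc])
  qed blast
  from r(2) show ?thesis
  proof eventually_elim
    case (elim x)
    show ?case
    proof
      assume x: "c < x \<and> x < d"
      have "(\<lambda>n. 1 / real (Suc (r n))) \<longlonglongrightarrow> 0"
        using LIMSEQ_subseq_LIMSEQ[OF lim_1_over_n[THEN LIMSEQ_Suc] r(1)] by (simp add: o_def)
      then have "eventually (\<lambda>n. 1 / real (Suc (r n)) < min (x - c) (d - x)) sequentially"
        using x by (intro order_tendstoD(2)) auto
      then have "eventually (\<lambda>n. 0 \<le> (\<integral>y. K (r n) (y - x) *\<^sub>R J y \<partial>lborel)) sequentially"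
      proof eventually_elim
        case (elim n)
        let ?h = "1 / real (Suc (r n))"
        have "(\<integral>y. K (r n) (y - x) *\<^sub>R J y \<partial>lborel) = 
          (\<integral>y. real (Suc (r n)) / 2 * (indicator {x - ?h<..<x + ?h} y * J y) \<partial>lborel)"
          by (intro Bochner_Integration.integral_cong) (auto simp: K_def split: split_indicator)
        also have "\<dots> = real (Suc (r n)) / 2 * (\<integral>y. indicator {x - ?h<..<x + ?h} y * J y \<partial>lborel)"
          by simp
        also have "\<dots> \<ge> 0"
          using elim by (intro mult_nonneg_nonneg nn) auto
        finally show ?case .
      qed
      with elim show "0 \<le> J x"
        by (intro tendsto_lowerbound[OF elim]) auto
    qed
  qed
qed

text \<open>The bumps increase to indicators of intervals, so nonnegative bump integrals give
  nonnegative interval integrals. Bumps are taken in r^2 because that is how radial test functions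
  produce them.\<close>

lemma AE_nonneg_of_bumps:
  fixes G :: "real \<Rightarrow> real"
  assumes [measurable]: "G \<in> borel_measurable borel"
    and int: "\<And>a b. 0 < a \<Longrightarrow> a < b \<Longrightarrow> b < \<rho> \<Longrightarrow> integrable lborel (\<lambda>r. indicator {a..b} r * G r)"
    and nn: "\<And>a b n. 0 < a \<Longrightarrow> a < b \<Longrightarrow> b < \<rho> \<Longrightarrow> 
      0 \<le> (\<integral>r. indicator {0..} r * (G r * bump (a\<^sup>2) (b\<^sup>2) n (r\<^sup>2)) \<partial>lborel)"
  shows "AE r in lborel. 0 < r \<and> r < \<rho> \<longrightarrow> 0 \<le> G r"
proof -
  have I: "0 \<le> (\<integral>r. indicator {a<..<b} r * G r \<partial>lborel)" if ab: "0 < a" "a < b" "b < \<rho>" for a b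
  proof (rule LIMSEQ_le_const)
    show "\<exists>M. \<forall>n\<ge>M. 0 \<le> (\<integral>r. indicator {0..} r * (G r * bump (a\<^sup>2) (b\<^sup>2) n (r\<^sup>2)) \<partial>lborel)"
      using nn[OF ab] by blast
    have sq: "a\<^sup>2 < r\<^sup>2 \<and> r\<^sup>2 < b\<^sup>2 \<longleftrightarrow> a < r \<and> r < b" if "r \<ge> 0" for r
      using ab that by (meson less_imp_le order.trans power_strict_mono power2_less_imp_less zero_less_numeral)
    note [measurable] = smooth_measurable[OF smooth_bump]
    show "(\<lambda>n. \<integral>r. indicator {0..} r * (G r * bump (a\<^sup>2) (b\<^sup>2) n (r\<^sup>2)) \<partial>lborel) \<longlonglongrightarrow>
      (\<integral>r. indicator {a<..<b} r * G r \<partial>lborel)"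
    proof (rule integral_dominated_convergence[where w = "\<lambda>r. \<bar>indicator {a..b} r * G r\<bar>"])
      show "integrable lborel (\<lambda>r. \<bar>indicator {a..b} r * G r\<bar>)"
        using int[OF ab] by (rule integrable_abs)
      show "AE r in lborel. (\<lambda>n. indicator {0..} r * (G r * bump (a\<^sup>2) (b\<^sup>2) n (r\<^sup>2))) \<longlonglongrightarrow> indicator {a<..<b} r * G r"
      proof (intro AE_I2)
        fix r
        have "(\<lambda>n. indicator {0..} r * (G r * bump (a\<^sup>2) (b\<^sup>2) n (r\<^sup>2))) \<longlonglongrightarrow> 
            indicator {0..} r * (G r * indicator {a\<^sup>2<..<b\<^sup>2} (r\<^sup>2))"
          by (intro tendsto_intros bump_tendsto)
        also have "indicator {0..} r * (G r * indicator {a\<^sup>2<..<b\<^sup>2} (r\<^sup>2)) = indicator {a<..<b} r * G r"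
          using sq[of r] ab(1) by (cases "r \<ge> 0") (auto split: split_indicator)
        finally show "(\<lambda>n. indicator {0..} r * (G r * bump (a\<^sup>2) (b\<^sup>2) n (r\<^sup>2))) \<longlonglongrightarrow> indicator {a<..<b} r * G r" .
      qed
      show "AE r in lborel. norm (indicator {0..} r * (G r * bump (a\<^sup>2) (b\<^sup>2) n (r\<^sup>2))) \<le> \<bar>indicator {a..b} r * G r\<bar>" for n
      proof (intro AE_I2)
        fix r
        show "norm (indicator {0..} r * (G r * bump (a\<^sup>2) (b\<^sup>2) n (r\<^sup>2))) \<le> \<bar>indicator {a..b} r * G r\<bar>"
        proof (cases "r \<ge> 0 \<and> bump (a\<^sup>2) (b\<^sup>2) n (r\<^sup>2) \<noteq> 0")
          case True
          then have "a < r \<and> r < b" using sq[of r] bump_eq_0[of "r\<^sup>2" "a\<^sup>2" "b\<^sup>2" n] by force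
          then show ?thesis using True bump_nonneg[of "a\<^sup>2" "b\<^sup>2" n "r\<^sup>2"] bump_le_1[of "a\<^sup>2" "b\<^sup>2" n "r\<^sup>2"]
            by (auto simp: abs_mult intro: mult_left_le)
        qed auto
      qed
    qed measurable
  qed
  \<comment> \<open>\<open>G\<close> may fail to be integrable up to 0 or up to
    \<open>\<rho>\<close>; the open interval is exhausted by countably many interior ones.\<close>
  have "AE r in lborel. 1 / real (Suc m) < r \<and> r < \<rho> - 1 / real (Suc m) \<longrightarrow> 0 \<le> G r" for m
  proof (cases "1 / real (Suc m) < \<rho> - 1 / real (Suc m)")
    case True
    let ?c = "1 / real (Suc m)" and ?d = "\<rho> - 1 / real (Suc m)"
    have "AE r in lborel. ?c < r \<and> r < ?d \<longrightarrow> 0 \<le> indicator {?c..?d} r * G r"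
    proof (rule AE_nonneg_of_intervals)
      show "integrable lborel (\<lambda>r. indicator {?c..?d} r * G r)"
        by (rule int) (use True in auto)
      fix a b assume ab: "?c < a" "a < b" "b < ?d"
      have "0 < ?c" by simp
      then have "0 < a" "b < \<rho>" using ab by linarith+
      moreover have "(\<integral>r. indicator {a<..<b} r * (indicator {?c..?d} r * G r) \<partial>lborel) = (\<integral>r. indicator {a<..<b} r * G r \<partial>lborel)"
        using ab by (intro Bochner_Integration.integral_cong) (auto split: split_indicator)
      ultimately show "0 \<le> (\<integral>r. indicator {a<..<b} r * (indicator {?c..?d} r * G r) \<partial>lborel)"
        using I[of a b] ab by simp
    qed
    then show ?thesis by eventually_elim auto
  qed (auto intro!: AE_I2)
  then have "AE r in lborel. \<forall>m. 1 / real (Suc m) < r \<and> r < \<rho> - 1 / real (Suc m) \<longrightarrow> 0 \<le> G r"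
    unfolding AE_all_countable by blast
  then show ?thesis
  proof eventually_elim
    case (elim r)
    show ?case
    proof
      assume "0 < r \<and> r < \<rho>"
      then obtain m where "1 / real (Suc m) < min r (\<rho> - r)"
        using nat_approx_posE[of "min r (\<rho> - r)"] by auto
      with elim show "0 \<le> G r" by (metis less_diff_eq add.commute min_less_iff_conj)
    qed
  qed
qed

text \<open>A smooth step: constant 0 to the left of a, constant equal to the mass \<open>I\<close>
  of the bump to the right of b. Differences of such steps, or of a step and a constant, yield the
  cut-offs used for testing.\<close>

lemma bump_primitive:
  assumes "a < b"
  obtains P I where "\<And>t. (P has_real_derivative bump a b n t) (at t)" "smooth P" "I > 0"
    "\<And>t. t \<le> a \<Longrightarrow> P t = 0" "\<And>t. t \<ge> b \<Longrightarrow> P t = I" "\<And>t. 0 \<le> P t" "\<And>t. P t \<le> I"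
proof -
  have cont: "continuous_on S (bump a b n)" for S by (rule smooth_continuous[OF smooth_bump])
  define P0 where "P0 t = (LBINT y=a..t. bump a b n y)" for t :: real
  have P0: "(P0 has_real_derivative bump a b n t) (at t)" for t
  proof -
    let ?l = "min a t - 1" and ?u = "max a t + 1"
    have "((\<lambda>u. LBINT y=a..u. bump a b n y) has_vector_derivative bump a b n t) (at t within {?l..?u})"
      by (rule interval_integral_FTC2) (use cont in auto)
    moreover have "at t within {?l..?u} = at t"
      by (rule at_within_interior) (auto simp: interior_atLeastAtMost_real)
    ultimately show ?thesis
      unfolding has_real_derivative_iff_has_vector_derivative P0_def[abs_def] by simp
  qed
  define P where "P t = P0 t - P0 a" for t
  have P: "(P has_real_derivative bump a b n t) (at t)" for t
    unfolding P_def[abs_def] using DERIV_diff[OF P0 DERIV_const] by simp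
  have contP: "continuous_on S P" for S
    using P DERIV_isCont continuous_at_imp_continuous_on by blast
  have Dz: "(P has_real_derivative 0) (at x)" if "x \<le> a \<or> b \<le> x" for x
    using P[of x] bump_eq_0[OF that, of n] by simp
  have mono: "P s \<le> P t" if "s \<le> t" for s t
    using that by (rule DERIV_nonneg_imp_nondecreasing) (use P bump_nonneg in blast)
  have strict: "P a < P b"
    using assms by (rule DERIV_pos_imp_increasing_open)
      (use P bump_pos contP in blast)+
  have left: "P t = 0" if "t \<le> a" for t
  proof -
    have "P a = P t"
    proof (cases "t = a")
      case False
      then show ?thesis using that
        by (intro DERIV_isconst_end[of t a P]) (auto intro!: contP Dz)
    qed simp
    then show ?thesis by (simp add: P_def)
  qed
  have right: "P t = P b" if "b \<le> t" for t
  proof (cases "t = b")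
    case False
    then show ?thesis using that
      by (intro DERIV_isconst_end[of b t P]) (auto intro!: contP Dz)
  qed simp
  show ?thesis
  proof (rule that[of P "P b"])
    show "smooth P" by (rule smoothI[OF P smooth_bump])
    show "0 < P b" using strict left[of a] by simp
    show "0 \<le> P t" for t using mono[of a t] left[of a] left[of t] by linarith
    show "P t \<le> P b" for t using mono[of t b] right[of t] by linarith
  qed (fact P left right)+
qed

section \<open>Reduction to one dimension\<close>

lemma integrable_indicator_continuous:
  fixes f :: "real \<Rightarrow> real"
  assumes "continuous_on {a..b} f"
  shows "integrable lborel (\<lambda>r. indicator {a..b} r * f r)"
  using borel_integrable_atLeastAtMost'[OF assms] by (simp add: set_integrable_def)

lemma DERIV_comp_sq:
  assumes "(f has_real_derivative d) (at (r\<^sup>2))"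
  shows "((\<lambda>r. f (r\<^sup>2)) has_real_derivative 2 * r * d) (at r)"
proof -
  have "((\<lambda>r. r\<^sup>2) has_real_derivative 2 * r) (at r)"
    by (auto intro!: derivative_eq_intros)
  from DERIV_chain2[OF assms this] show ?thesis by (simp add: mult.commute)
qed

text \<open>The assumption \<open>ineq\<close> says that L = U + c ln r is non-increasing in the
  sense of distributions. Hence near 0 it lies above a fixed average \<open>C\<close> of its values
  further out.\<close>

lemma log_lower_bound_of_bump_tests:
  fixes U :: "real \<Rightarrow> real"
  assumes [measurable]: "U \<in> borel_measurable borel" and "\<rho> > 0"
    and intU: "\<And>a b. 0 < a \<Longrightarrow> a < b \<Longrightarrow> b < \<rho> \<Longrightarrow> integrable lborel (\<lambda>r. indicator {a..b} r * U r)"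
    and ineq: "\<And>a s \<psi>. smooth \<psi> \<Longrightarrow> 0 < a \<Longrightarrow> a < s \<Longrightarrow> s < \<rho> \<Longrightarrow> (\<And>t. 0 \<le> \<psi> t) \<Longrightarrow>
      (\<And>t. t \<le> a\<^sup>2 \<Longrightarrow> \<psi> t = 0) \<Longrightarrow> (\<And>t. t \<ge> s\<^sup>2 \<Longrightarrow> \<psi> t = 0) \<Longrightarrow>
      0 \<le> (\<integral>r. indicator {0..} r * ((U r + c * ln r) * (2 * r * deriv \<psi> (r\<^sup>2))) \<partial>lborel)"
  obtains C \<rho>\<^sub>1 where "0 < \<rho>\<^sub>1" "AE r in lborel. 0 < r \<and> r < \<rho>\<^sub>1 \<longrightarrow> C - c * ln r \<le> U r"
proof -
  define \<rho>\<^sub>1 \<rho>\<^sub>2 where "\<rho>\<^sub>1 = \<rho> / 4" and "\<rho>\<^sub>2 = \<rho> / 2"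
  have \<rho>: "0 < \<rho>\<^sub>1" "\<rho>\<^sub>1 < \<rho>\<^sub>2" "\<rho>\<^sub>2 < \<rho>" using \<open>\<rho> > 0\<close> by (auto simp: \<rho>\<^sub>1_def \<rho>\<^sub>2_def)
  have \<rho>sq: "\<rho>\<^sub>1\<^sup>2 < \<rho>\<^sub>2\<^sup>2" using \<rho> by (intro power_strict_mono) auto
  define q where "q = bump (\<rho>\<^sub>1\<^sup>2) (\<rho>\<^sub>2\<^sup>2) 0"
  obtain Q Iq where Q: "\<And>t. (Q has_real_derivative q t) (at t)" "smooth Q" "Iq > 0"
    "\<And>t. t \<le> \<rho>\<^sub>1\<^sup>2 \<Longrightarrow> Q t = 0" "\<And>t. t \<ge> \<rho>\<^sub>2\<^sup>2 \<Longrightarrow> Q t = Iq" "\<And>t. 0 \<le> Q t" "\<And>t. Q t \<le> Iq"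
    unfolding q_def by (rule bump_primitive[OF \<rho>sq, of 0]) blast
  define L where "L r = U r + c * ln r" for r
  have [measurable]: "L \<in> borel_measurable borel" unfolding L_def[abs_def] by measurable
  note [measurable] = smooth_measurable[OF smooth_bump]
  \<comment> \<open>The average of L over the shell between \<open>\<rho>\<^sub>1\<close> and
    \<open>\<rho>\<^sub>2\<close> with weight 2 r q(r^2), whose total mass is
    \<open>Iq\<close>.\<close>
  define C where "C = (\<integral>r. indicator {0..} r * (L r * (2 * r * q (r\<^sup>2))) \<partial>lborel) / Iq"
  have intL: "integrable lborel (\<lambda>r. indicator {a..b} r * L r)" if "0 < a" "a < b" "b < \<rho>" for a b
  proof -
    have "integrable lborel (\<lambda>r. indicator {a..b} r * (c * ln r))"
      by (rule integrable_indicator_continuous) (use that in \<open>auto intro!: continuous_intros\<close>)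
    from Bochner_Integration.integrable_add[OF intU[OF that] this] show ?thesis
      by (simp add: L_def algebra_simps)
  qed
  have int_bump: "integrable lborel (\<lambda>r. indicator {0..} r * (f r * (2 * r * bump (a\<^sup>2) (b\<^sup>2) n (r\<^sup>2))))"
    if ab: "0 < a" "a < b" "b < \<rho>" and [measurable]: "f \<in> borel_measurable borel"
      and f: "integrable lborel (\<lambda>r. indicator {a..b} r * f r)" for a b n f
  proof (rule Bochner_Integration.integrable_bound)
    show "integrable lborel (\<lambda>r. 2 * b * (indicator {a..b} r * f r))"
      using f by simp
    show "AE r in lborel. norm (indicator {0..} r * (f r * (2 * r * bump (a\<^sup>2) (b\<^sup>2) n (r\<^sup>2)))) \<le> norm (2 * b * (indicator {a..b} r * f r))"
    proof (intro AE_I2)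
      fix r :: real
      show "norm (indicator {0..} r * (f r * (2 * r * bump (a\<^sup>2) (b\<^sup>2) n (r\<^sup>2)))) \<le> norm (2 * b * (indicator {a..b} r * f r))"
      proof (cases "0 \<le> r \<and> a\<^sup>2 < r\<^sup>2 \<and> r\<^sup>2 < b\<^sup>2")
        case True
        then have ar: "a \<le> r" "r \<le> b"
          using power2_less_imp_less[of a r] power2_less_imp_less[of r b] ab by auto
        let ?p = "bump (a\<^sup>2) (b\<^sup>2) n (r\<^sup>2)"
        have p: "0 \<le> ?p" "?p \<le> 1" by (rule bump_nonneg bump_le_1)+
        have "2 * r * ?p \<le> 2 * b * 1"
          by (rule mult_mono) (use ar ab p in auto)
        then have "\<bar>f r\<bar> * (2 * r * ?p) \<le> \<bar>f r\<bar> * (2 * b)"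
          by (intro mult_left_mono) auto
        moreover have "0 \<le> 2 * r * ?p" using True p(1) by simp
        ultimately show ?thesis using True ar ab p(1) by (simp add: abs_mult mult_ac)
      next
        case False
        then have "r < 0 \<or> bump (a\<^sup>2) (b\<^sup>2) n (r\<^sup>2) = 0" using bump_eq_0[of "r\<^sup>2" "a\<^sup>2" "b\<^sup>2" n] by (auto simp: not_less)
        then show ?thesis by auto
      qed
    qed
  qed measurable
  have "AE r in lborel. 0 < r \<and> r < \<rho>\<^sub>1 \<longrightarrow> 0 \<le> 2 * r * (L r - C)"
  proof (rule AE_nonneg_of_bumps)
    fix a b :: real assume ab: "0 < a" "a < b" "b < \<rho>\<^sub>1"
    then have b: "b < \<rho>" using \<rho> by simp
    have "integrable lborel (\<lambda>r. indicator {a..b} r * (2 * r * - C))"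
      by (rule integrable_indicator_continuous) (auto intro!: continuous_intros)
    moreover have "integrable lborel (\<lambda>r. 2 * r * (indicator {a..b} r * L r))"
    proof (rule Bochner_Integration.integrable_bound)
      show "integrable lborel (\<lambda>r. 2 * b * (indicator {a..b} r * L r))" using intL[OF ab(1,2) b] by simp
      show "AE r in lborel. norm (2 * r * (indicator {a..b} r * L r)) \<le> norm (2 * b * (indicator {a..b} r * L r))"
        using ab by (intro AE_I2) (auto simp: abs_mult split: split_indicator intro!: mult_right_mono)
    qed measurable
    ultimately show "integrable lborel (\<lambda>r. indicator {a..b} r * (2 * r * (L r - C)))"
      by (rule Bochner_Integration.integrable_cong[THEN iffD1, OF refl _ Bochner_Integration.integrable_add, rotated]) (simp add: algebra_simps)
    fix n
    have absq: "a\<^sup>2 < b\<^sup>2" using ab by (intro power_strict_mono) auto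
    obtain P I where P: "\<And>t. (P has_real_derivative bump (a\<^sup>2) (b\<^sup>2) n t) (at t)" "smooth P" "I > 0"
      "\<And>t. t \<le> a\<^sup>2 \<Longrightarrow> P t = 0" "\<And>t. t \<ge> b\<^sup>2 \<Longrightarrow> P t = I" "\<And>t. 0 \<le> P t" "\<And>t. P t \<le> I"
      by (rule bump_primitive[OF absq, of n]) blast
    \<comment> \<open>The fixed bump \<open>q\<close> further out compensates the mass of the bump near the origin, so that the
      primitive has compact support; it is nonnegative because \<open>q\<close> lies to the right.\<close>
    define \<psi> where "\<psi> t = P t + (- (I / Iq)) * Q t" for t
    have b1: "b\<^sup>2 < \<rho>\<^sub>1\<^sup>2" using ab by (intro power_strict_mono) auto
    have sm: "smooth \<psi>"
      unfolding \<psi>_def[abs_def] by (intro smooth_add smooth_cmult P Q)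
    have D: "deriv \<psi> t = bump (a\<^sup>2) (b\<^sup>2) n t - I / Iq * q t" for t
      unfolding \<psi>_def[abs_def] using Q(3)
      by (intro DERIV_imp_deriv) (auto intro!: derivative_eq_intros P(1) Q(1))
    have nn: "0 \<le> \<psi> t" for t
    proof (cases "t \<le> \<rho>\<^sub>1\<^sup>2")
      case True then show ?thesis using P(6) Q(4) by (simp add: \<psi>_def)
    next
      case False
      then have "P t = I" using P(5) b1 by simp
      then have "\<psi> t = I * (1 - Q t / Iq)" by (simp add: \<psi>_def algebra_simps)
      also have "\<dots> \<ge> 0" using Q(3) Q(7)[of t] P(3) by (intro mult_nonneg_nonneg) auto
      finally show ?thesis .
    qed
    have 0: "0 \<le> (\<integral>r. indicator {0..} r * (L r * (2 * r * deriv \<psi> (r\<^sup>2))) \<partial>lborel)"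
      unfolding L_def
    proof (rule ineq[OF sm ab(1) _ \<rho>(3) nn])
      show "a < \<rho>\<^sub>2" using ab \<rho> by simp
      show "\<psi> t = 0" if "t \<le> a\<^sup>2" for t using that P(4)[of t] Q(4)[of t] b1 absq by (simp add: \<psi>_def)
      show "\<psi> t = 0" if "t \<ge> \<rho>\<^sub>2\<^sup>2" for t using that P(5)[of t] Q(5)[of t] b1 \<rho>sq Q(3) by (simp add: \<psi>_def)
    qed
    let ?p = "\<lambda>r. bump (a\<^sup>2) (b\<^sup>2) n (r\<^sup>2)"
    have i1: "integrable lborel (\<lambda>r. indicator {0..} r * (L r * (2 * r * ?p r)))"
      by (rule int_bump[OF ab(1,2) b _ intL[OF ab(1,2) b]]) measurable
    have i2: "integrable lborel (\<lambda>r. indicator {0..} r * (L r * (2 * r * q (r\<^sup>2))))"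
      unfolding q_def by (rule int_bump[OF \<rho> _ intL[OF \<rho>]]) measurable
    have i3: "integrable lborel (\<lambda>r. indicator {0..} r * (C * (2 * r * ?p r)))"
      by (rule int_bump[OF ab(1,2) b _ integrable_indicator_continuous]) (auto intro!: continuous_intros)
    \<comment> \<open>The factor 2 r is the Jacobian of t = r^2, so the bump has in the variable r
      the same mass \<open>I\<close> as in t; therefore \<open>C * I\<close> is exactly the
      compensating term in \<open>\<psi>\<close>.\<close>
    have Ip: "(\<integral>r. indicator {0..} r * (1 * (2 * r * ?p r)) \<partial>lborel) = I"
    proof -
      have "(\<integral>r. (2 * r * ?p r) * indicator {0..b} r \<partial>lborel) = P (b\<^sup>2) - P (0\<^sup>2)"
      proof (rule integral_FTC_Icc_real)
        show "((\<lambda>r. P (r\<^sup>2)) has_real_derivative 2 * r * ?p r) (at r)" for r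
          by (rule DERIV_comp_sq[OF P(1)])
        show "isCont (\<lambda>r. 2 * r * ?p r) r" for r
          using DERIV_isCont[OF DERIV_comp_sq[OF smooth_DERIV[OF smooth_bump]]]
          by (intro continuous_intros)
      qed (use ab in auto)
      moreover have "P (b\<^sup>2) = I" "P (0\<^sup>2) = 0" using P(4,5) by auto
      moreover have "(\<integral>r. indicator {0..} r * (1 * (2 * r * ?p r)) \<partial>lborel) = (\<integral>r. (2 * r * ?p r) * indicator {0..b} r \<partial>lborel)"
      proof (intro Bochner_Integration.integral_cong refl)
        fix r :: real
        have "b\<^sup>2 \<le> r\<^sup>2" if "b < r" using that ab by (intro power_mono) auto
        then show "indicator {0..} r * (1 * (2 * r * ?p r)) = (2 * r * ?p r) * indicator {0..b} r"
          using bump_eq_0[of "r\<^sup>2" "a\<^sup>2" "b\<^sup>2" n] by (auto split: split_indicator)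
      qed
      ultimately show ?thesis by simp
    qed
    have "(\<integral>r. indicator {0..} r * (2 * r * (L r - C) * ?p r) \<partial>lborel) = 
      (\<integral>r. indicator {0..} r * (L r * (2 * r * ?p r)) - indicator {0..} r * (C * (2 * r * ?p r)) \<partial>lborel)"
      by (intro Bochner_Integration.integral_cong) (auto simp: algebra_simps)
    also have "\<dots> = (\<integral>r. indicator {0..} r * (L r * (2 * r * ?p r)) \<partial>lborel) - (\<integral>r. indicator {0..} r * (C * (2 * r * ?p r)) \<partial>lborel)"
      using i1 i3 by (rule Bochner_Integration.integral_diff)
    also have "(\<integral>r. indicator {0..} r * (C * (2 * r * ?p r)) \<partial>lborel) = C * (\<integral>r. indicator {0..} r * (1 * (2 * r * ?p r)) \<partial>lborel)"
      by (subst integral_mult_right_zero[symmetric]) (simp add: mult_ac)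
    also have "\<dots> = C * I" unfolding Ip ..
    also have "C * I = I / Iq * (\<integral>r. indicator {0..} r * (L r * (2 * r * q (r\<^sup>2))) \<partial>lborel)"
      by (simp add: C_def)
    also have "\<dots> = (\<integral>r. I / Iq * (indicator {0..} r * (L r * (2 * r * q (r\<^sup>2)))) \<partial>lborel)"
      by (rule integral_mult_right_zero[symmetric])
    also have "(\<integral>r. indicator {0..} r * (L r * (2 * r * ?p r)) \<partial>lborel) - \<dots> = 
        (\<integral>r. indicator {0..} r * (L r * (2 * r * ?p r)) - I / Iq * (indicator {0..} r * (L r * (2 * r * q (r\<^sup>2)))) \<partial>lborel)"
      using i1 integrable_mult_right[OF i2] by (intro Bochner_Integration.integral_diff[symmetric]) auto
    also have "\<dots> = (\<integral>r. indicator {0..} r * (L r * (2 * r * deriv \<psi> (r\<^sup>2))) \<partial>lborel)"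
      unfolding D by (intro Bochner_Integration.integral_cong) (auto simp: algebra_simps)
    finally show "0 \<le> (\<integral>r. indicator {0..} r * (2 * r * (L r - C) * ?p r) \<partial>lborel)"
      using 0 by simp
  qed measurable
  then have "AE r in lborel. 0 < r \<and> r < \<rho>\<^sub>1 \<longrightarrow> C - c * ln r \<le> U r"
    by eventually_elim (auto simp: zero_le_mult_iff L_def)
  with \<rho>(1) show ?thesis by (rule that)
qed

lemma integrable_radial_coefficient_power:
  fixes w :: "real ^ 'n \<Rightarrow> real ^ 'n"
  assumes [measurable]: "H \<in> borel_measurable borel" "w \<in> borel_measurable borel"
    and H: "AE x in lborel. norm x < \<rho> \<longrightarrow> w x = (H (norm x) / norm x) *\<^sub>R x"
    and w: "integrable lborel (\<lambda>x. norm (w x) ^ m)"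
  shows "integrable lborel (\<lambda>r. indicator {0..} r * sphere_area TYPE(real ^ 'n) r * (indicator {..<\<rho>} r * \<bar>H r\<bar> ^ m))"
proof -
  let ?F = "\<lambda>r. indicator {..<\<rho>} r * \<bar>H r\<bar> ^ m"
  have "integrable lborel (\<lambda>x::real ^ 'n. ?F (norm x))"
  proof (rule Bochner_Integration.integrable_bound[OF w])
    show "AE x in lborel. norm (?F (norm x)) \<le> norm (norm (w x) ^ m)"
      using H AE_lborel_singleton[of "0 :: real ^ 'n"]
    proof eventually_elim
      case (elim x)
      then show ?case by (cases "norm x < \<rho>") auto
    qed
  qed measurable
  then show ?thesis by (subst (asm) integrable_radial_iff) auto
qed

text \<open>A test function equal to a constant near 0 and falling to 0 across a shell picks up the
  mass at the origin, while its gradient samples the flux in the shell alone. Shrinking the shells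
  gives the bound on almost every sphere.\<close>

lemma radial_flux_bound:
  fixes w :: "real ^ 'n \<Rightarrow> real ^ 'n"
  assumes card: "CARD('n) \<ge> 2" and "\<alpha> > 0"
    and [measurable]: "H \<in> borel_measurable borel" "w \<in> borel_measurable borel"
    and H: "AE x in lborel. norm x < \<rho> \<longrightarrow> w x = (H (norm x) / norm x) *\<^sub>R x"
    and w: "integrable lborel (\<lambda>x. norm (w x) ^ (CARD('n) - 1))"
    and flux: "\<And>\<phi>. \<phi> \<in> test_functions (ball 0 \<rho>) \<Longrightarrow> (\<And>x. 0 \<le> \<phi> x) \<Longrightarrow> 
      \<alpha> * \<phi> 0 \<le> (\<integral>x. N_flux (w x) \<bullet> grad \<phi> x \<partial>lborel)"
  obtains c where "c > 0" "AE r in lborel. 0 < r \<and> r < \<rho> \<longrightarrow> c \<le> - (H r * r)"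
proof -
  let ?N = "CARD('n)"
  let ?A = "sphere_area TYPE(real ^ 'n)"
  \<comment> \<open>Up to the factor 2 r coming from the derivative of r^2, this is the outward flux
    of -|w|^(N-2) w through the sphere of radius r, minus \<open>\<alpha>\<close>.\<close>
  define G where "G r = 2 * r * (- (?A r * (\<bar>H r\<bar> ^ (?N - 2) * H r)) - \<alpha>)" for r
  have [measurable]: "G \<in> borel_measurable borel" unfolding G_def[abs_def] by measurable
  note [measurable] = smooth_measurable[OF smooth_bump]
  note IH = integrable_radial_coefficient_power[OF assms(3,4) H w]
  have N1: "?N - 1 = Suc (?N - 2)" using card by simp
  have powN: "\<bar>h\<bar> ^ (?N - 2) * \<bar>h\<bar> = \<bar>h\<bar> ^ (?N - 1)" for h :: real
    unfolding N1 by (simp add: mult.commute)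
  \<comment> \<open>The bounded weight \<open>k\<close> lets one estimate serve both the indicator
    of [a, b] and the bumps.\<close>
  have IG1: "integrable lborel (\<lambda>r. k r * (indicator {0..b} r * (2 * r * (?A r * (\<bar>H r\<bar> ^ (?N - 2) * H r)))))" 
    if "0 < b" "b < \<rho>" and [measurable]: "k \<in> borel_measurable borel" and k: "\<And>r. \<bar>k r\<bar> \<le> 1" for b k
  proof (rule Bochner_Integration.integrable_bound)
    show "integrable lborel (\<lambda>r. 2 * b * (indicator {0..} r * ?A r * (indicator {..<\<rho>} r * \<bar>H r\<bar> ^ (?N - 1))))"
      using IH by (rule integrable_mult_right)
    show "AE r in lborel. norm (k r * (indicator {0..b} r * (2 * r * (?A r * (\<bar>H r\<bar> ^ (?N - 2) * H r))))) 
      \<le> norm (2 * b * (indicator {0..} r * ?A r * (indicator {..<\<rho>} r * \<bar>H r\<bar> ^ (?N - 1))))"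
    proof (intro AE_I2)
      fix r
      show "norm (k r * (indicator {0..b} r * (2 * r * (?A r * (\<bar>H r\<bar> ^ (?N - 2) * H r))))) 
      \<le> norm (2 * b * (indicator {0..} r * ?A r * (indicator {..<\<rho>} r * \<bar>H r\<bar> ^ (?N - 1))))"
      proof (cases "r \<in> {0..b}")
        case True
        then have A: "0 \<le> ?A r" "r < \<rho>" using sphere_area_nonneg that(2) by auto
        have "norm (k r * (indicator {0..b} r * (2 * r * (?A r * (\<bar>H r\<bar> ^ (?N - 2) * H r))))) = 
          (\<bar>k r\<bar> * (2 * r)) * (?A r * \<bar>H r\<bar> ^ (?N - 1))"
          using True A by (simp add: abs_mult power_abs powN[simplified])
        also have "\<dots> \<le> (1 * (2 * b)) * (?A r * \<bar>H r\<bar> ^ (?N - 1))"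
          using True A k[of r] by (intro mult_right_mono mult_mono) auto
        also have "\<dots> = norm (2 * b * (indicator {0..} r * ?A r * (indicator {..<\<rho>} r * \<bar>H r\<bar> ^ (?N - 1))))"
          using True A that(1) by (simp add: abs_mult)
        finally show ?thesis .
      qed auto
    qed
  qed measurable
  have IG2: "integrable lborel (\<lambda>r. k r * (indicator {0..b} r * (2 * r * \<alpha>)))"
    if "0 < b" and [measurable]: "k \<in> borel_measurable borel" and k: "\<And>r. \<bar>k r\<bar> \<le> 1" for b k
  proof (rule Bochner_Integration.integrable_bound)
    show "integrable lborel (\<lambda>r. indicator {0..b} r * (2 * r * \<alpha>))"
      by (rule integrable_indicator_continuous) (auto intro!: continuous_intros)
    show "AE r in lborel. norm (k r * (indicator {0..b} r * (2 * r * \<alpha>))) \<le> norm (indicator {0..b} r * (2 * r * \<alpha>))"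
    proof (intro AE_I2)
      fix r
      have "\<bar>k r\<bar> * \<bar>indicator {0..b} r * (2 * r * \<alpha>)\<bar> \<le> 1 * \<bar>indicator {0..b} r * (2 * r * \<alpha>)\<bar>"
        by (intro mult_right_mono k) simp
      then show "norm (k r * (indicator {0..b} r * (2 * r * \<alpha>))) \<le> norm (indicator {0..b} r * (2 * r * \<alpha>))"
        unfolding real_norm_def abs_mult[of "k r"] by simp
    qed
  qed measurable
  have "AE r in lborel. 0 < r \<and> r < \<rho> \<longrightarrow> 0 \<le> G r"
  proof (rule AE_nonneg_of_bumps)
    fix a b :: real assume ab: "0 < a" "a < b" "b < \<rho>"
    have "integrable lborel (\<lambda>r. - (indicator {a..b} r * (indicator {0..b} r * (2 * r * (?A r * (\<bar>H r\<bar> ^ (?N - 2) * H r))))) 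
        - indicator {a..b} r * (indicator {0..b} r * (2 * r * \<alpha>)))"
      using ab by (intro Bochner_Integration.integrable_diff Bochner_Integration.integrable_minus IG1 IG2) 
         (auto split: split_indicator)
    also have "(\<lambda>r. - (indicator {a..b} r * (indicator {0..b} r * (2 * r * (?A r * (\<bar>H r\<bar> ^ (?N - 2) * H r))))) 
        - indicator {a..b} r * (indicator {0..b} r * (2 * r * \<alpha>))) = (\<lambda>r. indicator {a..b} r * G r)"
      using ab by (intro ext) (auto simp: G_def algebra_simps split: split_indicator)
    finally show "integrable lborel (\<lambda>r. indicator {a..b} r * G r)" .
    fix n
    have absq: "a\<^sup>2 < b\<^sup>2" using ab by (intro power_strict_mono) auto
    obtain P I where P: "\<And>t. (P has_real_derivative bump (a\<^sup>2) (b\<^sup>2) n t) (at t)" "smooth P" "I > 0"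
      "\<And>t. t \<le> a\<^sup>2 \<Longrightarrow> P t = 0" "\<And>t. t \<ge> b\<^sup>2 \<Longrightarrow> P t = I" "\<And>t. 0 \<le> P t" "\<And>t. P t \<le> I"
      by (rule bump_primitive[OF absq, of n]) blast
    \<comment> \<open>The plateau has height \<open>I\<close>, so the Dirac term is
      \<open>\<alpha> * I\<close>, which is also the integral of \<open>\<alpha>\<close> against 2 r
      times the bump; the two can be joined in a single integral of \<open>G\<close>.\<close>
    define \<eta> where "\<eta> t = I + (- 1) * P t" for t
    have sm: "smooth \<eta>" unfolding \<eta>_def[abs_def] by (intro smooth_add smooth_const smooth_cmult P)
    have D: "deriv \<eta> t = - bump (a\<^sup>2) (b\<^sup>2) n t" for t
      unfolding \<eta>_def[abs_def] by (intro DERIV_imp_deriv) (auto intro!: derivative_eq_intros P(1))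
    let ?\<phi> = "\<lambda>x::real ^ 'n. \<eta> ((norm (x - 0))\<^sup>2)"
    let ?p = "\<lambda>r. bump (a\<^sup>2) (b\<^sup>2) n (r\<^sup>2)"
    have test: "?\<phi> \<in> test_functions (ball 0 \<rho>)"
      by (rule radial_test_function[OF sm, of b]) (use ab P(5) in \<open>auto simp: \<eta>_def\<close>)
    have gr: "grad ?\<phi> x = (- 2 * ?p (norm x)) *\<^sub>R x" for x
      by (simp add: vec_eq_iff grad_nth partial_deriv_radial[OF sm, of _ 0, simplified] D)
    have "\<alpha> * I = \<alpha> * ?\<phi> 0" using P(4)[of 0] by (simp add: \<eta>_def)
    also have "\<dots> \<le> (\<integral>x. N_flux (w x) \<bullet> grad ?\<phi> x \<partial>lborel)"
      by (rule flux[OF test]) (use P(7) in \<open>auto simp: \<eta>_def\<close>)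
    also have "\<dots> = (\<integral>x. (\<lambda>r. \<bar>H r\<bar> ^ (?N - 2) * H r * r * (- 2 * ?p r)) (norm (x :: real ^ 'n)) \<partial>lborel)"
    proof (rule integral_cong_AE)
      show "AE x in lborel. N_flux (w x) \<bullet> grad ?\<phi> x = \<bar>H (norm x)\<bar> ^ (?N - 2) * H (norm x) * norm x * (- 2 * ?p (norm x))"
        using H AE_lborel_singleton[of "0 :: real ^ 'n"]
      proof eventually_elim
        case (elim x)
        show ?case
        proof (cases "norm x < \<rho>")
          case True
          then have wx: "w x = (H (norm x) / norm x) *\<^sub>R x" using elim by simp
          have nw: "norm (w x) = \<bar>H (norm x)\<bar>" using elim by (simp add: wx)
          have "N_flux (w x) \<bullet> grad ?\<phi> x = \<bar>H (norm x)\<bar> ^ (?N - 2) * (- 2 * ?p (norm x)) * (w x \<bullet> x)"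
            unfolding gr N_flux_def nw by simp
          also have "w x \<bullet> x = H (norm x) * norm x"
            using elim by (simp add: wx power2_norm_eq_inner[symmetric] power2_eq_square)
          finally show ?thesis by (simp add: mult_ac)
        next
          case False
          then have "b\<^sup>2 \<le> (norm x)\<^sup>2" using ab by (intro power_mono) auto
          then show ?thesis
            unfolding gr using bump_eq_0[of "(norm x)\<^sup>2" "a\<^sup>2" "b\<^sup>2" n] by simp
        qed
      qed
      show "(\<lambda>x. N_flux (w x) \<bullet> grad ?\<phi> x) \<in> borel_measurable lborel"
        unfolding gr N_flux_def by measurable
    qed measurable
    also have "\<dots> = (\<integral>r. indicator {0..} r * ?A r * (\<bar>H r\<bar> ^ (?N - 2) * H r * r * (- 2 * ?p r)) \<partial>lborel)"
      by (rule integral_radial) measurable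
    also have "\<dots> = (\<integral>r. - (?p r * (indicator {0..b} r * (2 * r * (?A r * (\<bar>H r\<bar> ^ (?N - 2) * H r))))) \<partial>lborel)"
    proof (intro Bochner_Integration.integral_cong refl)
      fix r :: real
      have "b\<^sup>2 \<le> r\<^sup>2" if "b < r" using that ab by (intro power_mono) auto
      then show "indicator {0..} r * ?A r * (\<bar>H r\<bar> ^ (?N - 2) * H r * r * (- 2 * ?p r)) =
        - (?p r * (indicator {0..b} r * (2 * r * (?A r * (\<bar>H r\<bar> ^ (?N - 2) * H r)))))"
        using bump_eq_0[of "r\<^sup>2" "a\<^sup>2" "b\<^sup>2" n] by (auto split: split_indicator)
    qed
    finally have 1: "\<alpha> * I \<le> (\<integral>r. - (?p r * (indicator {0..b} r * (2 * r * (?A r * (\<bar>H r\<bar> ^ (?N - 2) * H r))))) \<partial>lborel)" .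
    have "(\<integral>r. (2 * r * ?p r) * indicator {0..b} r \<partial>lborel) = P (b\<^sup>2) - P (0\<^sup>2)"
    proof (rule integral_FTC_Icc_real)
      show "((\<lambda>r. P (r\<^sup>2)) has_real_derivative 2 * r * ?p r) (at r)" for r
        by (rule DERIV_comp_sq[OF P(1)])
      show "isCont (\<lambda>r. 2 * r * ?p r) r" for r
        using DERIV_isCont[OF DERIV_comp_sq[OF smooth_DERIV[OF smooth_bump]]]
        by (intro continuous_intros)
    qed (use ab in auto)
    then have "(\<integral>r. (2 * r * ?p r) * indicator {0..b} r \<partial>lborel) = I" using P(4,5) by simp
    then have "\<alpha> * I = \<alpha> * (\<integral>r. (2 * r * ?p r) * indicator {0..b} r \<partial>lborel)" by simp
    also have "\<dots> = (\<integral>r. \<alpha> * ((2 * r * ?p r) * indicator {0..b} r) \<partial>lborel)"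
      by (rule integral_mult_right_zero[symmetric])
    finally have 2: "\<alpha> * I = (\<integral>r. ?p r * (indicator {0..b} r * (2 * r * \<alpha>)) \<partial>lborel)"
      by (simp add: mult_ac)
    have kp: "\<bar>?p r\<bar> \<le> 1" for r using bump_nonneg bump_le_1 by (simp add: abs_le_iff) 
    have "(\<integral>r. indicator {0..} r * (G r * ?p r) \<partial>lborel) = 
      (\<integral>r. - (?p r * (indicator {0..b} r * (2 * r * (?A r * (\<bar>H r\<bar> ^ (?N - 2) * H r))))) - ?p r * (indicator {0..b} r * (2 * r * \<alpha>)) \<partial>lborel)"
    proof (intro Bochner_Integration.integral_cong refl)
      fix r :: real
      have "b\<^sup>2 \<le> r\<^sup>2" if "b < r" using that ab by (intro power_mono) auto
      then show "indicator {0..} r * (G r * ?p r) =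
        - (?p r * (indicator {0..b} r * (2 * r * (?A r * (\<bar>H r\<bar> ^ (?N - 2) * H r))))) - ?p r * (indicator {0..b} r * (2 * r * \<alpha>))"
        using bump_eq_0[of "r\<^sup>2" "a\<^sup>2" "b\<^sup>2" n] by (auto simp: G_def algebra_simps split: split_indicator)
    qed
    also have "\<dots> = (\<integral>r. - (?p r * (indicator {0..b} r * (2 * r * (?A r * (\<bar>H r\<bar> ^ (?N - 2) * H r))))) \<partial>lborel) - \<alpha> * I"
      unfolding 2
    proof (rule Bochner_Integration.integral_diff)
      show "integrable lborel (\<lambda>r. - (?p r * (indicator {0..b} r * (2 * r * (?A r * (\<bar>H r\<bar> ^ (?N - 2) * H r))))))"
        by (rule Bochner_Integration.integrable_minus[OF IG1[OF _ ab(3) _ kp]]) (use ab in auto)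
      show "integrable lborel (\<lambda>r. ?p r * (indicator {0..b} r * (2 * r * \<alpha>)))"
        by (rule IG2[OF _ _ kp]) (use ab in auto)
    qed
    finally show "0 \<le> (\<integral>r. indicator {0..} r * (G r * ?p r) \<partial>lborel)" using 1 by simp
  qed measurable
  moreover
  define \<kappa> where "\<kappa> = real ?N * unit_ball_vol ?N"
  have \<kappa>: "\<kappa> > 0" by (simp add: \<kappa>_def)
  have A: "?A r = \<kappa> * r ^ (?N - 1)" for r by (simp add: sphere_area_def \<kappa>_def)
  \<comment> \<open>The positive solution of \<kappa> c^(N-1) = \<alpha>, where \<kappa> is the area
    of the unit sphere; since N >= 2, the order N - 1 of the root is not 0.\<close>
  define c where "c = root (?N - 1) (\<alpha> / \<kappa>)"
  have c: "c > 0" using card \<open>\<alpha> > 0\<close> \<kappa> by (simp add: c_def)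
  have cN: "c ^ (?N - 1) = \<alpha> / \<kappa>" using card \<open>\<alpha> > 0\<close> \<kappa> by (simp add: c_def)
  have "c \<le> - (H r * r)" if r: "0 < r" and G: "0 \<le> G r" for r
  proof -
    have *: "\<alpha> \<le> - (\<kappa> * r ^ (?N - 1) * (\<bar>H r\<bar> ^ (?N - 2) * H r))"
      using G r by (simp add: G_def A zero_le_mult_iff)
    \<comment> \<open>With H(r) >= 0 the flux term would be nonpositive and could not reach \<alpha>
      > 0. The sign is needed to read the inequality as one on |H|.\<close>
    have neg: "H r < 0"
    proof (rule ccontr)
      assume "\<not> H r < 0"
      then have "0 \<le> \<kappa> * r ^ (?N - 1) * (\<bar>H r\<bar> ^ (?N - 2) * H r)" using \<kappa> r by simp
      with * \<open>\<alpha> > 0\<close> show False by linarith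
    qed
    have "\<bar>H r\<bar> ^ (?N - 2) * H r = - (\<bar>H r\<bar> ^ (?N - 1))"
      using powN[of "H r"] neg by simp
    with * have "\<alpha> \<le> \<kappa> * (r * \<bar>H r\<bar>) ^ (?N - 1)"
      by (simp add: power_mult_distrib)
    then have "c ^ (?N - 1) \<le> (r * \<bar>H r\<bar>) ^ (?N - 1)"
      unfolding cN using \<kappa> by (simp add: pos_divide_le_eq mult.commute)
    then have "c \<le> r * \<bar>H r\<bar>"
      unfolding N1 by (rule power_le_imp_le_base) (use r in simp)
    then show ?thesis using neg by (simp add: mult.commute)
  qed
  ultimately have "AE r in lborel. 0 < r \<and> r < \<rho> \<longrightarrow> c \<le> - (H r * r)"
    by (auto elim!: eventually_mono)
  with c show ?thesis by (rule that)
qed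

text \<open>Away from 0 the area factor is at least its value at the inner radius and can be divided
  out.\<close>

lemma integrable_radial_annulus:
  fixes u :: "real ^ 'n \<Rightarrow> real"
  assumes [measurable]: "U \<in> borel_measurable borel"
    and u: "integrable lborel u" and U: "AE x in lborel. u x = U (norm x)"
    and ab: "0 < a"
  shows "integrable lborel (\<lambda>r. indicator {a..b} r * U r)"
proof -
  let ?A = "sphere_area TYPE(real ^ 'n)"
  have [measurable]: "u \<in> borel_measurable borel"
    using borel_measurable_integrable[OF u] by simp
  have "integrable lborel (\<lambda>x::real ^ 'n. U (norm x))"
    using U u by (subst integrable_cong_AE[of _ _ u]) auto
  then have I: "integrable lborel (\<lambda>r. indicator {0..} r * ?A r * U r)"
    by (subst (asm) integrable_radial_iff) auto
  have Aa: "?A a > 0" using ab by (rule sphere_area_pos)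
  show ?thesis
  proof (rule Bochner_Integration.integrable_bound)
    show "integrable lborel (\<lambda>r. 1 / ?A a * (indicator {0..} r * ?A r * U r))"
      using I by (rule integrable_mult_right)
    show "AE r in lborel. norm (indicator {a..b} r * U r) \<le> norm (1 / ?A a * (indicator {0..} r * ?A r * U r))"
    proof (intro AE_I2)
      fix r :: real
      show "norm (indicator {a..b} r * U r) \<le> norm (1 / ?A a * (indicator {0..} r * ?A r * U r))"
      proof (cases "r \<in> {a..b}")
        case True
        then have "?A a \<le> ?A r"
          unfolding sphere_area_def using ab by (intro mult_left_mono power_mono) auto
        then have "1 * \<bar>U r\<bar> \<le> (?A r / ?A a) * \<bar>U r\<bar>"
          using Aa by (intro mult_right_mono) auto
        then show ?thesis using True Aa ab \<open>?A a \<le> ?A r\<close> by (simp add: abs_mult)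
      qed auto
    qed
  qed measurable
qed

text \<open>The weight in the test field cancels the area factor, so that the weak gradient reads in
  one dimension: the integral of U (\<psi>(r^2))' equals minus the integral of H \<psi>(r^2). Then
  -H >= c / r = (c ln r)' and one integration by parts give the claim.\<close>

lemma radial_weak_inequality:
  fixes u :: "real ^ 'n \<Rightarrow> real" and w :: "real ^ 'n \<Rightarrow> real ^ 'n"
  assumes [measurable]: "U \<in> borel_measurable borel" "H \<in> borel_measurable borel"
    and u: "integrable lborel u" and U: "AE x in lborel. u x = U (norm x)"
    and w: "integrable lborel w"
    and H: "AE x in lborel. norm x < \<rho> \<longrightarrow> w x = (H (norm x) / norm x) *\<^sub>R x"
    and c: "AE r in lborel. 0 < r \<and> r < \<rho> \<longrightarrow> c \<le> - (H r * r)"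
    and weak: "\<And>\<phi> i. \<phi> \<in> test_functions (ball 0 \<rho>) \<Longrightarrow> 
      (\<integral>x. u x * partial_deriv i \<phi> x \<partial>lborel) = - (\<integral>x. w x $ i * \<phi> x \<partial>lborel)"
    and \<psi>: "smooth \<psi>" "0 < a" "a < s" "s < \<rho>" "\<And>t. 0 \<le> \<psi> t"
      "\<And>t. t \<le> a\<^sup>2 \<Longrightarrow> \<psi> t = 0" "\<And>t. t \<ge> s\<^sup>2 \<Longrightarrow> \<psi> t = 0"
  shows "0 \<le> (\<integral>r. indicator {0..} r * ((U r + c * ln r) * (2 * r * deriv \<psi> (r\<^sup>2))) \<partial>lborel)"
proof -
  let ?N = "CARD('n)"
  let ?A = "sphere_area TYPE(real ^ 'n)"
  define \<kappa> where "\<kappa> = real ?N * unit_ball_vol ?N"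
  have \<kappa>: "\<kappa> > 0" by (simp add: \<kappa>_def)
  have A: "?A r = \<kappa> * r ^ (?N - 1)" for r by (simp add: sphere_area_def \<kappa>_def)
  have N1: "r * r ^ (?N - 1) = r ^ ?N" for r :: real
    by (metis One_nat_def Suc_pred zero_less_card_finite power_Suc)
  have as: "0 < s" using \<psi> by simp
  \<comment> \<open>With this weight the divergence of \<open>\<zeta>(|x|\<^sup>2) x\<close> is \<open>2 |x|\<^sup>2\<^sup>-\<^sup>N \<psi>'(|x|\<^sup>2)\<close>.\<close>
  define \<zeta> where "\<zeta> t = t powr (- (real ?N / 2)) * \<psi> t" for t
  have sm: "smooth \<zeta>"
    unfolding \<zeta>_def[abs_def] by (rule smooth_powr_mult[OF \<psi>(1), of "a\<^sup>2"]) (use \<psi> in auto)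
  have \<zeta>0: "\<zeta> t = 0" if "t \<ge> s\<^sup>2" for t using \<psi>(7)[OF that] by (simp add: \<zeta>_def)
  have \<psi>'0: "deriv \<psi> t = 0" if "t \<ge> s\<^sup>2" for t
    by (rule smooth_deriv_eq_0[OF \<psi>(1) \<psi>(7) that])
  have \<zeta>'0: "deriv \<zeta> t = 0" if "t \<ge> s\<^sup>2" for t
    by (rule smooth_deriv_eq_0[OF sm \<zeta>0 that])
  have powr_sq: "(r\<^sup>2) powr (- (real ?N / 2)) = 1 / r ^ ?N" if "r > 0" for r :: real
  proof -
    have "(r\<^sup>2) powr (- (real ?N / 2)) = (r powr 2) powr (- (real ?N / 2))"
      using that by simp
    also have "\<dots> = r powr (- real ?N)" by (simp only: powr_powr) simp
    also have "\<dots> = 1 / r ^ ?N" using that by (simp add: powr_minus_divide powr_realpow)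
    finally show ?thesis .
  qed
  \<comment> \<open>The exponent -N/2 is the one for which the terms containing
    \<open>\<psi>\<close> undifferentiated cancel: differentiating the power yields -N \<zeta> after
    multiplication by 2 t.\<close>
  have D\<zeta>: "?N * \<zeta> t + 2 * t * deriv \<zeta> t = 2 * t * t powr (- (real ?N / 2)) * deriv \<psi> t" if "t > 0" for t
  proof -
    have "(\<zeta> has_real_derivative (- (real ?N / 2)) * t powr (- (real ?N / 2) - 1) * \<psi> t + t powr (- (real ?N / 2)) * deriv \<psi> t) (at t)"
      unfolding \<zeta>_def[abs_def] using that
      by (auto intro!: derivative_eq_intros smooth_DERIV[OF \<psi>(1)])
    then have "deriv \<zeta> t = (- (real ?N / 2)) * t powr (- (real ?N / 2) - 1) * \<psi> t + t powr (- (real ?N / 2)) * deriv \<psi> t"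
      by (rule DERIV_imp_deriv)
    moreover have "t powr (- (real ?N / 2)) = t * t powr (- (real ?N / 2) - 1)"
      using that by (simp add: powr_diff)
    ultimately show ?thesis unfolding \<zeta>_def
      by (simp only:) (simp add: algebra_simps)
  qed
  \<comment> \<open>The powers r^(N-1), r^2 and r^(-N) combine to r, leaving the plain derivative 2
    r \<psi>'(r^2) of \<psi>(r^2).\<close>
  have coef1: "?A r * (?N * \<zeta> (r\<^sup>2) + 2 * r\<^sup>2 * deriv \<zeta> (r\<^sup>2)) = \<kappa> * (2 * r * deriv \<psi> (r\<^sup>2))" if r: "r > 0" for r
  proof -
    have "?A r * (?N * \<zeta> (r\<^sup>2) + 2 * r\<^sup>2 * deriv \<zeta> (r\<^sup>2)) = ?A r * (2 * r\<^sup>2 * (1 / r ^ ?N) * deriv \<psi> (r\<^sup>2))"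
      using D\<zeta>[of "r\<^sup>2"] r powr_sq[OF r] by simp
    also have "\<dots> = \<kappa> * (2 * r * deriv \<psi> (r\<^sup>2)) * ((r * r ^ (?N - 1)) / r ^ ?N)"
      by (simp add: A power2_eq_square)
    finally show ?thesis unfolding N1 using r by simp
  qed
  have coef2: "?A r * (H r * r * \<zeta> (r\<^sup>2)) = \<kappa> * (H r * \<psi> (r\<^sup>2))" if r: "r > 0" for r
  proof -
    have "?A r * (H r * r * \<zeta> (r\<^sup>2)) = \<kappa> * (H r * \<psi> (r\<^sup>2)) * ((r * r ^ (?N - 1)) / r ^ ?N)"
      by (simp add: A \<zeta>_def powr_sq[OF r])
    then show ?thesis unfolding N1 using r by simp
  qed
  have [measurable]: "u \<in> borel_measurable borel" "w \<in> borel_measurable borel"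
    using borel_measurable_integrable[OF u] borel_measurable_integrable[OF w] by auto
  note [measurable] = smooth_measurable[OF sm] smooth_measurable[OF smooth_deriv[OF sm]]
    smooth_measurable[OF \<psi>(1)] smooth_measurable[OF smooth_deriv[OF \<psi>(1)]]
  have test: "(\<lambda>x. x $ i * \<zeta> ((norm x)\<^sup>2)) \<in> test_functions (ball 0 \<rho>)" for i
    by (rule nth_radial_test_function[OF sm \<zeta>0, of s]) (use \<psi> in auto)
  have sn: "s\<^sup>2 \<le> (norm z)\<^sup>2" if "s \<le> norm z" for z :: "real ^ 'n"
    using that as by (intro power_mono) auto
  have cont\<zeta>: "continuous_on UNIV (\<lambda>x::real ^ 'n. \<zeta> ((norm x)\<^sup>2))" "continuous_on UNIV (\<lambda>x::real ^ 'n. deriv \<zeta> ((norm x)\<^sup>2))"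
    using continuous_on_smooth_norm_sq[OF sm, of UNIV 0] continuous_on_smooth_norm_sq[OF smooth_deriv[OF sm], of UNIV 0] by auto
  have I1: "integrable lborel (\<lambda>x. u x * (\<zeta> ((norm x)\<^sup>2) + 2 * (x $ i)\<^sup>2 * deriv \<zeta> ((norm x)\<^sup>2)))" for i
  proof -
    have "\<exists>C. \<forall>x::real ^ 'n. norm (\<zeta> ((norm x)\<^sup>2) + 2 * (x $ i)\<^sup>2 * deriv \<zeta> ((norm x)\<^sup>2)) \<le> C"
    proof (rule compact_support_bounded[where a = 0 and s = s])
      show "continuous_on UNIV (\<lambda>x::real ^ 'n. \<zeta> ((norm x)\<^sup>2) + 2 * (x $ i)\<^sup>2 * deriv \<zeta> ((norm x)\<^sup>2))"
        by (intro continuous_on_add continuous_on_mult cont\<zeta> continuous_intros)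
    qed (use \<zeta>0 \<zeta>'0 sn in auto)
    then obtain C where "\<And>x::real ^ 'n. norm (\<zeta> ((norm x)\<^sup>2) + 2 * (x $ i)\<^sup>2 * deriv \<zeta> ((norm x)\<^sup>2)) \<le> C" by blast
    from integrable_scaleR_bounded[OF u _ this] show ?thesis by simp
  qed
  have I2: "integrable lborel (\<lambda>x. w x $ i * (x $ i * \<zeta> ((norm x)\<^sup>2)))" for i
  proof -
    have "\<exists>C. \<forall>x::real ^ 'n. norm (x $ i * \<zeta> ((norm x)\<^sup>2)) \<le> C"
    proof (rule compact_support_bounded[where a = 0 and s = s])
      show "continuous_on UNIV (\<lambda>x::real ^ 'n. x $ i * \<zeta> ((norm x)\<^sup>2))"
        by (intro continuous_on_mult cont\<zeta> continuous_intros)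
    qed (use \<zeta>0 sn in auto)
    then obtain C where "\<And>x::real ^ 'n. norm (x $ i * \<zeta> ((norm x)\<^sup>2)) \<le> C" by blast
    from integrable_scaleR_bounded[OF integrable_bounded_linear[OF bounded_linear_vec_nth w] _ this]
    show ?thesis by simp
  qed
  have sumsq: "(\<Sum>i\<in>UNIV. (x $ i)\<^sup>2) = (norm x)\<^sup>2" for x :: "real ^ 'n"
    by (simp add: norm_vec_def L2_set_def sum_nonneg)
  have e1: "(\<Sum>i\<in>UNIV. u x * (\<zeta> ((norm x)\<^sup>2) + 2 * (x $ i)\<^sup>2 * deriv \<zeta> ((norm x)\<^sup>2))) = 
      u x * (?N * \<zeta> ((norm x)\<^sup>2) + 2 * (norm x)\<^sup>2 * deriv \<zeta> ((norm x)\<^sup>2))" for x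
    by (simp add: sum_distrib_left[symmetric] sum.distrib sum_distrib_right[symmetric] sumsq)
  have e2: "(\<Sum>i\<in>UNIV. w x $ i * (x $ i * \<zeta> ((norm x)\<^sup>2))) = (w x \<bullet> x) * \<zeta> ((norm x)\<^sup>2)" for x
    by (simp add: inner_vec_def sum_distrib_right mult.assoc)
  have wk: "(\<integral>x. u x * (\<zeta> ((norm x)\<^sup>2) + 2 * (x $ i)\<^sup>2 * deriv \<zeta> ((norm x)\<^sup>2)) \<partial>lborel) =
      - (\<integral>x. w x $ i * (x $ i * \<zeta> ((norm x)\<^sup>2)) \<partial>lborel)" for i
    using weak[OF test[of i], of i] unfolding partial_deriv_nth_radial[OF sm] .
  define F1 where "F1 r = U r * (?N * \<zeta> (r\<^sup>2) + 2 * r\<^sup>2 * deriv \<zeta> (r\<^sup>2))" for r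
  define F2 where "F2 r = H r * r * \<zeta> (r\<^sup>2)" for r
  have [measurable]: "F1 \<in> borel_measurable borel" "F2 \<in> borel_measurable borel"
    unfolding F1_def[abs_def] F2_def[abs_def] by measurable
  have ae1: "AE x in lborel. u x * (?N * \<zeta> ((norm x)\<^sup>2) + 2 * (norm x)\<^sup>2 * deriv \<zeta> ((norm x)\<^sup>2)) = F1 (norm x)"
    using U by eventually_elim (simp add: F1_def)
  have ae2: "AE x in lborel. (w x \<bullet> x) * \<zeta> ((norm x)\<^sup>2) = F2 (norm x)"
    using H AE_lborel_singleton[of "0 :: real ^ 'n"]
  proof eventually_elim
    case (elim x)
    show ?case
    proof (cases "norm x < \<rho>")
      case True
      then have wx: "w x = (H (norm x) / norm x) *\<^sub>R x" using elim by simp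
      have "w x \<bullet> x = H (norm x) * norm x"
        using elim by (simp add: wx power2_norm_eq_inner[symmetric] power2_eq_square)
      then show ?thesis by (simp add: F2_def)
    next
      case False
      then show ?thesis using \<zeta>0[OF sn[of x]] \<psi>(4) by (simp add: F2_def)
    qed
  qed
  have int1: "integrable lborel (\<lambda>x. u x * (?N * \<zeta> ((norm x)\<^sup>2) + 2 * (norm x)\<^sup>2 * deriv \<zeta> ((norm x)\<^sup>2)))"
    unfolding e1[symmetric] by (intro Bochner_Integration.integrable_sum I1)
  have int2: "integrable lborel (\<lambda>x. (w x \<bullet> x) * \<zeta> ((norm x)\<^sup>2))"
    unfolding e2[symmetric] by (intro Bochner_Integration.integrable_sum I2)
  have "(\<integral>x. u x * (?N * \<zeta> ((norm x)\<^sup>2) + 2 * (norm x)\<^sup>2 * deriv \<zeta> ((norm x)\<^sup>2)) \<partial>lborel) =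
      (\<Sum>i\<in>UNIV. \<integral>x. u x * (\<zeta> ((norm x)\<^sup>2) + 2 * (x $ i)\<^sup>2 * deriv \<zeta> ((norm x)\<^sup>2)) \<partial>lborel)"
    unfolding e1[symmetric] by (intro Bochner_Integration.integral_sum I1)
  also have "\<dots> = (\<Sum>i\<in>UNIV. - (\<integral>x. w x $ i * (x $ i * \<zeta> ((norm x)\<^sup>2)) \<partial>lborel))"
    by (intro sum.cong refl wk)
  also have "\<dots> = - (\<integral>x. (w x \<bullet> x) * \<zeta> ((norm x)\<^sup>2) \<partial>lborel)"
    unfolding e2[symmetric] by (subst Bochner_Integration.integral_sum[OF I2]) (rule sum_negf)
  finally have "(\<integral>x. F1 (norm (x::real ^ 'n)) \<partial>lborel) = - (\<integral>x. F2 (norm (x::real ^ 'n)) \<partial>lborel)"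
    using integral_cong_AE[OF _ _ ae1] integral_cong_AE[OF _ _ ae2] by simp
  then have eq: "(\<integral>r. indicator {0..} r * ?A r * F1 r \<partial>lborel) = - (\<integral>r. indicator {0..} r * ?A r * F2 r \<partial>lborel)"
    by (simp add: integral_radial)
  have "integrable lborel (\<lambda>x::real ^ 'n. F1 (norm x))"
    using int1 ae1 by (subst (asm) integrable_cong_AE[OF _ _ ae1]) auto
  then have J1: "integrable lborel (\<lambda>r. indicator {0..} r * ?A r * F1 r)"
    by (subst (asm) integrable_radial_iff) auto
  have "integrable lborel (\<lambda>x::real ^ 'n. F2 (norm x))"
    using int2 ae2 by (subst (asm) integrable_cong_AE[OF _ _ ae2]) auto
  then have J2: "integrable lborel (\<lambda>r. indicator {0..} r * ?A r * F2 r)"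
    by (subst (asm) integrable_radial_iff) auto
  have f1: "indicator {0..} r * ?A r * F1 r = \<kappa> * (indicator {0..} r * (U r * (2 * r * deriv \<psi> (r\<^sup>2))))" if "r \<noteq> 0" for r
    using that coef1[of r] by (cases "r > 0") (auto simp: F1_def mult_ac)
  have f2: "indicator {0..} r * ?A r * F2 r = \<kappa> * (indicator {0..} r * (H r * \<psi> (r\<^sup>2)))" if "r \<noteq> 0" for r
    using that coef2[of r] by (cases "r > 0") (auto simp: F2_def mult_ac)
  have af1: "AE r in lborel. indicator {0..} r * ?A r * F1 r = \<kappa> * (indicator {0..} r * (U r * (2 * r * deriv \<psi> (r\<^sup>2))))"
    using AE_lborel_singleton[of "0 :: real"] by eventually_elim (rule f1)
  have af2: "AE r in lborel. indicator {0..} r * ?A r * F2 r = \<kappa> * (indicator {0..} r * (H r * \<psi> (r\<^sup>2)))"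
    using AE_lborel_singleton[of "0 :: real"] by eventually_elim (rule f2)
  have K1: "integrable lborel (\<lambda>r. indicator {0..} r * (U r * (2 * r * deriv \<psi> (r\<^sup>2))))"
    using J1 \<kappa> by (subst (asm) integrable_cong_AE[OF _ _ af1]) auto
  have K2: "integrable lborel (\<lambda>r. indicator {0..} r * (H r * \<psi> (r\<^sup>2)))"
    using J2 \<kappa> by (subst (asm) integrable_cong_AE[OF _ _ af2]) auto
  have eq': "(\<integral>r. indicator {0..} r * (U r * (2 * r * deriv \<psi> (r\<^sup>2))) \<partial>lborel) = - (\<integral>r. indicator {0..} r * (H r * \<psi> (r\<^sup>2)) \<partial>lborel)"
  proof -
    have "\<kappa> * (\<integral>r. indicator {0..} r * (U r * (2 * r * deriv \<psi> (r\<^sup>2))) \<partial>lborel) = 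
        \<kappa> * - (\<integral>r. indicator {0..} r * (H r * \<psi> (r\<^sup>2)) \<partial>lborel)"
      using eq integral_cong_AE[OF _ _ af1] integral_cong_AE[OF _ _ af2] by simp
    then show ?thesis using \<kappa> by (subst (asm) mult_left_cancel) auto
  qed
  have cont\<psi>: "continuous_on S (\<lambda>r. \<psi> (r\<^sup>2))" "continuous_on S (\<lambda>r. deriv \<psi> (r\<^sup>2))" for S
    using DERIV_isCont[OF DERIV_comp_sq[OF smooth_DERIV[OF \<psi>(1)]]]
      DERIV_isCont[OF DERIV_comp_sq[OF smooth_DERIV[OF smooth_deriv[OF \<psi>(1)]]]]
    by (auto intro: continuous_at_imp_continuous_on)
  have out: "\<psi> (r\<^sup>2) = 0" if "r \<ge> 0" "r \<notin> {a..s}" for r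
  proof (cases "r < a")
    case True then show ?thesis using that by (intro \<psi>(6) power_mono) auto
  next
    case False then show ?thesis using that as by (intro \<psi>(7) power_mono) auto
  qed
  have out': "deriv \<psi> (r\<^sup>2) = 0" if "r \<ge> 0" "r \<notin> {a..s}" for r
  proof (cases "r < a")
    case True
    then have "r\<^sup>2 < a\<^sup>2" using that by (intro power_strict_mono) auto
    then have "eventually (\<lambda>x. x < a\<^sup>2) (nhds (r\<^sup>2))"
      by (simp add: eventually_nhds_in_open[of "{..<a\<^sup>2}", simplified])
    then have "eventually (\<lambda>x. 0 = \<psi> x) (nhds (r\<^sup>2))"
      by eventually_elim (simp add: \<psi>(6))
    from DERIV_cong_ev[OF refl this refl, of 0] show ?thesis
      by (simp add: DERIV_imp_deriv)
  next
    case False then show ?thesis using that as by (intro \<psi>'0 power_mono) auto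
  qed
  have K3: "integrable lborel (\<lambda>r. indicator {a..s} r * (\<psi> (r\<^sup>2) / r))"
    by (rule integrable_indicator_continuous) (use \<psi>(2) in \<open>auto intro!: continuous_intros cont\<psi>\<close>)
  have K4: "integrable lborel (\<lambda>r. indicator {a..s} r * (ln r * (2 * r * deriv \<psi> (r\<^sup>2))))"
    by (rule integrable_indicator_continuous) (use \<psi>(2) in \<open>auto intro!: continuous_intros cont\<psi>\<close>)
  \<comment> \<open>Integration by parts through the primitive ln r \<psi>(r^2); the boundary terms
    vanish because \<psi> is 0 at a^2 and at s^2.\<close>
  have "(\<integral>r. (\<psi> (r\<^sup>2) / r + ln r * (2 * r * deriv \<psi> (r\<^sup>2))) * indicator {a..s} r \<partial>lborel) = ln s * \<psi> (s\<^sup>2) - ln a * \<psi> (a\<^sup>2)"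
  proof (rule integral_FTC_Icc_real)
    fix r assume r: "a \<le> r" "r \<le> s"
    then have "r > 0" using \<psi>(2) by simp
    then show "((\<lambda>r. ln r * \<psi> (r\<^sup>2)) has_real_derivative \<psi> (r\<^sup>2) / r + ln r * (2 * r * deriv \<psi> (r\<^sup>2))) (at r)"
      by (auto intro!: derivative_eq_intros DERIV_comp_sq[OF smooth_DERIV[OF \<psi>(1)]])
    show "isCont (\<lambda>r. \<psi> (r\<^sup>2) / r + ln r * (2 * r * deriv \<psi> (r\<^sup>2))) r"
      using \<open>r > 0\<close> DERIV_isCont[OF DERIV_comp_sq[OF smooth_DERIV[OF \<psi>(1)]]]
        DERIV_isCont[OF DERIV_comp_sq[OF smooth_DERIV[OF smooth_deriv[OF \<psi>(1)]]]]
      by (intro continuous_intros) auto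
  qed (use \<psi> in auto)
  also have "\<dots> = 0" by (simp add: \<psi>)
  also have "(\<integral>r. (\<psi> (r\<^sup>2) / r + ln r * (2 * r * deriv \<psi> (r\<^sup>2))) * indicator {a..s} r \<partial>lborel) = 
     (\<integral>r. indicator {a..s} r * (\<psi> (r\<^sup>2) / r) \<partial>lborel) + (\<integral>r. indicator {a..s} r * (ln r * (2 * r * deriv \<psi> (r\<^sup>2))) \<partial>lborel)"
    by (subst Bochner_Integration.integral_add[OF K3 K4, symmetric]) (simp add: algebra_simps)
  finally have parts: "(\<integral>r. indicator {a..s} r * (ln r * (2 * r * deriv \<psi> (r\<^sup>2))) \<partial>lborel) = 
      - (\<integral>r. indicator {a..s} r * (\<psi> (r\<^sup>2) / r) \<partial>lborel)" by simp
  \<comment> \<open>This is where the flux bound enters: (-H - c / r) \<psi>(r^2) is nonnegative on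
    the support of \<psi>(r^2).\<close>
  have "0 \<le> (\<integral>r. - (indicator {0..} r * (H r * \<psi> (r\<^sup>2))) - c * (indicator {a..s} r * (\<psi> (r\<^sup>2) / r)) \<partial>lborel)"
  proof (rule integral_nonneg_AE)
    show "AE r in lborel. 0 \<le> - (indicator {0..} r * (H r * \<psi> (r\<^sup>2))) - c * (indicator {a..s} r * (\<psi> (r\<^sup>2) / r))"
      using c
    proof eventually_elim
      case (elim r)
      show ?case
      proof (cases "r \<in> {a..s}")
        case True
        then have r: "0 < r" "r < \<rho>" using \<psi>(2,4) by auto
        then have "c / r \<le> - H r" using elim by (simp add: pos_divide_le_eq)
        then have "c / r * \<psi> (r\<^sup>2) \<le> - H r * \<psi> (r\<^sup>2)" by (intro mult_right_mono \<psi>(5))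
        then show ?thesis using True r by simp
      next
        case False
        then show ?thesis using out[of r] by (cases "r \<ge> 0") auto
      qed
    qed
  qed
  also have "\<dots> = (\<integral>r. indicator {0..} r * (U r * (2 * r * deriv \<psi> (r\<^sup>2))) \<partial>lborel) + 
      c * (\<integral>r. indicator {a..s} r * (ln r * (2 * r * deriv \<psi> (r\<^sup>2))) \<partial>lborel)"
    unfolding eq' parts
    by (subst Bochner_Integration.integral_diff[OF Bochner_Integration.integrable_minus[OF K2] integrable_mult_right[OF K3]])
      (simp only: integral_minus integral_mult_right_zero mult_minus_right diff_conv_add_uminus)
  also have "\<dots> = (\<integral>r. indicator {0..} r * (U r * (2 * r * deriv \<psi> (r\<^sup>2))) + c * (indicator {a..s} r * (ln r * (2 * r * deriv \<psi> (r\<^sup>2)))) \<partial>lborel)"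
    by (subst Bochner_Integration.integral_add[OF K1 integrable_mult_right[OF K4]])
      (simp only: integral_mult_right_zero)
  also have "\<dots> = (\<integral>r. indicator {0..} r * ((U r + c * ln r) * (2 * r * deriv \<psi> (r\<^sup>2))) \<partial>lborel)"
  proof (intro Bochner_Integration.integral_cong refl)
    fix r
    show "indicator {0..} r * (U r * (2 * r * deriv \<psi> (r\<^sup>2))) + c * (indicator {a..s} r * (ln r * (2 * r * deriv \<psi> (r\<^sup>2)))) = 
       indicator {0..} r * ((U r + c * ln r) * (2 * r * deriv \<psi> (r\<^sup>2)))"
      using out'[of r] \<psi>(2) by (cases "r \<in> {a..s}"; cases "r \<ge> 0") (auto simp: algebra_simps)
  qed
  finally show ?thesis .
qed

section \<open>Passing from Lebesgue to Borel representatives\<close>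

text \<open>The problem is posed for Lebesgue measurable functions, while Fubini, image measures and
  mollifications above are carried out with Borel functions.\<close>

lemma lebesgue_borel_representative_real:
  fixes w :: "'a::euclidean_space \<Rightarrow> real"
  assumes "integrable lebesgue w"
  shows "\<exists>w0. integrable lborel w0 \<and> (AE x in lborel. w x = w0 x)"
proof -
  obtain w0 where w0: "w0 \<in> borel_measurable lborel" "AE x in lborel. w x = w0 x"
    using completion_ex_borel_measurable_real[of w lborel] assms by auto
  have m: "w0 \<in> borel_measurable lebesgue" using w0(1) by (rule measurable_completion)
  have "integrable lebesgue w0"
    using assms integrable_cong_AE[OF _ m AE_completion[OF w0(2)]] by auto
  then have "integrable lborel w0" using integrable_completion[OF w0(1)] by simp
  with w0(2) show ?thesis by blast
qed

lemma lebesgue_borel_representative: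
  fixes w :: "'a::euclidean_space \<Rightarrow> real ^ 'n"
  assumes "integrable lebesgue w"
  shows "\<exists>w0. integrable lborel w0 \<and> (AE x in lborel. w x = w0 x)"
proof -
  have "\<exists>w0. integrable lborel w0 \<and> (AE x in lborel. w x $ i = w0 x)" for i
    using integrable_bounded_linear[OF bounded_linear_vec_nth assms]
    by (rule lebesgue_borel_representative_real)
  then obtain W where W: "\<And>i. integrable lborel (W i)" "\<And>i. AE x in lborel. w x $ i = W i x" by metis
  have "(\<lambda>x. \<chi> i. W i x) = (\<lambda>x. \<Sum>i\<in>UNIV. W i x *\<^sub>R axis i 1)"
    by (intro ext) (simp add: vec_eq_iff axis_def if_distrib cong: if_cong)
  moreover have "integrable lborel (\<lambda>x. \<Sum>i\<in>UNIV. W i x *\<^sub>R axis i (1::real))"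
    by (intro Bochner_Integration.integrable_sum integrable_scaleR_left W)
  moreover have "AE x in lborel. \<forall>i. w x $ i = W i x"
    using W(2) by (intro AE_finite_allI[of UNIV, simplified]) auto
  then have "AE x in lborel. w x = (\<chi> i. W i x)"
    by eventually_elim (simp add: vec_eq_iff)
  ultimately show ?thesis by (intro exI[of _ "\<lambda>x. \<chi> i. W i x"]) simp
qed

text \<open>Measurability of \<open>F\<close> comes for free: Lebesgue measure is complete and
  \<open>F\<close> agrees almost everywhere with a Borel function.\<close>

lemma integral_lebesgue_eq_lborel:
  fixes F :: "'a::euclidean_space \<Rightarrow> real"
  assumes F0: "F0 \<in> borel_measurable borel" and ae: "AE x in lborel. F x = F0 x"
  shows "(LINT x|lebesgue. F x) = (LINT x|lborel. F0 x)"
proof -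
  have m: "F0 \<in> borel_measurable lborel" using F0 by simp
  have m': "F0 \<in> borel_measurable lebesgue" using m by (rule measurable_completion)
  have ae': "AE x in lebesgue. F0 x = F x"
    using AE_completion[OF ae] by eventually_elim simp
  have F: "F \<in> borel_measurable lebesgue" by (rule borel_measurable_AE[OF m' ae'])
  have "(LINT x|lebesgue. F x) = (LINT x|lebesgue. F0 x)"
    by (rule integral_cong_AE[OF F m' AE_completion[OF ae]])
  also have "\<dots> = (LINT x|lborel. F0 x)" by (rule integral_completion[OF m])
  finally show ?thesis .
qed

section \<open>Support and measurability of test functions\<close>

lemma test_functions_mono: "\<phi> \<in> test_functions A \<Longrightarrow> A \<subseteq> B \<Longrightarrow> \<phi> \<in> test_functions B"
  unfolding test_functions_def by blast

text \<open>A point outside \<Omega> lies in the open complement of the support, so the function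
  vanishes on a whole neighbourhood and its derivative vanishes too.\<close>

lemma test_functions_outside:
  assumes "\<phi> \<in> test_functions \<Omega>" "x \<notin> \<Omega>"
  shows "\<phi> x = 0" "partial_deriv i \<phi> x = 0"
proof -
  let ?S = "closure {x. \<phi> x \<noteq> 0}"
  have x: "x \<notin> ?S" using assms unfolding test_functions_def by blast
  then show "\<phi> x = 0" using closure_subset[of "{x. \<phi> x \<noteq> 0}"] by blast
  have "(\<phi> has_derivative (\<lambda>_. 0)) (at x)"
  proof (rule has_derivative_transform_within_open[of "\<lambda>_. 0"])
    show "open (- ?S)" by (rule open_Compl[OF closed_closure])
    show "0 = \<phi> y" if "y \<in> - ?S" for y
    proof -
      have "\<phi> y = 0" using that closure_subset[of "{x. \<phi> x \<noteq> 0}"] by blast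
      then show ?thesis by simp
    qed
  qed (use x in auto)
  then show "partial_deriv i \<phi> x = 0" by (simp add: partial_deriv_eqI)
qed

lemma test_functions_measurable:
  assumes "\<phi> \<in> test_functions \<Omega>"
  shows "\<phi> \<in> borel_measurable borel" "partial_deriv i \<phi> \<in> borel_measurable borel"
    "grad \<phi> \<in> borel_measurable borel"
proof -
  have C: "C_k k \<phi>" for k using assms unfolding test_functions_def by blast
  show "\<phi> \<in> borel_measurable borel"
    using C[of 0] by (intro borel_measurable_continuous_onI) simp
  have c: "continuous_on UNIV (partial_deriv i \<phi>)" for i
    using C[of "Suc 0"] by simp
  then show "partial_deriv i \<phi> \<in> borel_measurable borel"
    by (intro borel_measurable_continuous_onI)
  have "continuous_on UNIV (grad \<phi>)"
    unfolding grad_def[abs_def] by (rule continuous_on_vec_lambda) (rule c)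
  then show "grad \<phi> \<in> borel_measurable borel"
    by (rule borel_measurable_continuous_onI)
qed

section \<open>From a logarithmic lower bound on u to the growth of f\<close>

lemma cond_f2_power_bound:
  assumes f2: "cond_f2 N f" and f0: "\<forall>t\<ge>0. f t \<ge> 0" and N: "N \<ge> 1"
  obtains \<delta> T where "\<delta> > 0" "T \<ge> 0" "\<And>t. t \<ge> 0 \<Longrightarrow> t ^ (N - 1) \<le> f t / \<delta> + T"
proof -
  \<comment> \<open>Any positive real below the liminf will do; the liminf itself may be
    infinite.\<close>
  obtain d where d: "0 < ereal d" "ereal d < Liminf at_top (\<lambda>t. ereal (f t * t powr (1 - real N)))"
    using ereal_dense2[OF f2[unfolded cond_f2_def]] by auto
  have "eventually (\<lambda>t. ereal d < ereal (f t * t powr (1 - real N))) at_top"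
    using less_LiminfD[OF d(2)] .
  then have "eventually (\<lambda>t. d < f t * t powr (1 - real N)) at_top" by simp
  then obtain T where T: "\<And>t. t \<ge> T \<Longrightarrow> d < f t * t powr (1 - real N)"
    unfolding eventually_at_top_linorder by blast
  \<comment> \<open>Taking at least 1 keeps t positive where t^(N-1) is divided out; below this
    threshold the constant T'^(N-1) alone bounds the power.\<close>
  define T' where "T' = max T 1"
  have d0: "d > 0" using d by simp
  show ?thesis
  proof (rule that[OF d0])
    show "0 \<le> T' ^ (N - 1)" by (simp add: T'_def)
    fix t :: real assume t: "t \<ge> 0"
    show "t ^ (N - 1) \<le> f t / d + T' ^ (N - 1)"
    proof (cases "t \<ge> T'")
      case True
      then have t1: "t > 0" "t \<ge> T" by (auto simp: T'_def)
      have "1 - real N = - real (N - 1)" using N by (simp add: of_nat_diff)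
      then have "t powr (1 - real N) = 1 / t ^ (N - 1)"
        using t1 by (simp only: powr_minus_divide powr_realpow)
      with T[OF t1(2)] have "d < f t / t ^ (N - 1)" by simp
      then have "d * t ^ (N - 1) < f t" using t1 by (simp add: pos_less_divide_eq)
      then have "t ^ (N - 1) \<le> f t / d" using d0 by (simp add: pos_le_divide_eq mult.commute)
      moreover have "0 \<le> T' ^ (N - 1)" by (simp add: T'_def)
      ultimately show ?thesis by linarith
    next
      case False
      then have "t ^ (N - 1) \<le> T' ^ (N - 1)" using t by (intro power_mono) auto
      moreover have "0 \<le> f t / d" using f0 t d0 by simp
      ultimately show ?thesis by linarith
    qed
  qed
qed

text \<open>Under the substitution t = C - c ln r, the volume of the ball of radius r decays like
  exp (- N t / c); a fixed bound on M(t) times this volume becomes an exponential bound on f <=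
  M.\<close>

lemma sub_exponential_of_log_bound:
  fixes u :: "real ^ 'n \<Rightarrow> real"
  assumes f0: "\<forall>t\<ge>0. f t \<ge> 0" and f2: "cond_f2 CARD('n) f" and f3: "cond_f3 CARD('n) f"
    and "c > 0" "\<rho> > 0"
    and u0: "AE x in lebesgue. x \<in> ball 0 \<rho> \<longrightarrow> 0 \<le> u x"
    and int: "set_integrable lebesgue (ball 0 \<rho>) (\<lambda>x. f (u x))"
    and lb: "AE x in lebesgue. 0 < norm x \<and> norm x < \<rho> \<longrightarrow> C - c * ln (norm x) \<le> u x"
  shows "sub_exponential f"
proof -
  let ?N = "CARD('n)"
  obtain \<kappa> where \<kappa>: "\<kappa> > 0" "mono_on {0..} (\<lambda>t. f t + \<kappa> * t ^ (?N - 1))"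
    using f3 unfolding cond_f3_def by blast
  define M where "M t = f t + \<kappa> * t ^ (?N - 1)" for t
  have M: "M s \<le> M t" if "0 \<le> s" "s \<le> t" for s t
    using monotone_onD[OF \<kappa>(2), of s t] that by (simp add: M_def)
  have fM: "f t \<le> M t" if "0 \<le> t" for t using \<kappa>(1) that by (simp add: M_def)
  obtain \<delta> T where \<delta>: "\<delta> > 0" "T \<ge> 0" "\<And>t. t \<ge> 0 \<Longrightarrow> t ^ (?N - 1) \<le> f t / \<delta> + T"
    by (rule cond_f2_power_bound[OF f2 f0]) auto
  define A where "A = 1 + \<kappa> / \<delta>"
  have MA: "M t \<le> A * f t + \<kappa> * T" if "t \<ge> 0" for t
    using mult_left_mono[OF \<delta>(3)[OF that], of \<kappa>] \<kappa>(1) by (simp add: M_def A_def algebra_simps)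
  \<comment> \<open>The integrand dominates M(u) but is affine in f(u), whose integrability is
    given, so integrability of u^(N-1) never has to be discussed.\<close>
  define K where "K = (LINT x|lebesgue. indicator (ball (0 :: real ^ 'n) \<rho>) x * (A * f (u x) + \<kappa> * T))"
  have indI: "integrable lebesgue (\<lambda>x::real ^ 'n. indicator (ball 0 r) x * k)" if "r > 0" for r k :: real
  proof -
    have "integrable lborel (\<lambda>x::real ^ 'n. indicator (ball 0 r) x * k)"
      using that by (intro integrable_mult_left) (simp add: integrable_indicator_iff emeasure_ball)
    then show ?thesis by (subst integrable_completion) auto
  qed
  have KI: "integrable lebesgue (\<lambda>x. indicator (ball (0 :: real ^ 'n) \<rho>) x * (A * f (u x) + \<kappa> * T))"
  proof -
    have "integrable lebesgue (\<lambda>x. A * (indicator (ball (0 :: real ^ 'n) \<rho>) x * f (u x)) + indicator (ball (0 :: real ^ 'n) \<rho>) x * (\<kappa> * T))"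
      using int indI[OF \<open>\<rho> > 0\<close>] unfolding set_integrable_def
      by (intro Bochner_Integration.integrable_add integrable_mult_right) auto
    then show ?thesis by (simp add: algebra_simps)
  qed
  have A1: "A \<ge> 1" using \<kappa>(1) \<delta>(1) by (simp add: A_def)
  define V where "V = unit_ball_vol (real ?N)"
  have V: "V > 0" by (simp add: V_def)
  have key: "M (C - c * ln r) * (V * r ^ ?N) \<le> K" if r: "0 < r" "r < \<rho>" "0 \<le> C - c * ln r" for r
  proof -
    have "M (C - c * ln r) * (V * r ^ ?N) = (LINT x|lborel. indicator (ball (0 :: real ^ 'n) r) x * M (C - c * ln r))"
      using r by (simp add: content_ball V_def)
    also have "\<dots> = (LINT x|lebesgue. indicator (ball (0 :: real ^ 'n) r) x * M (C - c * ln r))"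
      by (rule integral_completion[symmetric])
        (intro borel_measurable_times borel_measurable_indicator borel_measurable_const, simp)
    also have "\<dots> \<le> K"
      unfolding K_def
    proof (rule integral_mono_AE[OF indI[OF r(1)] KI])
      have "AE x in lebesgue. x \<noteq> (0 :: real ^ 'n)"
        by (rule AE_completion[OF AE_lborel_singleton])
      with u0 lb show "AE x in lebesgue. indicator (ball (0 :: real ^ 'n) r) x * M (C - c * ln r) 
        \<le> indicator (ball 0 \<rho>) x * (A * f (u x) + \<kappa> * T)"
      proof eventually_elim
        case (elim x)
        show ?case
        proof (cases "norm x < \<rho>")
          case True
          then have ux: "0 \<le> u x" using elim by simp
          have nn: "0 \<le> A * f (u x) + \<kappa> * T" using A1 f0 ux \<kappa>(1) \<delta>(2) by simp
          show ?thesis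
          proof (cases "norm x < r")
            case r': True
            have "ln (norm x) \<le> ln r" using r' elim r by simp
            then have "c * ln (norm x) \<le> c * ln r" using \<open>c > 0\<close> by simp
            moreover have "C - c * ln (norm x) \<le> u x" using elim True by simp
            ultimately have "C - c * ln r \<le> u x" by linarith
            then have "M (C - c * ln r) \<le> A * f (u x) + \<kappa> * T"
              using M[OF r(3)] MA[OF ux] by fastforce
            then show ?thesis using r' True by simp
          qed (use nn True in simp)
        qed (use r in simp)
      qed
    qed
    finally show ?thesis .
  qed
  \<comment> \<open>Beyond \<open>T0\<close> the argument t is nonnegative, where \<open>M\<close>
    is monotone, and the corresponding radius is at most \<rho>/2, hence inside the ball.\<close>
  define T0 where "T0 = max 0 (C - c * ln (\<rho> / 2))"
  define \<beta> where "\<beta> = real ?N / c"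
  have \<beta>: "\<beta> > 0" using \<open>c > 0\<close> by (simp add: \<beta>_def)
  have big: "f t * exp (- \<beta> * t) \<le> K / V * exp (- \<beta> * C)" if t: "t \<ge> T0" for t
  proof -
    \<comment> \<open>The radius at which the logarithmic lower bound takes the value t.\<close>
    define r where "r = exp ((C - t) / c)"
    have lr: "C - c * ln r = t" using \<open>c > 0\<close> by (simp add: r_def)
    have r: "r > 0" by (simp add: r_def)
    have "C - c * ln (\<rho> / 2) \<le> C - c * ln r" using t lr by (simp add: T0_def)
    then have "ln r \<le> ln (\<rho> / 2)" using \<open>c > 0\<close> by simp
    then have "r \<le> \<rho> / 2" using r \<open>\<rho> > 0\<close> by simp
    then have "M t * (V * r ^ ?N) \<le> K"
      using key[of r] r lr t \<open>\<rho> > 0\<close> by (simp add: T0_def)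
    moreover have "f t * (V * r ^ ?N) \<le> M t * (V * r ^ ?N)"
      using fM[of t] t V r by (intro mult_right_mono) (auto simp: T0_def)
    moreover have "r ^ ?N = exp (\<beta> * C) * exp (- \<beta> * t)"
      using \<open>c > 0\<close> by (simp add: r_def \<beta>_def exp_add[symmetric] exp_of_nat_mult[symmetric] field_simps)
    ultimately have "f t * exp (- \<beta> * t) * (V * exp (\<beta> * C)) \<le> K" by (simp add: mult_ac)
    then have "f t * exp (- \<beta> * t) \<le> K / (V * exp (\<beta> * C))"
      using V by (subst pos_le_divide_eq) auto
    then show ?thesis by (simp add: exp_minus divide_inverse)
  qed
  \<comment> \<open>On the bounded range monotonicity of \<open>M\<close> replaces any compactness
    argument: f(t) <= M(t) <= M(T0).\<close>
  have small: "f t * exp (- \<beta> * t) \<le> M T0" if t: "0 \<le> t" "t \<le> T0" for t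
  proof -
    have "f t * exp (- \<beta> * t) \<le> f t * 1"
      using f0 t \<beta> by (intro mult_left_mono) auto
    also have "\<dots> \<le> M T0" using fM[OF t(1)] M[OF t] by simp
    finally show ?thesis .
  qed
  have "bdd_above ((\<lambda>t. f t * exp (- \<beta> * t)) ` {0..})"
  proof (rule bdd_aboveI2)
    fix t :: real assume "t \<in> {0..}"
    then show "f t * exp (- \<beta> * t) \<le> max (M T0) (K / V * exp (- \<beta> * C))"
      using big[of t] small[of t] by (cases "t \<ge> T0") auto
  qed
  with \<beta> show ?thesis unfolding sub_exponential_def by blast
qed

section \<open>Localisation and conclusion\<close>

lemma integrable_indicator_of_Lp_loc:
  fixes w :: "real ^ 'n \<Rightarrow> 'b::euclidean_space"
  assumes "Lp_loc 1 S w" "compact K" "K \<subseteq> S"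
  shows "integrable lebesgue (\<lambda>x. indicator K x *\<^sub>R w x)"
proof (rule integrable_norm_cancel)
  have *: "set_borel_measurable lebesgue K w" "set_integrable lebesgue K (\<lambda>x. norm (w x) ^ 1)"
    using assms unfolding Lp_loc_def by blast+
  show "(\<lambda>x. indicator K x *\<^sub>R w x) \<in> borel_measurable lebesgue"
    using *(1) unfolding set_borel_measurable_def .
  have "integrable lebesgue (\<lambda>x. indicator K x *\<^sub>R norm (w x) ^ 1)"
    using *(2) unfolding set_integrable_def .
  then show "integrable lebesgue (\<lambda>x. norm (indicator K x *\<^sub>R w x))" by simp
qed

theorem lemma4p1:
  fixes f :: "real \<Rightarrow> real" and u :: "real ^ 'n \<Rightarrow> real" and R \<alpha> :: real
  assumes "CARD('n) \<ge> 2"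
    and "R > 0"
    and "\<forall>t\<ge>0. f t \<ge> 0"
    and "cond_f1 f"
    and "cond_f2 CARD('n) f"
    and "cond_f3 CARD('n) f"
    and "super_exponential f"
    and "solves_P_star f R u"
    and "\<alpha> \<ge> 0"
    and "solves_P_alpha f \<alpha> R u"
  shows "\<alpha> = 0"
proof (rule ccontr)
  assume "\<alpha> \<noteq> 0"
  with \<open>\<alpha> \<ge> 0\<close> have \<alpha>: "\<alpha> > 0" by simp
  let ?N = "CARD('n)" and ?B = "ball (0 :: real ^ 'n) R"
  obtain g where g: "AE x in lebesgue. x \<in> ?B - {0} \<longrightarrow> u x = g (norm x)"
    using assms(8) unfolding solves_P_star_def radial_on_def Let_def by blast
  obtain v where nonneg: "AE x in lebesgue. x \<in> ?B \<longrightarrow> 0 \<le> u x"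
    and fu: "set_integrable lebesgue ?B (\<lambda>x. f (u x))"
    and v: "has_weak_gradient ?B u v" "Lp_loc (?N - 1) ?B v"
    and eqn: "\<And>\<phi>. \<phi> \<in> test_functions ?B \<Longrightarrow> (LINT x:?B|lebesgue. N_flux (v x) \<bullet> grad \<phi> x)
               = (LINT x:?B|lebesgue. f (u x) * \<phi> x) + \<alpha> * \<phi> 0"
    using assms(10) unfolding solves_P_alpha_def Let_def by blast
  \<comment> \<open>The integrability of \<open>u\<close> and \<open>v\<close> is only local in the
    open ball; on a smaller closed ball, which is compact, it becomes global.\<close>
  define \<rho> where "\<rho> = R / 2"
  have \<rho>: "0 < \<rho>" "\<rho> < R" using \<open>R > 0\<close> by (auto simp: \<rho>_def)
  let ?K = "cball (0 :: real ^ 'n) \<rho>"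
  have K: "compact ?K" "?K \<subseteq> ?B" using \<rho> by auto
  have Lp: "Lp_loc 1 ?B u" "Lp_loc 1 ?B v" using v(1) unfolding has_weak_gradient_def by auto
  have weak: "(LINT x:?B|lebesgue. u x * partial_deriv i \<phi> x) = - (LINT x:?B|lebesgue. (v x $ i) * \<phi> x)"
    if "\<phi> \<in> test_functions ?B" for \<phi> i
    using v(1) that unfolding has_weak_gradient_def by blast
  \<comment> \<open>\<open>u0\<close> and \<open>w0\<close> are Borel versions of \<open>u\<close>
    and \<open>v\<close> cut off outside the closed ball of radius \<rho>. They are integrable on
    the whole space, as the mollification lemmas demand.\<close>
  obtain u0 where u0: "integrable lborel u0" "AE x in lborel. indicator ?K x *\<^sub>R u x = u0 x"
    using lebesgue_borel_representative_real[OF integrable_indicator_of_Lp_loc[OF Lp(1) K]] by auto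
  obtain w0 where w0: "integrable lborel w0" "AE x in lborel. indicator ?K x *\<^sub>R v x = w0 x"
    using lebesgue_borel_representative[OF integrable_indicator_of_Lp_loc[OF Lp(2) K]] by auto
  have [measurable]: "u0 \<in> borel_measurable borel" "w0 \<in> borel_measurable borel"
    using borel_measurable_integrable[OF u0(1)] borel_measurable_integrable[OF w0(1)] by auto

  \<comment> \<open>The cut-off is itself radial, and the excluded origin is a null set.\<close>
  have gK: "AE x in lborel. u0 x = (if norm x \<le> \<rho> then g (norm x) else 0)"
    using u0(2) g[unfolded AE_completion_iff] AE_lborel_singleton[of "0 :: real ^ 'n"]
  proof eventually_elim
    case (elim x)
    then show ?case using \<rho> by (cases "norm x \<le> \<rho>") (simp_all add: dist_norm)
  qed

  have weak0: "(\<integral>x. u0 x * partial_deriv i \<phi> x \<partial>lborel) = - (\<integral>x. w0 x $ i * \<phi> x \<partial>lborel)"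
    if \<phi>: "\<phi> \<in> test_functions (ball 0 \<rho>)" for \<phi> i
  proof -
    note [measurable] = test_functions_measurable[OF \<phi>]
    note out = test_functions_outside[OF \<phi>]
    have "(LINT x:?B|lebesgue. u x * partial_deriv i \<phi> x) = (\<integral>x. u0 x * partial_deriv i \<phi> x \<partial>lborel)"
      unfolding set_lebesgue_integral_def
    proof (rule integral_lebesgue_eq_lborel)
      show "AE x in lborel. indicator ?B x *\<^sub>R (u x * partial_deriv i \<phi> x) = u0 x * partial_deriv i \<phi> x"
        using u0(2)
      proof eventually_elim
        case (elim x)
        then show ?case using out(2)[of x i] \<rho> by (cases "norm x < \<rho>") auto
      qed
    qed measurable
    moreover have "(LINT x:?B|lebesgue. (v x $ i) * \<phi> x) = (\<integral>x. w0 x $ i * \<phi> x \<partial>lborel)"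
      unfolding set_lebesgue_integral_def
    proof (rule integral_lebesgue_eq_lborel)
      show "AE x in lborel. indicator ?B x *\<^sub>R (v x $ i * \<phi> x) = w0 x $ i * \<phi> x"
        using w0(2)
      proof eventually_elim
        case (elim x)
        then show ?case using out(1)[of x] \<rho> by (cases "norm x < \<rho>") auto
      qed
      show "(\<lambda>x. w0 x $ i * \<phi> x) \<in> borel_measurable borel"
        using borel_measurable_integrable[OF integrable_bounded_linear[OF bounded_linear_vec_nth w0(1)], of i]
          test_functions_measurable(1)[OF \<phi>] by (intro borel_measurable_times) auto
    qed
    moreover have "\<phi> \<in> test_functions ?B"
      using \<phi> \<rho> by (auto intro: test_functions_mono)
    ultimately show ?thesis using weak[of \<phi> i] by simp
  qed

  have flux0: "\<alpha> * \<phi> 0 \<le> (\<integral>x. N_flux (w0 x) \<bullet> grad \<phi> x \<partial>lborel)"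
    if \<phi>: "\<phi> \<in> test_functions (ball 0 \<rho>)" "\<And>x. 0 \<le> \<phi> x" for \<phi>
  proof -
    note [measurable] = test_functions_measurable[OF \<phi>(1)]
    note out = test_functions_outside[OF \<phi>(1)]
    have "(LINT x:?B|lebesgue. N_flux (v x) \<bullet> grad \<phi> x) = (\<integral>x. N_flux (w0 x) \<bullet> grad \<phi> x \<partial>lborel)"
      unfolding set_lebesgue_integral_def
    proof (rule integral_lebesgue_eq_lborel)
      show "AE x in lborel. indicator ?B x *\<^sub>R (N_flux (v x) \<bullet> grad \<phi> x) = N_flux (w0 x) \<bullet> grad \<phi> x"
        using w0(2)
      proof eventually_elim
        case (elim x)
        show ?case
        proof (cases "norm x < \<rho>")
          case True
          then show ?thesis using elim \<rho> by simp
        next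
          case False
          then have "grad \<phi> x = 0" using out(2)[of x] by (simp add: vec_eq_iff grad_nth)
          then show ?thesis by simp
        qed
      qed
      show "(\<lambda>x. N_flux (w0 x) \<bullet> grad \<phi> x) \<in> borel_measurable borel"
        unfolding N_flux_def by measurable
    qed
    moreover have "\<phi> \<in> test_functions ?B"
      using \<phi> \<rho> by (auto intro: test_functions_mono)
    \<comment> \<open>The reaction term is nonnegative for nonnegative test functions; dropping it
      leaves the one-sided flux inequality.\<close>
    moreover have "0 \<le> (LINT x:?B|lebesgue. f (u x) * \<phi> x)"
      unfolding set_lebesgue_integral_def
    proof (rule integral_nonneg_AE)
      show "AE x in lebesgue. 0 \<le> indicator ?B x *\<^sub>R (f (u x) * \<phi> x)"
        using nonneg
      proof eventually_elim
        case (elim x)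
        then show ?case using assms(3) \<phi>(2) by (cases "x \<in> ?B") auto
      qed
    qed
    ultimately show ?thesis using eqn[of \<phi>] by simp
  qed

  have wN: "integrable lborel (\<lambda>x. norm (w0 x) ^ (?N - 1))"
  proof -
    have m: "(\<lambda>x. norm (w0 x) ^ (?N - 1)) \<in> borel_measurable lborel" by measurable
    \<comment> \<open>Outside the closed ball the cut-off field is 0, and 0^(N-1) = 0 requires a
      nonzero exponent.\<close>
    have N0: "?N - 1 \<noteq> 0" using assms(1) by simp
    have "AE x in lborel. indicator ?K x *\<^sub>R norm (v x) ^ (?N - 1) = norm (w0 x) ^ (?N - 1)"
      using w0(2)
    proof eventually_elim
      case (elim x)
      show ?case unfolding elim[symmetric] using N0 by (cases "x \<in> ?K") (auto simp: zero_power)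
    qed
    from AE_completion[OF this]
    have ae: "AE x in lebesgue. indicator ?K x *\<^sub>R norm (v x) ^ (?N - 1) = norm (w0 x) ^ (?N - 1)" .
    have I: "integrable lebesgue (\<lambda>x. indicator ?K x *\<^sub>R norm (v x) ^ (?N - 1))"
      using v(2) K unfolding Lp_loc_def set_integrable_def by blast
    have "integrable lebesgue (\<lambda>x. norm (w0 x) ^ (?N - 1))"
      using I integrable_cong_AE[OF borel_measurable_integrable[OF I] measurable_completion[OF m] ae] by simp
    then show ?thesis unfolding integrable_completion[OF m] .
  qed

  obtain U where U: "U \<in> borel_measurable borel" "AE x in lborel. u0 x = U (norm x)"
    by (rule radial_borel_representative[OF u0(1) gK])
  obtain H where H: "H \<in> borel_measurable borel"
    "AE x in lborel. norm x < \<rho> \<longrightarrow> w0 x = (H (norm x) / norm x) *\<^sub>R x"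
  proof (rule radial_weak_gradient[OF u0(1) gK w0(1), of \<rho>])
    fix h and x :: "real ^ 'n" and s i
    assume h: "smooth h" "0 < s" "\<And>t. t \<ge> s\<^sup>2 \<Longrightarrow> h t = 0" "norm x + s < \<rho>"
    have "cball x s \<subseteq> ball 0 \<rho>"
    proof
      fix y assume "y \<in> cball x s"
      then have "norm (y - x) \<le> s" by (simp add: dist_norm norm_minus_commute)
      then have "norm y < \<rho>" using norm_triangle_ineq2[of y x] h(4) by linarith
      then show "y \<in> ball 0 \<rho>" by simp
    qed
    then have "(\<lambda>y. h ((norm (y - x))\<^sup>2)) \<in> test_functions (ball 0 \<rho>)"
      by (intro radial_test_function[OF h(1), of s]) (use h in auto)
    from weak0[OF this, of i]
    show "(\<integral>y. u0 y * (2 * (y - x) $ i * deriv h ((norm (y - x))\<^sup>2)) \<partial>lborel) = - (\<integral>y. w0 y $ i * h ((norm (y - x))\<^sup>2) \<partial>lborel)"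
      unfolding partial_deriv_radial[OF h(1)] .
  qed
  obtain c where c: "c > 0" "AE r in lborel. 0 < r \<and> r < \<rho> \<longrightarrow> c \<le> - (H r * r)"
    by (rule radial_flux_bound[OF assms(1) \<alpha> H(1) _ H(2) wN flux0]) auto
  obtain C \<rho>\<^sub>1 where C: "0 < \<rho>\<^sub>1" "AE r in lborel. 0 < r \<and> r < \<rho>\<^sub>1 \<longrightarrow> C - c * ln r \<le> U r"
  proof (rule log_lower_bound_of_bump_tests[OF U(1) \<rho>(1)])
    show "integrable lborel (\<lambda>r. indicator {a..b} r * U r)" if "0 < a" for a b
      by (rule integrable_radial_annulus[OF U(1) u0(1) U(2) that])
  next
    fix a s \<psi>
    assume \<psi>: "smooth \<psi>" "0 < a" "a < s" "s < \<rho>" "\<And>t. 0 \<le> \<psi> t" "\<And>t. t \<le> a\<^sup>2 \<Longrightarrow> \<psi> t = 0" "\<And>t. t \<ge> s\<^sup>2 \<Longrightarrow> \<psi> t = 0"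
    show "0 \<le> (\<integral>r. indicator {0..} r * ((U r + c * ln r) * (2 * r * deriv \<psi> (r\<^sup>2))) \<partial>lborel)"
      by (rule radial_weak_inequality[OF U(1) H(1) u0(1) U(2) w0(1) H(2) c(2) weak0 \<psi>])
  qed
  \<comment> \<open>The bound holds for \<open>U\<close> below \<open>\<rho>\<^sub>1\<close>; it
    concerns \<open>u\<close> itself only inside the ball of radius \<rho>, where the cut-off has no
    effect.\<close>
  define \<rho>\<^sub>2 where "\<rho>\<^sub>2 = min \<rho> \<rho>\<^sub>1"
  have "AE x in lborel. 0 < norm x \<and> norm x < \<rho>\<^sub>2 \<longrightarrow> C - c * ln (norm x) \<le> u x"
    using AE_radial[OF C(2)] U(2) u0(2)
  proof eventually_elim
    case (elim x)
    then show ?case by (auto simp: \<rho>\<^sub>2_def)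
  qed
  then have lb: "AE x in lebesgue. 0 < norm x \<and> norm x < \<rho>\<^sub>2 \<longrightarrow> C - c * ln (norm x) \<le> u x"
    by (rule AE_completion)
  have "sub_exponential f"
  proof (rule sub_exponential_of_log_bound[OF assms(3,5,6) c(1) _ _ _ lb])
    show "0 < \<rho>\<^sub>2" using \<rho> C(1) by (simp add: \<rho>\<^sub>2_def)
    show "AE x in lebesgue. x \<in> ball 0 \<rho>\<^sub>2 \<longrightarrow> 0 \<le> u x"
      using nonneg by eventually_elim (use \<rho> in \<open>auto simp: \<rho>\<^sub>2_def\<close>)
    show "set_integrable lebesgue (ball 0 \<rho>\<^sub>2) (\<lambda>x. f (u x))"
      by (rule set_integrable_subset[OF fu]) (use \<rho> in \<open>auto simp: \<rho>\<^sub>2_def\<close>)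
  qed
  with assms(7) show False unfolding super_exponential_def by blast
qed

end
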